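(* Let $n,p\ge1$, $L\ge m>0$, and let $A\in\mathbb{R}^{np\times np}$, $B\in\mathbb{R}^{np\times p}$, $C\in\mathbb{R}^{p\times np}$, $D\in\mathbb{R}^{p\times np}$, $D^\dagger\in\mathbb{R}^{np\times p}$ be given with $DD^\dagger=I_p$, $CD^\dagger=I_p$, $(A-I)D^\dagger=0$. Fix $\rho\in(0,1)$ and assume that $A+mBC$ has all eigenvalues in the open disk of radius $\rho$. Let $\ell_+,\ell_-\in\mathbb{N}$ be given and set $n_c=p(n+\ell_-+\ell_+)$. If there exist $P=P^\top\in\mathbb{R}^{n_c\times n_c}$, $M_+\in\mathbb{R}^{p\times \ell_+p}$, $M_-\in\mathbb{R}^{p\times\ell_-p}$, $M_0\in\mathbb{R}^{p\times p}$ such that $$\begin{bmatrix}A_c(\rho)&B_c\\ I&0\\ C_c(\rho)&D_c\end{bmatrix}^\top\begin{bmatrix}P&0&0\\ 0&-P&0\\ 0&0&M_\Delta\end{bmatrix}\begin{bmatrix}A_c(\rho)&B_c\\ I&0\\ C_c(\rho)&D_c\end{bmatrix}\prec0,\qquad \begin{bmatrix}M_-&M_0&M_+\end{bmatrix}\in\mathbb{M}(\rho,\ell_+,\ell_-,p),$$ then the origin of the system $$\xi_{k+1}=(A+mBC)\xi_k+Bw_k,\quad y_k=C\xi_k,\quad w_k=\Delta_H(y)_k$$ is robustly exponentially stable with rate $\rho$ against $\{\Delta_H : H\in\mathcal{S}_{m,L}\}$.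
   Context: $\mathbb{N}$ includes $0$. $\mathcal{S}_{m,L}$: functions $H:\mathbb{R}^p\to\mathbb{R}$, $H\in\mathcal{C}^2$, with $(\nabla H(x)-\nabla H(y))^\top(x-y)\ge m\|x-y\|^2$ and $\|\nabla H(x)-\nabla H(y)\|\le L\|x-y\|$ for all $x,y$; $z^\star$ denotes the unique minimizer of $H$. For a sequence $y=(y_k)_{k\in\mathbb{N}}$ in $\mathbb{R}^p$, $\Delta_H(y)_k=\nabla H(y_k+z^\star)-my_k$. Robust exponential stability of the origin with rate $\rho$ against $\{\Delta_H\}$: there exists $\eta>0$ such that $\|\xi_k\|^2\le\eta\rho^{2k}\|\xi_0\|^2$ for all $k\in\mathbb{N}$, all $\xi_0\in\mathbb{R}^{np}$ and all $H\in\mathcal{S}_{m,L}$. $\mathbb{M}(\rho,\ell_+,\ell_-,p)$ is the set of block rows $[M_{-\ell_-}\ M_{-\ell_-+1}\ \cdots\ M_{\ell_+}]$ with $M_i=m_iI_p$, $m_i\in\mathbb{R}$, $m_i\le0$ for all $i\ne0$, $(\sum_{i=-\ell_-}^{\ell_+}M_i\rho^{-i})\mathbf{1}\ge0$ and $\mathbf{1}^\top(\sum_{i=-\ell_-}^{\ell_+}M_i\rho^{i})\ge0$ (elementwise; $\mathbf 1$ the all-ones vector). $M_-=[M_{-\ell_-}\cdots M_{-1}]$, $M_+=[M_1^\top\cdots M_{\ell_+}^\top]$. $$M_\Delta=\mathrm{blkdiag}\left(\begin{bmatrix}0&M_0^\top\\ M_0&0\end{bmatrix},\begin{bmatrix}0&M_-^\top\\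 M_-&0\end{bmatrix},\begin{bmatrix}0&M_+\\ M_+^\top&0\end{bmatrix}\right),$$ with block sizes $(p,p,\ell_-p,p,p,\ell_+p)$. For an integer $\ell$ let $S_\ell\in\mathbb{R}^{\ell\times\ell}$ have ones on the first superdiagonal and zeros elsewhere, $e_\ell=[0,\dots,0,1]^\top\in\mathbb{R}^\ell$, and let $J_\ell$ be the $\ell\times\ell$ matrix with ones on the antidiagonal and zeros elsewhere (blocks of dimension zero are omitted). Put $\widehat W=\begin{bmatrix}(L-m)I_p&-I_p\\ 0&I_p\end{bmatrix}$, $$A_\Delta=\begin{bmatrix}S_{\ell_-}&0\\ 0&S_{\ell_+}\end{bmatrix}\otimes I_p,\quad B_\Delta=\begin{bmatrix}e_{\ell_-}\otimes I_p&0\\ 0&e_{\ell_+}\otimes I_p\end{bmatrix}\widehat W,\quad C_\Delta=\begin{bmatrix}0&0\\ 0&0\\ I_{\ell_-p}&0\\ 0&0\\ 0&0\\ 0&J_{\ell_+}\otimes I_p\end{bmatrix},\quad D_\Delta=\begin{bmatrix}I_p&0\\ 0&I_p\\ 0&0\\ 0&I_p\\ I_p&0\\ 0&0\end{bmatrix}\widehat W,$$ where the block rows of $C_\Delta,D_\Delta$ have sizes $(p,p,\ell_-p,p,p,\ell_+p)$. Finally $$A_c(\rho)=\begin{bmatrix}A_\Delta&\rho^{-1}B_\Delta\begin{bmatrix}C\\ 0\end{bmatrix}\\ 0&\rho^{-1}(A+mBC)\end{bmatrix},\ B_c=\begin{bmatrix}B_\Delta\begin{bmatrix}0\\ I_p\end{bmatrix}\\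 B\end{bmatrix},\ C_c(\rho)=\begin{bmatrix}C_\Delta&\rho^{-1}D_\Delta\begin{bmatrix}C\\ 0\end{bmatrix}\end{bmatrix},\ D_c=D_\Delta\begin{bmatrix}0\\ I_p\end{bmatrix}.$$ *)

theory Defs
  imports
    "HOL-Analysis.Analysis"
    "Jordan_Normal_Form.Matrix"
    "Jordan_Normal_Form.Char_Poly"
begin

text \<open>
  Matrices have sizes that depend on natural numbers which may be zero, so all matrices and
  all state vectors are carrier-based.  The uncertainty is an ordinary function on the Euclidean
  space \<open>real ^ 'p\<close>, so that the library notions of derivative and norm apply.  From here
  on \<open>$\<close> and \<open>\<bullet>\<close> refer to carrier-based vectors.
\<close>

unbundle no vec_syntax

subsection \<open>Strongly convex functions with Lipschitz gradient\<close>

definition grad :: "('a::real_inner \<Rightarrow> real) \<Rightarrow> 'a \<Rightarrow> 'a" where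
  "grad H x = (THE g. GDERIV H x :> g)"

definition C2_fun :: "(real ^ 'p \<Rightarrow> real) \<Rightarrow> bool" where
  "C2_fun H \<longleftrightarrow>
     (\<forall>x. H differentiable (at x)) \<and>
     (\<exists>Hess :: real ^ 'p \<Rightarrow> real ^ 'p ^ 'p.
        continuous_on UNIV Hess \<and>
        (\<forall>x. (grad H has_derivative (\<lambda>h. Hess x *v h)) (at x)))"

definition S_class :: "real \<Rightarrow> real \<Rightarrow> (real ^ 'p \<Rightarrow> real) set" where
  "S_class m L = {H. C2_fun H \<and>
     (\<forall>x y. inner (grad H x - grad H y) (x - y) \<ge> m * (norm (x - y))\<^sup>2) \<and>
     (\<forall>x y. norm (grad H x - grad H y) \<le> L * norm (x - y))}"

definition minimizer :: "('a \<Rightarrow> real) \<Rightarrow> 'a" where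
  "minimizer H = (THE z. is_arg_min H (\<lambda>_. True) z)"

definition Delta_op ::
  "real \<Rightarrow> (real ^ 'p \<Rightarrow> real) \<Rightarrow> (nat \<Rightarrow> real ^ 'p) \<Rightarrow> nat \<Rightarrow> real ^ 'p" where
  "Delta_op m H y k = grad H (y k + minimizer H) - m *\<^sub>R y k"

subsection \<open>Identification of \<open>real ^ 'p\<close> with vectors of dimension \<open>CARD('p)\<close>\<close>

text \<open>The index type carries no canonical order; an arbitrary enumeration is fixed.\<close>

definition coord :: "nat \<Rightarrow> 'p::finite" where
  "coord = (SOME e. bij_betw e {..<CARD('p)} UNIV)"

definition to_vec :: "real ^ 'p \<Rightarrow> real vec" where
  "to_vec x = vec CARD('p) (\<lambda>i. vec_nth x (coord i))"

definition of_vec :: "real vec \<Rightarrow> real ^ 'p" where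
  "of_vec v = vec_lambda (\<lambda>j. v $ (inv_into {..<CARD('p)} coord j))"

subsection \<open>Robust exponential stability of a feedback interconnection\<close>

definition solves_loop :: "real mat \<Rightarrow> real mat \<Rightarrow> real mat \<Rightarrow>
    ((nat \<Rightarrow> real ^ 'p) \<Rightarrow> nat \<Rightarrow> real ^ 'p) \<Rightarrow> (nat \<Rightarrow> real vec) \<Rightarrow> bool" where
  "solves_loop F B C \<Delta> \<xi> \<longleftrightarrow>
     \<xi> 0 \<in> carrier_vec (dim_col F) \<and>
     (\<forall>k. \<xi> (Suc k) = F *\<^sub>v \<xi> k + B *\<^sub>v to_vec (\<Delta> (\<lambda>j. of_vec (C *\<^sub>v \<xi> j)) k))"

text \<open>Here \<open>v \<bullet> v\<close> is the squared Euclidean norm of a real vector.\<close>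

definition robustly_exp_stable :: "real \<Rightarrow> real mat \<Rightarrow> real mat \<Rightarrow> real mat \<Rightarrow>
    ((nat \<Rightarrow> real ^ 'p) \<Rightarrow> nat \<Rightarrow> real ^ 'p) set \<Rightarrow> bool" where
  "robustly_exp_stable \<rho> F B C \<D> \<longleftrightarrow>
     (\<exists>\<eta>>0. \<forall>\<Delta>\<in>\<D>. \<forall>\<xi>. solves_loop F B C \<Delta> \<xi> \<longrightarrow>
        (\<forall>k. \<xi> k \<bullet> \<xi> k \<le> \<eta> * \<rho> ^ (2 * k) * (\<xi> 0 \<bullet> \<xi> 0)))"

subsection \<open>Matrix constructions\<close>

definition append_cols :: "'a::zero mat \<Rightarrow> 'a mat \<Rightarrow> 'a mat" (infixr \<open>@\<^sub>c\<close> 65) where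
  "A @\<^sub>c B = four_block_mat A B (0\<^sub>m 0 (dim_col A)) (0\<^sub>m 0 (dim_col B))"

definition kron :: "'a::semiring_1 mat \<Rightarrow> 'a mat \<Rightarrow> 'a mat" (infixl \<open>\<otimes>\<^sub>m\<close> 70) where
  "A \<otimes>\<^sub>m B = mat (dim_row A * dim_row B) (dim_col A * dim_col B)
     (\<lambda>(i, j). A $$ (i div dim_row B, j div dim_col B) * B $$ (i mod dim_row B, j mod dim_col B))"

definition neg_definite :: "real mat \<Rightarrow> bool" where
  "neg_definite X \<longleftrightarrow> square_mat X \<and> transpose_mat X = X \<and>
     (\<forall>v \<in> carrier_vec (dim_row X). v \<noteq> 0\<^sub>v (dim_row X) \<longrightarrow> v \<bullet> (X *\<^sub>v v) < 0)"

definition S_mat :: "nat \<Rightarrow> real mat" where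
  "S_mat l = mat l l (\<lambda>(i, j). if j = Suc i then 1 else 0)"

definition e_mat :: "nat \<Rightarrow> real mat" where
  "e_mat l = mat l 1 (\<lambda>(i, _). if Suc i = l then 1 else 0)"

definition J_mat :: "nat \<Rightarrow> real mat" where
  "J_mat l = mat l l (\<lambda>(i, j). if Suc (i + j) = l then 1 else 0)"

subsection \<open>Multipliers\<close>

text \<open>
  The index \<open>i\<close> of a block ranges over \<open>{- lm..lp}\<close>, so the block at position
  \<open>b\<close> of the row (counted from 0) is \<open>M (b - lm)\<close>.  Writing \<open>Mp\<close> as
  \<open>[M 1, ..., M lp]\<close> loses nothing, because the blocks are symmetric.
\<close>

definition multipliers :: "real \<Rightarrow> nat \<Rightarrow> nat \<Rightarrow> nat \<Rightarrow> real mat set" where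
  "multipliers \<rho> lp lm p =
     {mat p ((lm + 1 + lp) * p) (\<lambda>(r, c). M (int (c div p) - int lm) $$ (r, c mod p)) | M.
        (\<exists>\<mu> :: int \<Rightarrow> real.
           (\<forall>i \<in> {- int lm..int lp}. M i = \<mu> i \<cdot>\<^sub>m 1\<^sub>m p) \<and>
           (\<forall>i \<in> {- int lm..int lp}. i \<noteq> 0 \<longrightarrow> \<mu> i \<le> 0)) \<and>
        mat p p (\<lambda>rc. \<Sum>i \<in> {- int lm..int lp}. M i $$ rc * \<rho> powi (- i)) *\<^sub>v vec p (\<lambda>_. 1)
          \<ge> 0\<^sub>v p \<and>
        mat_of_row (vec p (\<lambda>_. 1)) *
          mat p p (\<lambda>rc. \<Sum>i \<in> {- int lm..int lp}. M i $$ rc * \<rho> powi i) \<ge> 0\<^sub>m 1 p}"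

definition M_Delta :: "real mat \<Rightarrow> real mat \<Rightarrow> real mat \<Rightarrow> real mat" where
  "M_Delta M0 Mm Mp = diag_block_mat
     [four_block_mat (0\<^sub>m (dim_col M0) (dim_col M0)) (transpose_mat M0)
                     M0 (0\<^sub>m (dim_row M0) (dim_row M0)),
      four_block_mat (0\<^sub>m (dim_col Mm) (dim_col Mm)) (transpose_mat Mm)
                     Mm (0\<^sub>m (dim_row Mm) (dim_row Mm)),
      four_block_mat (0\<^sub>m (dim_row Mp) (dim_row Mp)) Mp
                     (transpose_mat Mp) (0\<^sub>m (dim_col Mp) (dim_col Mp))]"

subsection \<open>Filter realization and extended plant\<close>

definition W_hat :: "nat \<Rightarrow> real \<Rightarrow> real \<Rightarrow> real mat" where
  "W_hat p m L = four_block_mat ((L - m) \<cdot>\<^sub>m 1\<^sub>m p) (- 1\<^sub>m p) (0\<^sub>m p p) (1\<^sub>m p)"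

definition A_Delta :: "nat \<Rightarrow> nat \<Rightarrow> nat \<Rightarrow> real mat" where
  "A_Delta lp lm p = diag_block_mat [S_mat lm, S_mat lp] \<otimes>\<^sub>m 1\<^sub>m p"

definition B_Delta :: "nat \<Rightarrow> nat \<Rightarrow> nat \<Rightarrow> real \<Rightarrow> real \<Rightarrow> real mat" where
  "B_Delta lp lm p m L =
     diag_block_mat [e_mat lm \<otimes>\<^sub>m 1\<^sub>m p, e_mat lp \<otimes>\<^sub>m 1\<^sub>m p] * W_hat p m L"

definition C_Delta :: "nat \<Rightarrow> nat \<Rightarrow> nat \<Rightarrow> real mat" where
  "C_Delta lp lm p =
     (0\<^sub>m p (lm * p) @\<^sub>c 0\<^sub>m p (lp * p)) @\<^sub>r
     (0\<^sub>m p (lm * p) @\<^sub>c 0\<^sub>m p (lp * p)) @\<^sub>r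
     (1\<^sub>m (lm * p) @\<^sub>c 0\<^sub>m (lm * p) (lp * p)) @\<^sub>r
     (0\<^sub>m p (lm * p) @\<^sub>c 0\<^sub>m p (lp * p)) @\<^sub>r
     (0\<^sub>m p (lm * p) @\<^sub>c 0\<^sub>m p (lp * p)) @\<^sub>r
     (0\<^sub>m (lp * p) (lm * p) @\<^sub>c (J_mat lp \<otimes>\<^sub>m 1\<^sub>m p))"

definition D_Delta :: "nat \<Rightarrow> nat \<Rightarrow> nat \<Rightarrow> real \<Rightarrow> real \<Rightarrow> real mat" where
  "D_Delta lp lm p m L =
     ((1\<^sub>m p @\<^sub>c 0\<^sub>m p p) @\<^sub>r
      (0\<^sub>m p p @\<^sub>c 1\<^sub>m p) @\<^sub>r
      (0\<^sub>m (lm * p) p @\<^sub>c 0\<^sub>m (lm * p) p) @\<^sub>r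
      (0\<^sub>m p p @\<^sub>c 1\<^sub>m p) @\<^sub>r
      (1\<^sub>m p @\<^sub>c 0\<^sub>m p p) @\<^sub>r
      (0\<^sub>m (lp * p) p @\<^sub>c 0\<^sub>m (lp * p) p)) * W_hat p m L"

definition A_c :: "nat \<Rightarrow> nat \<Rightarrow> nat \<Rightarrow> nat \<Rightarrow> real \<Rightarrow> real \<Rightarrow>
    real mat \<Rightarrow> real mat \<Rightarrow> real mat \<Rightarrow> real \<Rightarrow> real mat" where
  "A_c lp lm n p m L A B C \<rho> = four_block_mat
     (A_Delta lp lm p)
     (inverse \<rho> \<cdot>\<^sub>m (B_Delta lp lm p m L * (C @\<^sub>r 0\<^sub>m p (n * p))))
     (0\<^sub>m (n * p) ((lm + lp) * p))
     (inverse \<rho> \<cdot>\<^sub>m (A + m \<cdot>\<^sub>m (B * C)))"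

definition B_c :: "nat \<Rightarrow> nat \<Rightarrow> nat \<Rightarrow> real \<Rightarrow> real \<Rightarrow> real mat \<Rightarrow> real mat" where
  "B_c lp lm p m L B = (B_Delta lp lm p m L * (0\<^sub>m p p @\<^sub>r 1\<^sub>m p)) @\<^sub>r B"

definition C_c :: "nat \<Rightarrow> nat \<Rightarrow> nat \<Rightarrow> nat \<Rightarrow> real \<Rightarrow> real \<Rightarrow> real mat \<Rightarrow> real \<Rightarrow> real mat" where
  "C_c lp lm n p m L C \<rho> =
     C_Delta lp lm p @\<^sub>c (inverse \<rho> \<cdot>\<^sub>m (D_Delta lp lm p m L * (C @\<^sub>r 0\<^sub>m p (n * p))))"

definition D_c :: "nat \<Rightarrow> nat \<Rightarrow> nat \<Rightarrow> real \<Rightarrow> real \<Rightarrow> real mat" where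
  "D_c lp lm p m L = D_Delta lp lm p m L * (0\<^sub>m p p @\<^sub>r 1\<^sub>m p)"

definition outer_factor :: "nat \<Rightarrow> real mat \<Rightarrow> real mat \<Rightarrow> real mat \<Rightarrow> real mat \<Rightarrow> real mat" where
  "outer_factor nc Ac Bc Cc Dc =
     (Ac @\<^sub>c Bc) @\<^sub>r (1\<^sub>m nc @\<^sub>c 0\<^sub>m nc (dim_col Bc)) @\<^sub>r (Cc @\<^sub>c Dc)"

definition LMI :: "nat \<Rightarrow> real mat \<Rightarrow> real mat \<Rightarrow> real mat \<Rightarrow> real mat \<Rightarrow>
    real mat \<Rightarrow> real mat \<Rightarrow> bool" where
  "LMI nc Ac Bc Cc Dc P M \<longleftrightarrow>
     neg_definite (transpose_mat (outer_factor nc Ac Bc Cc Dc) * diag_block_mat [P, - P, M] *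
                   outer_factor nc Ac Bc Cc Dc)"

end

theory Submission
  imports Defs "Jordan_Normal_Form.Spectral_Radius"
begin

text \<open>
  Scaling the state by \<open>\<rho> ^ (-k)\<close> turns exponential stability with rate \<open>\<rho>\<close> into square summability
  of the scaled state. The shifted gradient \<open>f x = \<nabla>H(x + z\<^sup>\<star>) - m x\<close> is the gradient of a convex
  function \<open>g\<close>, and with \<open>K = L - m\<close> the function \<open>V = K (g - g 0) - |f|\<^sup>2 / 2\<close> satisfies
  \<open>0 \<le> V \<le> f \<bullet> (K x - f)\<close> and a cyclic monotonicity inequality; this makes every truncated
  Zames--Falb sum nonnegative. Summing the LMI along a trajectory then bounds the squared
  \<open>l\<^sup>2\<close> norm of the scaled state by a multiple of that of its initial value and of an additive
  disturbance. As \<open>P\<close> is indefinite, this works only if the terminal storage tends to zero, so square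
  summability has to be known beforehand. It is obtained by a homotopy replacing \<open>f\<close> by \<open>\<tau> f\<close>:
  at \<open>\<tau> = 0\<close> the loop is a Schur stable linear system, and a small increase of \<open>\<tau>\<close>, truncated at
  a finite time, is a disturbance absorbed by the uniform bound.
\<close>

unbundle no vec_syntax
unbundle no inner_syntax

subsection \<open>Convex functions and the storage function\<close>

text \<open>Why truncation does no harm: with q = f and p = (L - m) x - f, each diagonal product of
  q and p splits into V and a remainder, both nonnegative. A delayed product is bounded by a V term
  and a remainder term, and the weights \<open>\<rho> ^ i\<close> and
  \<open>inverse \<rho> ^ i\<close> fall on these two in opposite ways for positive and negative
  delays. Collecting coefficients, the remainders receive exactly the row sum of the multiplier and
  the V terms exactly its column sum. What the finite horizon cuts off has the favourable sign. Why
  the homotopy closes: \<tau> f obeys the same inequalities, with the same L - m, for every \<tau>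
  in [0,1]. The LMI bound therefore has one constant for all \<tau>, and a fixed step length reaches
  \<tau> = 1 after finitely many steps. That constant depends neither on H nor on the initial state,
  so it serves as \<eta>. V is formed without dividing by L - m, so that L = m is covered.\<close>

lemma convex_first_order:
  fixes g :: "'a::real_inner \<Rightarrow> real"
  assumes der: "\<And>x. (g has_derivative (\<lambda>h. inner (f x) h)) (at x)"
    and mono: "\<And>x y. 0 \<le> inner (f x - f y) (x - y)"
  shows "g x + inner (f x) (y - x) \<le> g y"
proof -
  have "((\<lambda>t. g (x + t *\<^sub>R (y - x))) has_real_derivative inner (f (x + t *\<^sub>R (y - x))) (y - x)) (at t)" for t
  proof -
    have "((\<lambda>t. x + t *\<^sub>R (y - x)) has_derivative (\<lambda>s. s *\<^sub>R (y - x))) (at t)"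
      by (auto intro!: derivative_eq_intros)
    from has_derivative_compose[OF this der]
    show ?thesis by (simp add: has_field_derivative_def mult_commute_abs)
  qed
  then obtain t where t: "0 < t" "t < 1"
    "g (x + 1 *\<^sub>R (y - x)) - g (x + 0 *\<^sub>R (y - x)) = (1 - 0) * inner (f (x + t *\<^sub>R (y - x))) (y - x)"
    using MVT2[of 0 1 "\<lambda>t. g (x + t *\<^sub>R (y - x))" "\<lambda>t. inner (f (x + t *\<^sub>R (y - x))) (y - x)"]
    by auto
  have "0 \<le> t * inner (f (x + t *\<^sub>R (y - x)) - f x) (y - x)"
    using mono[of "x + t *\<^sub>R (y - x)" x] by simp
  then have "0 \<le> inner (f (x + t *\<^sub>R (y - x)) - f x) (y - x)"
    using t by (simp add: zero_le_mult_iff)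
  then show ?thesis using t by (simp add: inner_diff_left)
qed

text \<open>Since K/2 |x|^2 - g is convex as well, g lies below a parabola touching it at x. At the
  point x - t d, with d = f x - f y, this parabola is compared with the tangent of g at y, which
  lies below g. The resulting gap, quadratic in t, is largest at t = 1/K. Multiplying through by K
  keeps the statement meaningful for K = 0.\<close>

lemma cocoercive_first_order:
  fixes g :: "'a::real_inner \<Rightarrow> real"
  assumes der: "\<And>x. (g has_derivative (\<lambda>h. inner (f x) h)) (at x)"
    and mono: "\<And>x y. 0 \<le> inner (f x - f y) (x - y)"
    and upper: "\<And>x y. inner (f x - f y) (x - y) \<le> K * (norm (x - y))\<^sup>2"
    and "0 \<le> K"
  shows "K * g y + K * inner (f y) (x - y) + (norm (f x - f y))\<^sup>2 / 2 \<le> K * g x"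
proof -
  define d where "d = f x - f y"
  have der': "((\<lambda>x. K / 2 * inner x x - g x) has_derivative (\<lambda>h. inner (K *\<^sub>R z - f z) h)) (at z)" for z
    by (rule derivative_eq_intros der | simp)+
      (simp add: fun_eq_iff algebra_simps inner_commute)
  have mono': "0 \<le> inner ((K *\<^sub>R u - f u) - (K *\<^sub>R v - f v)) (u - v)" for u v
  proof -
    have "inner ((K *\<^sub>R u - f u) - (K *\<^sub>R v - f v)) (u - v) = K * (norm (u - v))\<^sup>2 - inner (f u - f v) (u - v)"
      by (simp add: power2_norm_eq_inner algebra_simps)
    then show ?thesis using upper[of u v] by simp
  qed
  have descent: "g z \<le> g x + inner (f x) (z - x) + K / 2 * inner (z - x) (z - x)" for z
    using convex_first_order[of "\<lambda>x. K / 2 * inner x x - g x" "\<lambda>z. K *\<^sub>R z - f z" x z, OF der' mono']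
    by (simp add: algebra_simps inner_commute)
  have gap: "t * inner d d - K / 2 * t\<^sup>2 * inner d d \<le> g x - g y - inner (f y) (x - y)" for t
  proof -
    have "g y + inner (f y) (x - t *\<^sub>R d - y) \<le> g (x - t *\<^sub>R d)"
      by (rule convex_first_order[OF der mono])
    also have "\<dots> \<le> g x - t * inner (f x) d + K / 2 * t\<^sup>2 * inner d d"
      using descent[of "x - t *\<^sub>R d"] by (simp add: power2_eq_square)
    finally have "g y + inner (f y) (x - y) - t * inner (f y) d \<le> g x - t * inner (f x) d + K / 2 * t\<^sup>2 * inner d d"
      by (simp add: inner_diff_right)
    moreover have "t * inner d d = t * inner (f x) d - t * inner (f y) d"
      unfolding d_def by (simp add: inner_diff_left right_diff_distrib)
    ultimately show ?thesis by linarith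
  qed
  show ?thesis
  proof (cases "K = 0")
    case True
    \<comment> \<open>Without the quadratic term \<open>gap\<close> is linear in t; the chosen t
      makes its left side exceed the right side by 1.\<close>
    have "d = 0"
    proof (rule ccontr)
      assume "d \<noteq> 0"
      then show False
        using gap[of "(g x - g y - inner (f y) (x - y) + 1) / inner d d"] True by simp
    qed
    then show ?thesis using True by (simp add: d_def)
  next
    case False
    then have K: "0 < K" using assms by simp
    have "K * (1 / K * inner d d - K / 2 * (1 / K)\<^sup>2 * inner d d) \<le> K * (g x - g y - inner (f y) (x - y))"
      using gap[of "1 / K"] K by (intro mult_left_mono) auto
    moreover have "K * (1 / K * inner d d - K / 2 * (1 / K)\<^sup>2 * inner d d) = inner d d / 2"
      using K by (simp add: field_simps power2_eq_square)
    ultimately have "inner d d / 2 \<le> K * (g x - g y - inner (f y) (x - y))" by linarith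
    then show ?thesis
      unfolding d_def[symmetric] power2_norm_eq_inner by (simp add: right_diff_distrib)
  qed
qed

text \<open>All that the summation needs to know about the nonlinearity. The vectors f x and K x - f
  x are the two outputs of \<open>W_hat\<close>, for K = L - m. Added around a cycle of points, the
  V terms of the last clause cancel, which leaves cyclic monotonicity of these two signals.\<close>

definition zf_storage :: "real \<Rightarrow> ('a::real_inner \<Rightarrow> 'a) \<Rightarrow> ('a \<Rightarrow> real) \<Rightarrow> bool" where
  "zf_storage K f V \<longleftrightarrow>
     (\<forall>x. 0 \<le> V x \<and> V x \<le> inner (f x) (K *\<^sub>R x - f x)) \<and>
     (\<forall>x y. inner (f y) (K *\<^sub>R x - f x) \<le> inner (f y) (K *\<^sub>R y - f y) + V x - V y)"

text \<open>Expanding the square in \<open>cocoercive_first_order\<close> leaves half of |f x|^2 and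
  half of |f y|^2, which become part of V x and V y. Both bounds on V are the cross inequality with
  one of its points at 0, where f and V vanish.\<close>

lemma zf_storage_gradient:
  fixes g :: "'a::real_inner \<Rightarrow> real"
  assumes der: "\<And>x. (g has_derivative (\<lambda>h. inner (f x) h)) (at x)"
    and mono: "\<And>x y. 0 \<le> inner (f x - f y) (x - y)"
    and upper: "\<And>x y. inner (f x - f y) (x - y) \<le> K * (norm (x - y))\<^sup>2"
    and "0 \<le> K" and f0: "f 0 = 0"
  shows "zf_storage K f (\<lambda>x. K * (g x - g 0) - (norm (f x))\<^sup>2 / 2)"
proof -
  let ?V = "\<lambda>x. K * (g x - g 0) - (norm (f x))\<^sup>2 / 2"
  have key: "inner (f y) (K *\<^sub>R x - f x) \<le> inner (f y) (K *\<^sub>R y - f y) + ?V x - ?V y" for x y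
    using cocoercive_first_order[OF der mono upper \<open>0 \<le> K\<close>, of y x]
    by (simp add: power2_norm_eq_inner algebra_simps inner_commute diff_divide_distrib add_divide_distrib)
  show ?thesis
    unfolding zf_storage_def
    using key key[of 0] key[of _ 0] f0 by auto
qed

section \<open>Gradient and minimizer of a strongly convex function\<close>

text \<open>As \<open>grad\<close> is a definite description, existence and uniqueness have to be
  established: the representing vector is the adjoint of the derivative applied to 1.\<close>

lemma grad_has_derivative:
  fixes H :: "'a::euclidean_space \<Rightarrow> real"
  assumes "H differentiable (at x)"
  shows "(H has_derivative (\<lambda>h. inner (grad H x) h)) (at x)"
proof -
  obtain H' where H': "(H has_derivative H') (at x)"
    using assms by (auto simp: differentiable_def)
  have lin: "linear H'" using H' by (rule has_derivative_linear)
  have eq: "H' = (\<lambda>h. inner h (adjoint H' 1))"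
    using adjoint_works[OF lin, of _ 1] by (auto simp: fun_eq_iff)
  have ex: "GDERIV H x :> adjoint H' 1"
    using H' eq by (simp add: gderiv_def)
  have "grad H x = adjoint H' 1"
    unfolding grad_def
  proof (rule the_equality)
    show "GDERIV H x :> adjoint H' 1" by (rule ex)
    fix g assume "GDERIV H x :> g"
    then have "H' = (\<lambda>h. inner h g)"
      using H' has_derivative_unique unfolding gderiv_def by blast
    then have "inner h (g - adjoint H' 1) = 0" for h
      using eq by (metis inner_diff_right right_minus_eq)
    then show "g = adjoint H' 1" by (metis inner_eq_zero_iff right_minus_eq)
  qed
  then show ?thesis using H' eq by (simp add: inner_commute)
qed

lemma has_derivative_half_norm_sq:
  "((\<lambda>x. m / 2 * inner x x) has_derivative (\<lambda>h. inner (m *\<^sub>R x) h)) (at x)"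
  by (rule derivative_eq_intros | simp)+
     (simp add: fun_eq_iff inner_commute)

text \<open>Here too a definite description has to be justified. Strong convexity gives quadratic
  growth, so a minimum over a large ball is global; two minimizers are both critical points, and
  strong monotonicity of the gradient makes them equal.\<close>

lemma grad_minimizer:
  fixes H :: "real ^ 'p \<Rightarrow> real"
  assumes diff: "\<And>x. H differentiable (at x)"
    and mono: "\<And>x y. m * (norm (x - y))\<^sup>2 \<le> inner (grad H x - grad H y) (x - y)"
    and m: "0 < m"
  shows "grad H (minimizer H) = 0"
proof -
  have der: "(H has_derivative (\<lambda>h. inner (grad H x) h)) (at x)" for x
    by (rule grad_has_derivative[OF diff])
  have der': "((\<lambda>x. H x - m / 2 * inner x x) has_derivative (\<lambda>h. inner (grad H x - m *\<^sub>R x) h)) (at x)" for x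
    unfolding inner_diff_left by (intro has_derivative_diff der has_derivative_half_norm_sq)
  have mono': "0 \<le> inner ((grad H x - m *\<^sub>R x) - (grad H y - m *\<^sub>R y)) (x - y)" for x y
    using mono[of x y] by (simp add: power2_norm_eq_inner algebra_simps)
  have growth: "H 0 + inner (grad H 0) y + m / 2 * (norm y)\<^sup>2 \<le> H y" for y
    using convex_first_order[of "\<lambda>x. H x - m / 2 * inner x x" "\<lambda>x. grad H x - m *\<^sub>R x" 0 y, OF der' mono']
    by (simp add: power2_norm_eq_inner)
  \<comment> \<open>From this radius on, the quadratic term m/2 |y|^2 outweighs the linear term of
    the lower bound \<open>growth\<close>.\<close>
  define R where "R = 2 * norm (grad H 0) / m"
  have R: "0 \<le> R" using m by (simp add: R_def)
  have out: "H 0 \<le> H y" if "R \<le> norm y" for y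
  proof -
    have "norm (grad H 0) * norm y \<le> m / 2 * norm y * norm y"
      using that m by (intro mult_right_mono) (auto simp: R_def field_simps)
    moreover have "- (norm (grad H 0) * norm y) \<le> inner (grad H 0) y"
      using Cauchy_Schwarz_ineq2[of "grad H 0" y] by linarith
    ultimately show ?thesis using growth[of y] by (simp add: power2_eq_square)
  qed
  have "continuous_on (cball 0 R) H"
    using diff by (intro continuous_at_imp_continuous_on) (auto intro: differentiable_imp_continuous_within)
  then obtain z where z: "z \<in> cball 0 R" "\<And>y. y \<in> cball 0 R \<Longrightarrow> H z \<le> H y"
    using continuous_attains_inf[of "cball 0 R" H] R by auto
  have zmin: "H z \<le> H y" for y
  proof (cases "y \<in> cball 0 R")
    case False
    then have "H 0 \<le> H y" using out[of y] by simp
    moreover have "H z \<le> H 0" using z R by auto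
    ultimately show ?thesis by simp
  qed (use z in auto)
  have crit: "grad H u = 0" if "\<And>y. H u \<le> H y" for u
  proof -
    have "(\<lambda>h. inner (grad H u) h) = (\<lambda>h. 0)"
      by (rule has_derivative_local_min[OF der]) (simp add: that)
    then show ?thesis by (metis inner_eq_zero_iff)
  qed
  have "is_arg_min H (\<lambda>_. True) z" using zmin by (auto simp: is_arg_min_def not_less)
  moreover have "u = z" if "is_arg_min H (\<lambda>_. True) u" for u
  proof -
    have "grad H u = 0" "grad H z = 0"
      using that crit zmin by (auto simp: is_arg_min_def not_less)
    then have "m * (norm (u - z))\<^sup>2 \<le> 0" using mono[of u z] by simp
    then show ?thesis using m by (simp add: mult_le_0_iff)
  qed
  ultimately have "minimizer H = z" unfolding minimizer_def by (rule the_equality)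
  then show ?thesis using crit zmin by simp
qed

text \<open>Subtracting m x turns strong monotonicity into monotonicity and the Lipschitz bound L,
  via Cauchy-Schwarz, into the upper bound L - m. Scaling by \<tau> between 0 and 1 preserves both
  bounds, which is what the homotopy relies on. The gain in the first claim is coarse; it only has
  to be finite and independent of H.\<close>

lemma S_class_residual:
  fixes H :: "real ^ 'p \<Rightarrow> real"
  assumes H: "H \<in> S_class m L" and m: "0 < m" "m \<le> L"
  defines "f \<equiv> \<lambda>x. grad H (x + minimizer H) - m *\<^sub>R x"
  shows "norm (f x) \<le> (L + m) * norm x"
    and "0 \<le> \<tau> \<Longrightarrow> \<tau> \<le> 1 \<Longrightarrow> \<exists>V. zf_storage (L - m) (\<lambda>x. \<tau> *\<^sub>R f x) V"
proof -
  let ?z = "minimizer H"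
  have diff: "H differentiable (at x)" for x using H by (simp add: S_class_def C2_fun_def)
  have mono: "m * (norm (x - y))\<^sup>2 \<le> inner (grad H x - grad H y) (x - y)" for x y
    using H by (simp add: S_class_def)
  have lip: "norm (grad H x - grad H y) \<le> L * norm (x - y)" for x y
    using H by (simp add: S_class_def)
  have crit: "grad H ?z = 0" by (rule grad_minimizer[OF diff mono m(1)])
  show "norm (f x) \<le> (L + m) * norm x"
    using norm_triangle_ineq4[of "grad H (x + ?z)" "m *\<^sub>R x"] lip[of "x + ?z" ?z] crit m
    by (simp add: f_def distrib_right)
  assume \<tau>: "0 \<le> \<tau>" "\<tau> \<le> 1"
  have der: "(H has_derivative (\<lambda>h. inner (grad H x) h)) (at x)" for x
    by (rule grad_has_derivative[OF diff])
  have "((\<lambda>x. H (x + ?z)) has_derivative (\<lambda>h. inner (grad H (x + ?z)) h)) (at x)" for x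
  proof -
    have "((\<lambda>x. x + ?z) has_derivative (\<lambda>h. h)) (at x)" by (auto intro!: derivative_eq_intros)
    from has_derivative_compose[OF this der] show ?thesis .
  qed
  then have derf: "((\<lambda>x. H (x + ?z) - m / 2 * inner x x) has_derivative (\<lambda>h. inner (f x) h)) (at x)" for x
    unfolding f_def inner_diff_left by (intro has_derivative_diff has_derivative_half_norm_sq)
  have der\<tau>: "((\<lambda>x. \<tau> * (H (x + ?z) - m / 2 * inner x x)) has_derivative (\<lambda>h. inner (\<tau> *\<^sub>R f x) h)) (at x)" for x
    using has_derivative_mult_right[OF derf[of x], of \<tau>] by simp
  have lower: "0 \<le> inner (f x - f y) (x - y)" for x y
    using mono[of "x + ?z" "y + ?z"] by (simp add: f_def power2_norm_eq_inner algebra_simps)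
  have upper: "inner (f x - f y) (x - y) \<le> (L - m) * (norm (x - y))\<^sup>2" for x y
  proof -
    have "inner (grad H (x + ?z) - grad H (y + ?z)) (x - y) \<le> L * norm (x - y) * norm (x - y)"
      using norm_cauchy_schwarz[of "grad H (x + ?z) - grad H (y + ?z)" "x - y"]
        mult_right_mono[OF lip[of "x + ?z" "y + ?z"], of "norm (x - y)"] by simp
    moreover have "inner (f x - f y) (x - y) =
        inner (grad H (x + ?z) - grad H (y + ?z)) (x - y) - m * (norm (x - y))\<^sup>2"
      by (simp add: f_def power2_norm_eq_inner algebra_simps)
    ultimately show ?thesis by (simp add: power2_eq_square algebra_simps)
  qed
  have scale: "inner (\<tau> *\<^sub>R f x - \<tau> *\<^sub>R f y) (x - y) = \<tau> * inner (f x - f y) (x - y)" for x y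
    by (simp add: algebra_simps)
  show "\<exists>V. zf_storage (L - m) (\<lambda>x. \<tau> *\<^sub>R f x) V"
  proof (rule exI, rule zf_storage_gradient[where f = "\<lambda>x. \<tau> *\<^sub>R f x", OF der\<tau>])
    show "0 \<le> inner (\<tau> *\<^sub>R f x - \<tau> *\<^sub>R f y) (x - y)" for x y
      unfolding scale using \<tau> lower by simp
    show "inner (\<tau> *\<^sub>R f x - \<tau> *\<^sub>R f y) (x - y) \<le> (L - m) * (norm (x - y))\<^sup>2" for x y
      unfolding scale using mult_right_mono[OF \<tau>(2) lower[of x y]] upper[of x y] by simp
  qed (use m crit in \<open>auto simp: f_def\<close>)
qed

subsection \<open>Truncated Zames--Falb sums\<close>

lemma sum_int_symmetric_interval:
  fixes h :: "int \<Rightarrow> 'a::comm_monoid_add"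
  shows "(\<Sum>i\<in>{- int a..int b}. h i) = h 0 + (\<Sum>i=1..a. h (- int i)) + (\<Sum>i=1..b. h (int i))"
proof -
  have split: "{- int a..int b} = {0} \<union> (\<lambda>i. - int i) ` {1..a} \<union> int ` {1..b}"
  proof (intro equalityI subsetI)
    fix i assume "i \<in> {- int a..int b}"
    then consider "i = 0" | "i = - int (nat (- i))" "nat (- i) \<in> {1..a}" | "i = int (nat i)" "nat i \<in> {1..b}"
      by (cases "i = 0"; cases "i < 0") (auto simp: Suc_le_eq nat_le_iff)
    then show "i \<in> {0} \<union> (\<lambda>i. - int i) ` {1..a} \<union> int ` {1..b}"
      by cases (blast | fastforce)+
  qed auto
  have "(\<Sum>i\<in>{- int a..int b}. h i) = (\<Sum>i\<in>{0}. h i) + (\<Sum>i\<in>(\<lambda>i. - int i) ` {1..a}. h i) + (\<Sum>i\<in>int ` {1..b}. h i)"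
    unfolding split by (subst sum.union_disjoint; (subst sum.union_disjoint)?; fastforce)
  also have "(\<Sum>i\<in>(\<lambda>i. - int i) ` {1..a}. h i) = (\<Sum>i=1..a. h (- int i))"
    by (subst sum.reindex) (auto simp: inj_on_def)
  also have "(\<Sum>i\<in>int ` {1..b}. h i) = (\<Sum>i=1..b. h (int i))"
    by (subst sum.reindex) (auto simp: inj_on_def)
  finally show ?thesis by simp
qed

lemma sum_delay:
  fixes f :: "nat \<Rightarrow> 'a::comm_monoid_add"
  shows "(\<Sum>k<N. if i \<le> k then f (k - i) else 0) = (\<Sum>j<N - i. f j)"
  by (induction N) (auto simp: Suc_diff_le)

text \<open>A delay by i pushes the last i terms beyond the horizon N; for nonnegative terms the
  loss can be ignored. This is the only effect of truncation on the Zames-Falb sums.\<close>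

lemma sum_delay_le:
  fixes f :: "nat \<Rightarrow> real"
  assumes "\<And>j. 0 \<le> f j"
  shows "(\<Sum>k<N. if i \<le> k then f (k - i) else 0) \<le> (\<Sum>j<N. f j)"
  unfolding sum_delay by (rule sum_mono2) (use assms in auto)

text \<open>\<open>t j k\<close> stands for \<open>q\<^sub>j \<bullet> p\<^sub>k\<close>; signals vanish at negative times.\<close>

definition zf_term :: "(nat \<Rightarrow> nat \<Rightarrow> real) \<Rightarrow> (int \<Rightarrow> real) \<Rightarrow> nat \<Rightarrow> nat \<Rightarrow> nat \<Rightarrow> real" where
  "zf_term t \<mu> lp lm k = \<mu> 0 * t k k
     + (\<Sum>i=1..lm. \<mu> (- int i) * (if i \<le> k then t k (k - i) else 0))
     + (\<Sum>i=1..lp. \<mu> (int i) * (if i \<le> k then t (k - i) k else 0))"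

text \<open>Scalar data along one trajectory: \<open>s j k\<close> is the product of q at time j
  with p at time k before exponential weighting, and V is the storage at time k.\<close>

locale zf_signals =
  fixes s :: "nat \<Rightarrow> nat \<Rightarrow> real" and V :: "nat \<Rightarrow> real" and \<rho> :: real
  assumes rho: "0 < \<rho>"
    and V_nonneg: "\<And>k. 0 \<le> V k"
    and V_le: "\<And>k. V k \<le> s k k"
    and cross_le: "\<And>j k. s j k \<le> s j j + V k - V j"
begin

definition t :: "nat \<Rightarrow> nat \<Rightarrow> real" where
  "t j k = inverse \<rho> ^ (j + k) * s j k"

text \<open>The common weight of times k and k - i can be referred to the later time, at the price
  of \<open>\<rho> ^ i\<close>, or to the earlier one, at the price of
  \<open>inverse \<rho> ^ i\<close>. This is the source of the two different sums that define the
  multiplier class.\<close>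

lemma power_shift:
  assumes "i \<le> k"
  shows "inverse \<rho> ^ (k + (k - i)) = inverse \<rho> ^ (2 * k) * \<rho> ^ i"
    and "inverse \<rho> ^ (k + (k - i)) = inverse \<rho> ^ (2 * (k - i)) * inverse \<rho> ^ i"
proof -
  have "2 * k = (k + (k - i)) + i" using assms by simp
  then have "inverse \<rho> ^ (2 * k) = inverse \<rho> ^ (k + (k - i)) * inverse \<rho> ^ i"
    by (metis power_add)
  then show "inverse \<rho> ^ (k + (k - i)) = inverse \<rho> ^ (2 * k) * \<rho> ^ i"
    using rho by (simp add: power_inverse)
  have "k + (k - i) = 2 * (k - i) + i" using assms by simp
  then show "inverse \<rho> ^ (k + (k - i)) = inverse \<rho> ^ (2 * (k - i)) * inverse \<rho> ^ i"
    by (metis power_add)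
qed

text \<open>The cross inequality bounds the product by the remainder s - V at time k plus V at time
  k - i. Each part is weighted relative to its own time, and the delayed V part is then shifted by
  \<open>sum_delay_le\<close>.\<close>

lemma anticausal_bound:
  "(\<Sum>k<N. if i \<le> k then t k (k - i) else 0)
    \<le> (\<Sum>k<N. inverse \<rho> ^ (2 * k) * (\<rho> ^ i * (s k k - V k) + inverse \<rho> ^ i * V k))"
proof -
  let ?r = "inverse \<rho>"
  have r: "0 < ?r" using rho by simp
  have "(if i \<le> k then t k (k - i) else 0)
      \<le> ?r ^ (2 * k) * (\<rho> ^ i * (s k k - V k)) + (if i \<le> k then ?r ^ (2 * (k - i)) * (?r ^ i * V (k - i)) else 0)" for k
  proof (cases "i \<le> k")
    case True
    have "t k (k - i) \<le> ?r ^ (k + (k - i)) * (s k k + V (k - i) - V k)"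
      unfolding t_def using cross_le[of k "k - i"] r by (intro mult_left_mono) auto
    also have "\<dots> = ?r ^ (k + (k - i)) * (s k k - V k) + ?r ^ (k + (k - i)) * V (k - i)"
      by (simp add: algebra_simps)
    also have "\<dots> = ?r ^ (2 * k) * \<rho> ^ i * (s k k - V k) + ?r ^ (2 * (k - i)) * ?r ^ i * V (k - i)"
      using power_shift[OF True] by simp
    finally show ?thesis using True by (simp add: mult.assoc)
  next
    \<comment> \<open>Before time i the left side is the default 0, and the remainder left on the
      right is nonnegative.\<close>
    case False
    then show ?thesis using r rho V_le[of k] by simp
  qed
  then have "(\<Sum>k<N. if i \<le> k then t k (k - i) else 0) \<le>
      (\<Sum>k<N. ?r ^ (2 * k) * (\<rho> ^ i * (s k k - V k)) + (if i \<le> k then ?r ^ (2 * (k - i)) * (?r ^ i * V (k - i)) else 0))"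
    by (rule sum_mono)
  also have "\<dots> \<le> (\<Sum>k<N. ?r ^ (2 * k) * (\<rho> ^ i * (s k k - V k))) + (\<Sum>k<N. ?r ^ (2 * k) * (?r ^ i * V k))"
    unfolding sum.distrib
    by (intro add_left_mono sum_delay_le) (use r V_nonneg in simp)
  also have "\<dots> = (\<Sum>k<N. ?r ^ (2 * k) * (\<rho> ^ i * (s k k - V k) + ?r ^ i * V k))"
    by (simp add: sum.distrib distrib_left)
  finally show ?thesis .
qed

text \<open>Mirror image of \<open>anticausal_bound\<close>: now q is evaluated at the earlier time,
  so the remainder is delayed while V stays at time k, and the two weights change places.\<close>

lemma causal_bound:
  "(\<Sum>k<N. if i \<le> k then t (k - i) k else 0)
    \<le> (\<Sum>k<N. inverse \<rho> ^ (2 * k) * (inverse \<rho> ^ i * (s k k - V k) + \<rho> ^ i * V k))"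
proof -
  let ?r = "inverse \<rho>"
  have r: "0 < ?r" using rho by simp
  have "(if i \<le> k then t (k - i) k else 0)
      \<le> ?r ^ (2 * k) * (\<rho> ^ i * V k) + (if i \<le> k then ?r ^ (2 * (k - i)) * (?r ^ i * (s (k - i) (k - i) - V (k - i))) else 0)" for k
  proof (cases "i \<le> k")
    case True
    have "t (k - i) k \<le> ?r ^ (k + (k - i)) * (s (k - i) (k - i) + V k - V (k - i))"
      unfolding t_def add.commute[of "k - i" k] using cross_le[of "k - i" k] r by (intro mult_left_mono) auto
    also have "\<dots> = ?r ^ (k + (k - i)) * V k + ?r ^ (k + (k - i)) * (s (k - i) (k - i) - V (k - i))"
      by (simp add: algebra_simps)
    also have "\<dots> = ?r ^ (2 * k) * \<rho> ^ i * V k + ?r ^ (2 * (k - i)) * ?r ^ i * (s (k - i) (k - i) - V (k - i))"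
      using power_shift[OF True] by simp
    finally show ?thesis using True by (simp add: mult.assoc)
  next
    case False
    then show ?thesis using r rho V_nonneg[of k] by simp
  qed
  then have "(\<Sum>k<N. if i \<le> k then t (k - i) k else 0) \<le>
      (\<Sum>k<N. ?r ^ (2 * k) * (\<rho> ^ i * V k) + (if i \<le> k then ?r ^ (2 * (k - i)) * (?r ^ i * (s (k - i) (k - i) - V (k - i))) else 0))"
    by (rule sum_mono)
  also have "\<dots> \<le> (\<Sum>k<N. ?r ^ (2 * k) * (\<rho> ^ i * V k)) + (\<Sum>k<N. ?r ^ (2 * k) * (?r ^ i * (s k k - V k)))"
    unfolding sum.distrib
    by (intro add_left_mono sum_delay_le[where f = "\<lambda>k. ?r ^ (2 * k) * (?r ^ i * (s k k - V k))"])
      (use r V_le in simp)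
  also have "\<dots> = (\<Sum>k<N. ?r ^ (2 * k) * (?r ^ i * (s k k - V k) + \<rho> ^ i * V k))"
    by (simp add: sum.distrib distrib_left)
  finally show ?thesis .
qed

text \<open>The off-centre coefficients are nonpositive, so the upper bounds on delayed sums become
  lower bounds after multiplication. In the resulting lower bound each s - V carries the nonnegative
  row sum and each V the nonnegative column sum. The chain below runs from this regrouped expression
  up to the sum of interest.\<close>

lemma zames_falb_sum:
  assumes sign: "\<And>i. i \<in> {- int lm..int lp} \<Longrightarrow> i \<noteq> 0 \<Longrightarrow> \<mu> i \<le> 0"
    and row: "0 \<le> (\<Sum>i\<in>{- int lm..int lp}. \<mu> i * \<rho> powi (- i))"
    and col: "0 \<le> (\<Sum>i\<in>{- int lm..int lp}. \<mu> i * \<rho> powi i)"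
  shows "0 \<le> (\<Sum>k<N. zf_term t \<mu> lp lm k)"
proof -
  let ?r = "inverse \<rho>"
  let ?a = "\<lambda>i k. ?r ^ (2 * k) * (\<rho> ^ i * (s k k - V k) + ?r ^ i * V k)"
  let ?b = "\<lambda>i k. ?r ^ (2 * k) * (?r ^ i * (s k k - V k) + \<rho> ^ i * V k)"
  have row': "0 \<le> \<mu> 0 + (\<Sum>i=1..lm. \<mu> (- int i) * \<rho> ^ i) + (\<Sum>i=1..lp. \<mu> (int i) * ?r ^ i)"
    using row unfolding sum_int_symmetric_interval by (simp add: power_int_minus power_inverse)
  have col': "0 \<le> \<mu> 0 + (\<Sum>i=1..lm. \<mu> (- int i) * ?r ^ i) + (\<Sum>i=1..lp. \<mu> (int i) * \<rho> ^ i)"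
    using col unfolding sum_int_symmetric_interval by (simp add: power_int_minus power_inverse)
  have "0 \<le> (\<Sum>k<N. ?r ^ (2 * k) *
      ((s k k - V k) * (\<mu> 0 + (\<Sum>i=1..lm. \<mu> (- int i) * \<rho> ^ i) + (\<Sum>i=1..lp. \<mu> (int i) * ?r ^ i))
       + V k * (\<mu> 0 + (\<Sum>i=1..lm. \<mu> (- int i) * ?r ^ i) + (\<Sum>i=1..lp. \<mu> (int i) * \<rho> ^ i))))"
    using row' col' V_nonneg V_le rho
    by (intro sum_nonneg mult_nonneg_nonneg add_nonneg_nonneg[of "(_ - _) * _"]) auto
  also have "\<dots> = (\<Sum>k<N. \<mu> 0 * t k k + (\<Sum>i=1..lm. \<mu> (- int i) * ?a i k) + (\<Sum>i=1..lp. \<mu> (int i) * ?b i k))"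
  proof (rule sum.cong)
    fix k
    have A: "(\<Sum>i=1..lm. \<mu> (- int i) * ?a i k) = ?r ^ (2 * k) *
        ((s k k - V k) * (\<Sum>i=1..lm. \<mu> (- int i) * \<rho> ^ i) + V k * (\<Sum>i=1..lm. \<mu> (- int i) * ?r ^ i))"
      unfolding sum_distrib_left sum.distrib[symmetric]
      by (intro sum.cong) (auto simp: algebra_simps)
    have B: "(\<Sum>i=1..lp. \<mu> (int i) * ?b i k) = ?r ^ (2 * k) *
        ((s k k - V k) * (\<Sum>i=1..lp. \<mu> (int i) * ?r ^ i) + V k * (\<Sum>i=1..lp. \<mu> (int i) * \<rho> ^ i))"
      unfolding sum_distrib_left sum.distrib[symmetric]
      by (intro sum.cong) (auto simp: algebra_simps)
    show "?r ^ (2 * k) *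
      ((s k k - V k) * (\<mu> 0 + (\<Sum>i=1..lm. \<mu> (- int i) * \<rho> ^ i) + (\<Sum>i=1..lp. \<mu> (int i) * ?r ^ i))
       + V k * (\<mu> 0 + (\<Sum>i=1..lm. \<mu> (- int i) * ?r ^ i) + (\<Sum>i=1..lp. \<mu> (int i) * \<rho> ^ i)))
      = \<mu> 0 * t k k + (\<Sum>i=1..lm. \<mu> (- int i) * ?a i k) + (\<Sum>i=1..lp. \<mu> (int i) * ?b i k)"
      unfolding A B t_def mult_2[symmetric] by (simp add: algebra_simps)
  qed simp
  also have "\<dots> = (\<Sum>k<N. \<mu> 0 * t k k) + (\<Sum>i=1..lm. \<mu> (- int i) * (\<Sum>k<N. ?a i k))
      + (\<Sum>i=1..lp. \<mu> (int i) * (\<Sum>k<N. ?b i k))"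
    unfolding sum.distrib sum_distrib_left
    by (subst sum.swap, subst sum.swap[of _ "{1..lp}"]) simp
  also have "\<dots> \<le> (\<Sum>k<N. \<mu> 0 * t k k)
      + (\<Sum>i=1..lm. \<mu> (- int i) * (\<Sum>k<N. if i \<le> k then t k (k - i) else 0))
      + (\<Sum>i=1..lp. \<mu> (int i) * (\<Sum>k<N. if i \<le> k then t (k - i) k else 0))"
    by (intro add_mono sum_mono mult_left_mono_neg anticausal_bound causal_bound order_refl sign) auto
  also have "\<dots> = (\<Sum>k<N. zf_term t \<mu> lp lm k)"
    unfolding zf_term_def sum.distrib sum_distrib_left
    by (subst (2) sum.swap, subst (4) sum.swap) simp
  finally show ?thesis .
qed

end

subsection \<open>Quadratic estimates for vectors and matrices\<close>

lemma scalar_prod_self: "v \<bullet> v = (\<Sum>i<dim_vec v. (v $ i)\<^sup>2)" for v :: "real vec"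
  by (simp add: scalar_prod_def atLeast0LessThan power2_eq_square)

lemma scalar_prod_self_nonneg: "0 \<le> v \<bullet> v" for v :: "real vec"
  by (simp add: scalar_prod_self sum_nonneg)

lemma scalar_prod_self_smult: "(a \<cdot>\<^sub>v v) \<bullet> (a \<cdot>\<^sub>v v) = a\<^sup>2 * (v \<bullet> v)" for v :: "real vec"
  by (simp add: scalar_prod_self sum_distrib_left power_mult_distrib)

lemma scalar_prod_young:
  fixes a b :: "real vec"
  assumes "a \<in> carrier_vec n" "b \<in> carrier_vec n" "0 < s"
  shows "2 * (a \<bullet> b) \<le> s * (a \<bullet> a) + (b \<bullet> b) / s"
proof -
  have "2 * (x * y) \<le> s * x\<^sup>2 + y\<^sup>2 / s" for x y :: real
  proof -
    have "0 \<le> (s * x - y)\<^sup>2 / s" using assms by simp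
    then show ?thesis using assms by (simp add: field_simps power2_eq_square)
  qed
  then have "(\<Sum>i<n. 2 * (a $ i * b $ i)) \<le> (\<Sum>i<n. s * (a $ i)\<^sup>2 + (b $ i)\<^sup>2 / s)"
    by (intro sum_mono)
  then show ?thesis using assms
    by (simp add: scalar_prod_def atLeast0LessThan sum_distrib_left sum.distrib sum_divide_distrib power2_eq_square)
qed

lemma scalar_prod_self_add:
  fixes a b :: "real vec"
  assumes "a \<in> carrier_vec n" "b \<in> carrier_vec n"
  shows "(a + b) \<bullet> (a + b) = a \<bullet> a + 2 * (a \<bullet> b) + b \<bullet> b"
  using assms
  by (simp add: add_scalar_prod_distrib[of _ n] scalar_prod_add_distrib[of _ n] comm_scalar_prod[of b n a])

lemma scalar_prod_self_add_le:
  fixes a b :: "real vec"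
  assumes "a \<in> carrier_vec n" "b \<in> carrier_vec n" "0 < s"
  shows "(a + b) \<bullet> (a + b) \<le> (1 + s) * (a \<bullet> a) + (1 + 1 / s) * (b \<bullet> b)"
  using scalar_prod_young[OF assms] by (simp add: scalar_prod_self_add[OF assms(1,2)] algebra_simps)

lemma mult_mat_vec_frobenius:
  fixes Q :: "real mat"
  assumes Q: "Q \<in> carrier_mat r c" and v: "v \<in> carrier_vec c"
  shows "(Q *\<^sub>v v) \<bullet> (Q *\<^sub>v v) \<le> (\<Sum>i<r. \<Sum>j<c. (Q $$ (i, j))\<^sup>2) * (v \<bullet> v)"
proof -
  have "(Q *\<^sub>v v) \<bullet> (Q *\<^sub>v v) = (\<Sum>i<r. (\<Sum>j<c. Q $$ (i, j) * v $ j)\<^sup>2)"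
    using Q v by (auto simp: scalar_prod_self scalar_prod_def atLeast0LessThan)
  also have "\<dots> \<le> (\<Sum>i<r. (\<Sum>j<c. (Q $$ (i, j))\<^sup>2) * (\<Sum>j<c. (v $ j)\<^sup>2))"
    by (intro sum_mono Cauchy_Schwarz_ineq_sum)
  also have "\<dots> = (\<Sum>i<r. \<Sum>j<c. (Q $$ (i, j))\<^sup>2) * (v \<bullet> v)"
    using v by (simp add: scalar_prod_self sum_distrib_right)
  finally show ?thesis .
qed

lemma mult_mat_vec_bounded:
  fixes Q :: "real mat"
  assumes Q: "Q \<in> carrier_mat r c"
  obtains \<kappa> where "0 < \<kappa>" "\<And>v. v \<in> carrier_vec c \<Longrightarrow> (Q *\<^sub>v v) \<bullet> (Q *\<^sub>v v) \<le> \<kappa> * (v \<bullet> v)"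
proof
  \<comment> \<open>The added 1 keeps the constant positive when Q is zero or empty.\<close>
  let ?\<kappa> = "(\<Sum>i<r. \<Sum>j<c. (Q $$ (i, j))\<^sup>2) + 1"
  show "0 < ?\<kappa>" by (intro add_nonneg_pos sum_nonneg) auto
  fix v :: "real vec" assume v: "v \<in> carrier_vec c"
  show "(Q *\<^sub>v v) \<bullet> (Q *\<^sub>v v) \<le> ?\<kappa> * (v \<bullet> v)"
    using mult_mat_vec_frobenius[OF Q v] scalar_prod_self_nonneg[of v] by (simp add: distrib_right)
qed

text \<open>The dimension n is a term, so the sphere is placed among sequences that vanish from n
  on. There the unit cube is compact by Tychonoff, and the sphere equation is closed because it
  involves finitely many coordinates.\<close>

lemma compact_unit_sphere_fun:
  "compact {f :: nat \<Rightarrow> real. (\<forall>i\<ge>n. f i = 0) \<and> (\<Sum>i<n. (f i)\<^sup>2) = 1}"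
proof -
  let ?S = "\<lambda>i. if i < n then cball 0 1 else {0::real}"
  have "compactin (product_topology (\<lambda>_. euclidean) UNIV) (PiE UNIV ?S)"
    unfolding compactin_PiE by (auto simp: compactin_euclidean_iff)
  then have K: "compact (PiE UNIV ?S)"
    by (simp add: euclidean_product_topology compactin_euclidean_iff)
  have cont: "continuous_on UNIV (\<lambda>f :: nat \<Rightarrow> real. \<Sum>i<n. (f i)\<^sup>2)"
    by (intro continuous_intros continuous_on_product_coordinates)
  have "closed {f :: nat \<Rightarrow> real. (\<Sum>i<n. (f i)\<^sup>2) = 1}"
    by (intro closed_Collect_eq cont continuous_on_const)
  then have "compact (PiE UNIV ?S \<inter> {f. (\<Sum>i<n. (f i)\<^sup>2) = 1})"
    by (rule compact_Int_closed[OF K])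
  moreover have "{f :: nat \<Rightarrow> real. (\<forall>i\<ge>n. f i = 0) \<and> (\<Sum>i<n. (f i)\<^sup>2) = 1} =
      PiE UNIV ?S \<inter> {f. (\<Sum>i<n. (f i)\<^sup>2) = 1}"
  proof (intro equalityI subsetI)
    fix f :: "nat \<Rightarrow> real"
    assume f: "f \<in> {f. (\<forall>i\<ge>n. f i = 0) \<and> (\<Sum>i<n. (f i)\<^sup>2) = 1}"
    have "\<bar>f i\<bar> \<le> 1" if "i < n" for i
    proof -
      have "(f i)\<^sup>2 \<le> (\<Sum>i<n. (f i)\<^sup>2)"
        by (rule member_le_sum) (use that in auto)
      then show ?thesis using f by (simp add: abs_square_le_1)
    qed
    then show "f \<in> PiE UNIV ?S \<inter> {f. (\<Sum>i<n. (f i)\<^sup>2) = 1}" using f by auto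
  next
    fix f :: "nat \<Rightarrow> real"
    assume f: "f \<in> PiE UNIV ?S \<inter> {f. (\<Sum>i<n. (f i)\<^sup>2) = 1}"
    then have "f i \<in> ?S i" for i by (intro PiE_mem[of f UNIV]) auto
    then have "\<forall>i\<ge>n. f i = 0" by (metis not_less singletonD)
    then show "f \<in> {f. (\<forall>i\<ge>n. f i = 0) \<and> (\<Sum>i<n. (f i)\<^sup>2) = 1}" using f by simp
  qed
  ultimately show ?thesis by simp
qed

text \<open>The quadratic form attains a negative maximum on the compact unit sphere; homogeneity
  carries this margin to all vectors.\<close>

lemma neg_definite_uniform:
  assumes X: "neg_definite X" "X \<in> carrier_mat n n"
  obtains \<epsilon> where "0 < \<epsilon>" "\<And>v. v \<in> carrier_vec n \<Longrightarrow> v \<bullet> (X *\<^sub>v v) \<le> - \<epsilon> * (v \<bullet> v)"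
proof -
  let ?S = "{f :: nat \<Rightarrow> real. (\<forall>i\<ge>n. f i = 0) \<and> (\<Sum>i<n. (f i)\<^sup>2) = 1}"
  let ?q = "\<lambda>f :: nat \<Rightarrow> real. \<Sum>i<n. f i * (\<Sum>j<n. X $$ (i, j) * f j)"
  have q: "v \<bullet> (X *\<^sub>v v) = ?q (\<lambda>i. if i < n then v $ i else 0)" if "v \<in> carrier_vec n" for v
    using that X(2) by (auto simp: scalar_prod_def atLeast0LessThan)
  have q_neg: "?q f < 0" if f: "f \<in> ?S" for f
  proof -
    have "vec n f \<noteq> 0\<^sub>v n"
    proof
      assume "vec n f = 0\<^sub>v n"
      then have "f i = 0" if "i < n" for i using that by (metis index_vec index_zero_vec(1))
      then show False using f by simp
    qed
    then have "vec n f \<bullet> (X *\<^sub>v vec n f) < 0"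
      using X by (auto simp: neg_definite_def)
    then show ?thesis using X(2) by (simp add: scalar_prod_def atLeast0LessThan)
  qed
  obtain \<epsilon> where \<epsilon>: "0 < \<epsilon>" "\<And>f. f \<in> ?S \<Longrightarrow> ?q f \<le> - \<epsilon>"
  proof (cases "?S = {}")
    \<comment> \<open>The sphere is empty exactly for n = 0, where any positive margin will
      do.\<close>
    case True
    show ?thesis by (rule that[of 1]) (use True in \<open>simp, blast\<close>)
  next
    case False
    have coord: "continuous_on ?S (\<lambda>f. f i)" for i
      by (rule continuous_on_subset[OF continuous_on_product_coordinates subset_UNIV])
    have "continuous_on ?S ?q"
      by (intro continuous_on_sum continuous_on_mult continuous_on_const coord)
    from continuous_attains_sup[OF compact_unit_sphere_fun False this]
    obtain g where g: "g \<in> ?S" "\<forall>f\<in>?S. ?q f \<le> ?q g" by (rule bexE)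
    show ?thesis
    proof (rule that[of "- ?q g"])
      show "0 < - ?q g" using q_neg[OF g(1)] by linarith
      show "?q f \<le> - (- ?q g)" if "f \<in> ?S" for f using bspec[OF g(2) that] by linarith
    qed
  qed
  show thesis
  proof (rule that[OF \<epsilon>(1)])
    fix v :: "real vec" assume v: "v \<in> carrier_vec n"
    let ?f = "\<lambda>i. if i < n then v $ i else 0"
    show "v \<bullet> (X *\<^sub>v v) \<le> - \<epsilon> * (v \<bullet> v)"
    proof (cases "v \<bullet> v = 0")
      case True
      then have "\<forall>i<n. v $ i = 0"
        using v by (simp add: scalar_prod_self sum_nonneg_eq_0_iff)
      then show ?thesis unfolding q[OF v] using True by simp
    next
      case False
      then have pos: "0 < v \<bullet> v" using scalar_prod_self_nonneg[of v] by simp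
      let ?c = "1 / sqrt (v \<bullet> v)"
      have "(\<Sum>i<n. (c * ?f i)\<^sup>2) = c\<^sup>2 * (v \<bullet> v)" for c
        using v by (simp add: scalar_prod_self sum_distrib_left power_mult_distrib)
      then have "(\<Sum>i<n. (?c * ?f i)\<^sup>2) = ?c\<^sup>2 * (v \<bullet> v)" .
      also have "\<dots> = 1" using pos by (simp add: power_divide)
      finally have "?q (\<lambda>i. ?c * ?f i) \<le> - \<epsilon>" by (intro \<epsilon>(2)) auto
      moreover have "?q (\<lambda>i. ?c * ?f i) = ?c\<^sup>2 * ?q ?f"
        by (simp add: sum_distrib_left power2_eq_square mult_ac)
      moreover have "?c\<^sup>2 = 1 / (v \<bullet> v)" using pos by (simp add: power_divide)
      ultimately have "?q ?f / (v \<bullet> v) \<le> - \<epsilon>" by simp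
      then show ?thesis unfolding q[OF v] using pos by (simp add: field_simps)
    qed
  qed
qed

subsection \<open>Block matrices and delay lines\<close>

lemma smult_mat_mult_vec:
  fixes A :: "real mat"
  assumes "A \<in> carrier_mat r c" "v \<in> carrier_vec c"
  shows "(k \<cdot>\<^sub>m A) *\<^sub>v v = k \<cdot>\<^sub>v (A *\<^sub>v v)"
  using assms by (intro eq_vecI) auto

lemma zero_mult_mat_vec:
  "v \<in> carrier_vec c \<Longrightarrow> 0\<^sub>m r c *\<^sub>v v = (0\<^sub>v r :: real vec)"
  by (intro eq_vecI) auto

lemma append_cols_carrier [simp]:
  "A \<in> carrier_mat r c \<Longrightarrow> B \<in> carrier_mat r d \<Longrightarrow> A @\<^sub>c B \<in> carrier_mat r (c + d)"
  unfolding append_cols_def by auto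

lemma append_cols_mult_vec:
  fixes A :: "real mat"
  assumes "A \<in> carrier_mat r c" "B \<in> carrier_mat r d" "v \<in> carrier_vec c" "w \<in> carrier_vec d"
  shows "(A @\<^sub>c B) *\<^sub>v (v @\<^sub>v w) = A *\<^sub>v v + B *\<^sub>v w"
proof -
  have "(A @\<^sub>c B) *\<^sub>v (v @\<^sub>v w) =
      (A *\<^sub>v v + B *\<^sub>v w) @\<^sub>v (0\<^sub>m 0 c *\<^sub>v v + 0\<^sub>m 0 d *\<^sub>v w)"
    using assms unfolding append_cols_def
    by (subst four_block_mat_mult_vec[of _ r c _ d _ 0]) auto
  then show ?thesis using assms by (intro eq_vecI) auto
qed

lemma four_block_quadratic_form:
  fixes A :: "real mat"
  assumes "A \<in> carrier_mat r r" "B \<in> carrier_mat r s" "C \<in> carrier_mat s r" "D \<in> carrier_mat s s"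
    "a \<in> carrier_vec r" "b \<in> carrier_vec s"
  shows "(a @\<^sub>v b) \<bullet> (four_block_mat A B C D *\<^sub>v (a @\<^sub>v b)) =
    a \<bullet> (A *\<^sub>v a) + a \<bullet> (B *\<^sub>v b) + b \<bullet> (C *\<^sub>v a) + b \<bullet> (D *\<^sub>v b)"
proof -
  have "(a @\<^sub>v b) \<bullet> (four_block_mat A B C D *\<^sub>v (a @\<^sub>v b)) =
      a \<bullet> (A *\<^sub>v a + B *\<^sub>v b) + b \<bullet> (C *\<^sub>v a + D *\<^sub>v b)"
    using assms by (subst four_block_mat_mult_vec, auto intro!: scalar_prod_append)
  then show ?thesis
    using assms by (simp add: scalar_prod_add_distrib[of a r] scalar_prod_add_distrib[of b s])
qed

lemma diag_block_quadratic_form: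
  fixes A :: "real mat"
  assumes "A \<in> carrier_mat r r" "diag_block_mat As \<in> carrier_mat s s"
    "a \<in> carrier_vec r" "b \<in> carrier_vec s"
  shows "(a @\<^sub>v b) \<bullet> (diag_block_mat (A # As) *\<^sub>v (a @\<^sub>v b)) =
    a \<bullet> (A *\<^sub>v a) + b \<bullet> (diag_block_mat As *\<^sub>v b)"
  using assms four_block_quadratic_form[of A r "0\<^sub>m r s" s "0\<^sub>m s r" "diag_block_mat As" a b]
  by (simp add: Let_def zero_mult_mat_vec)

lemma antidiag_quadratic_form:
  fixes M :: "real mat"
  assumes "M \<in> carrier_mat s r" "a \<in> carrier_vec r" "b \<in> carrier_vec s"
  shows "(a @\<^sub>v b) \<bullet> (four_block_mat (0\<^sub>m r r) (transpose_mat M) M (0\<^sub>m s s) *\<^sub>v (a @\<^sub>v b)) =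
    2 * (b \<bullet> (M *\<^sub>v a))"
proof -
  have "a \<bullet> (transpose_mat M *\<^sub>v b) = b \<bullet> (M *\<^sub>v a)"
    using assms transpose_vec_mult_scalar[of M s r a b]
    by (simp add: comm_scalar_prod[of a r])
  then show ?thesis
    using assms four_block_quadratic_form[of "0\<^sub>m r r" r "transpose_mat M" s M "0\<^sub>m s s" a b]
    by (simp add: zero_mult_mat_vec)
qed

lemma congruence_quadratic_form:
  fixes T :: "real mat"
  assumes "T \<in> carrier_mat r c" "D \<in> carrier_mat r r" "v \<in> carrier_vec c"
  shows "v \<bullet> ((transpose_mat T * D * T) *\<^sub>v v) = (T *\<^sub>v v) \<bullet> (D *\<^sub>v (T *\<^sub>v v))"
proof -
  have "(transpose_mat T * D * T) *\<^sub>v v = transpose_mat T *\<^sub>v (D *\<^sub>v (T *\<^sub>v v))"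
    using assms by (simp add: assoc_mult_mat_vec[of _ c r _ c] assoc_mult_mat_vec[of _ c r _ r])
  then show ?thesis
    using assms transpose_vec_mult_scalar[of T r c v "D *\<^sub>v (T *\<^sub>v v)"]
    by (simp add: comm_scalar_prod[of v c] comm_scalar_prod[of _ r "D *\<^sub>v _"])
qed

lemma diag_block_mat_two:
  fixes A B :: "'a::zero mat"
  assumes "A \<in> carrier_mat a c" "B \<in> carrier_mat b d"
  shows "diag_block_mat [A, B] = four_block_mat A (0\<^sub>m a d) (0\<^sub>m b c) B"
  unfolding diag_block_mat.simps(2)[of A "[B]"] diag_block_mat_singleton Let_def using assms by auto

section \<open>Kronecker products with an identity factor\<close>

lemma kron_dim [simp]:
  "dim_row (A \<otimes>\<^sub>m B) = dim_row A * dim_row B" "dim_col (A \<otimes>\<^sub>m B) = dim_col A * dim_col B"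
  by (auto simp: kron_def)

lemma kron_carrier:
  "A \<in> carrier_mat a b \<Longrightarrow> B \<in> carrier_mat c d \<Longrightarrow> A \<otimes>\<^sub>m B \<in> carrier_mat (a * c) (b * d)"
  by (auto simp: kron_def)

text \<open>The identity factor keeps the offset \<open>i mod p\<close> fixed, so M acts on block
  indices alone. All computations with delay lines go through this formula.\<close>

lemma kron_one_mult_vec:
  fixes M :: "real mat"
  assumes M: "M \<in> carrier_mat a b" and w: "w \<in> carrier_vec (b * p)" and i: "i < a * p"
  shows "((M \<otimes>\<^sub>m 1\<^sub>m p) *\<^sub>v w) $ i = (\<Sum>j<b. M $$ (i div p, j) * w $ (j * p + i mod p))"
proof -
  have p: "0 < p" using i by (cases p) auto
  have "((M \<otimes>\<^sub>m 1\<^sub>m p) *\<^sub>v w) $ i = (\<Sum>c<b * p. (M \<otimes>\<^sub>m 1\<^sub>m p) $$ (i, c) * w $ c)"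
    using assms by (simp add: kron_def scalar_prod_def atLeast0LessThan)
  also have "\<dots> = (\<Sum>c<b * p. M $$ (i div p, c div p) * (if i mod p = c mod p then 1 else 0) * w $ c)"
  proof (rule sum.cong)
    fix c assume "c \<in> {..<b * p}"
    then have "c < b * p" "i mod p < p" "c mod p < p" using p by auto
    then show "(M \<otimes>\<^sub>m 1\<^sub>m p) $$ (i, c) * w $ c =
        M $$ (i div p, c div p) * (if i mod p = c mod p then 1 else 0) * w $ c"
      using M i by (simp add: kron_def)
  qed simp
  also have "\<dots> = (\<Sum>j<b. \<Sum>l<p. M $$ (i div p, j) * (if i mod p = l then 1 else 0) * w $ (l + j * p))"
    unfolding sum_mult_product by (intro sum.cong) (use p in auto)
  also have "\<dots> = (\<Sum>j<b. M $$ (i div p, j) * w $ (j * p + i mod p))"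
  proof (rule sum.cong)
    fix j
    have "(\<Sum>l<p. M $$ (i div p, j) * (if i mod p = l then 1 else 0) * w $ (l + j * p)) =
        (\<Sum>l<p. if i mod p = l then M $$ (i div p, j) * w $ (l + j * p) else 0)"
      by (intro sum.cong) auto
    also have "\<dots> = M $$ (i div p, j) * w $ (j * p + i mod p)"
      using p by (simp add: sum.delta' add.commute)
    finally show "(\<Sum>l<p. M $$ (i div p, j) * (if i mod p = l then 1 else 0) * w $ (l + j * p)) =
      M $$ (i div p, j) * w $ (j * p + i mod p)" .
  qed simp
  finally show ?thesis .
qed

text \<open>\<open>A_Delta\<close> takes the Kronecker product after forming the block diagonal;
  exchanging the two lets each delay line be treated separately.\<close>

lemma kron_block_diag:
  fixes A B :: "real mat"
  assumes A: "A \<in> carrier_mat a c" and B: "B \<in> carrier_mat b d"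
  shows "diag_block_mat [A, B] \<otimes>\<^sub>m 1\<^sub>m p = diag_block_mat [A \<otimes>\<^sub>m 1\<^sub>m p, B \<otimes>\<^sub>m 1\<^sub>m p]"
proof -
  note A' = kron_carrier[OF A one_carrier_mat[of p]] and B' = kron_carrier[OF B one_carrier_mat[of p]]
  let ?l = "four_block_mat A (0\<^sub>m a d) (0\<^sub>m b c) B \<otimes>\<^sub>m 1\<^sub>m p"
  let ?r = "four_block_mat (A \<otimes>\<^sub>m 1\<^sub>m p) (0\<^sub>m (a * p) (d * p)) (0\<^sub>m (b * p) (c * p)) (B \<otimes>\<^sub>m 1\<^sub>m p)"
  show ?thesis unfolding diag_block_mat_two[OF A B] diag_block_mat_two[OF A' B']
  proof (rule eq_matI)
    show "dim_row ?l = dim_row ?r" "dim_col ?l = dim_col ?r"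
      using A B by (auto simp: distrib_right)
    fix i j assume "i < dim_row ?r" "j < dim_col ?r"
    then have i: "i < (a + b) * p" and j: "j < (c + d) * p"
      using A B by (auto simp: distrib_right)
    have p: "0 < p" using i by (cases p) auto
    have lt: "k div p < e \<longleftrightarrow> k < e * p" for k e using p by (simp add: div_less_iff_less_mult)
    have sub: "(k - e * p) div p = k div p - e" "(k - e * p) mod p = k mod p" if "\<not> k < e * p" for k e
    proof -
      have "k = (k - e * p) + e * p" using that by simp
      then have "k div p = (k - e * p) div p + e" "k mod p = (k - e * p) mod p"
        using p by (metis div_mult_self1 add.commute less_irrefl, metis mod_mult_self1)
      then show "(k - e * p) div p = k div p - e" "(k - e * p) mod p = k mod p" by auto
    qed
    have rest: "i - a * p < b * p" if "\<not> i < a * p" using i that by (simp add: distrib_right)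
    have rest': "j - c * p < d * p" if "\<not> j < c * p" using j that by (simp add: distrib_right)
    have ij: "i div p < a + b" "j div p < c + d" using i j by (auto simp: lt)
    have bl: "i div p - a < b" if "\<not> i div p < a" using ij that by linarith
    have bl': "j div p - c < d" if "\<not> j div p < c" using ij that by linarith
    have l: "?l $$ (i, j) = four_block_mat A (0\<^sub>m a d) (0\<^sub>m b c) B $$ (i div p, j div p) * 1\<^sub>m p $$ (i mod p, j mod p)"
      using A B i j by (simp add: kron_def)
    show "?l $$ (i, j) = ?r $$ (i, j)"
      unfolding l using A B i j p ij
      by (cases "i < a * p"; cases "j < c * p")
         (simp_all add: kron_def lt[of i a] lt[of j c] sub bl bl' rest rest' distrib_right[of a b p] distrib_right[of c d p])
  qed
qed

lemma diag_block_mult_vec: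
  fixes A B :: "real mat"
  assumes "A \<in> carrier_mat a c" "B \<in> carrier_mat b d" "v \<in> carrier_vec c" "w \<in> carrier_vec d"
  shows "diag_block_mat [A, B] *\<^sub>v (v @\<^sub>v w) = (A *\<^sub>v v) @\<^sub>v (B *\<^sub>v w)"
  using assms four_block_mat_mult_vec[of A a c "0\<^sub>m a d" d "0\<^sub>m b c" b B v w]
  unfolding diag_block_mat_two[OF assms(1,2)] by (simp add: zero_mult_mat_vec)

text \<open>\<open>hist p l s k\<close> stacks \<open>s (k - l), \<dots>, s (k - 1)\<close>, with zeros for negative times.\<close>

definition hist :: "nat \<Rightarrow> nat \<Rightarrow> (nat \<Rightarrow> real vec) \<Rightarrow> nat \<Rightarrow> real vec" where
  "hist p l s k = vec (l * p) (\<lambda>i. if l \<le> k + i div p then s (k + i div p - l) $ (i mod p) else 0)"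

lemma hist_carrier [simp]: "hist p l s k \<in> carrier_vec (l * p)"
  by (simp add: hist_def)

lemma hist_0 [simp]: "hist p l s 0 = 0\<^sub>v (l * p)"
proof -
  have "\<not> l \<le> i div p" if "i < l * p" for i
    using that by (simp add: not_le less_mult_imp_div_less)
  then show ?thesis by (intro eq_vecI) (auto simp: hist_def)
qed

lemma hist_index:
  assumes "a < l" "b < p"
  shows "hist p l s k $ (a * p + b) = (if l \<le> k + a then s (k + a - l) $ b else 0)"
proof -
  have "a * p + b < l * p"
  proof -
    have "a * p + b < a * p + p" using assms by simp
    also have "\<dots> = Suc a * p" by simp
    also have "\<dots> \<le> l * p" using assms by (intro mult_right_mono) auto
    finally show ?thesis .
  qed
  then show ?thesis using assms by (simp add: hist_def)
qed

text \<open>\<open>S_mat\<close> moves every block one place towards the oldest end and frees the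
  last place, which \<open>e_mat\<close> fills with the current signal. Because signals are zero at
  negative times, the recursion holds from k = 0 with zero filter state.\<close>

lemma hist_step:
  assumes s: "s k \<in> carrier_vec p"
  shows "(S_mat l \<otimes>\<^sub>m 1\<^sub>m p) *\<^sub>v hist p l s k + (e_mat l \<otimes>\<^sub>m 1\<^sub>m p) *\<^sub>v s k = hist p l s (Suc k)"
    (is "?v + ?w = _")
proof (rule eq_vecI)
  have S: "S_mat l \<in> carrier_mat l l" and e: "e_mat l \<in> carrier_mat l 1"
    by (auto simp: S_mat_def e_mat_def)
  show "dim_vec (?v + ?w) = dim_vec (hist p l s (Suc k))"
    by (simp add: kron_def e_mat_def hist_def)
  fix i assume "i < dim_vec (hist p l s (Suc k))"
  then have i: "i < l * p" by (simp add: hist_def)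
  then have p: "0 < p" by (cases p) auto
  let ?a = "i div p" and ?b = "i mod p"
  have a: "?a < l" and b: "?b < p" using i p by (auto simp: less_mult_imp_div_less)
  have v: "?v $ i = (if Suc ?a < l then hist p l s k $ (Suc ?a * p + ?b) else 0)"
  proof -
    have "?v $ i = (\<Sum>j<l. S_mat l $$ (?a, j) * hist p l s k $ (j * p + ?b))"
      by (rule kron_one_mult_vec[OF S _ i]) simp
    also have "\<dots> = (\<Sum>j<l. if j = Suc ?a then hist p l s k $ (j * p + ?b) else 0)"
      by (intro sum.cong) (use a in \<open>auto simp: S_mat_def\<close>)
    finally show ?thesis by simp
  qed
  have w: "?w $ i = (if Suc ?a = l then s k $ ?b else 0)"
    using kron_one_mult_vec[OF e _ i, of "s k"] s a by (simp add: e_mat_def)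
  have "hist p l s (Suc k) $ i = (if l \<le> Suc k + ?a then s (Suc k + ?a - l) $ ?b else 0)"
    using hist_index[OF a b, of s "Suc k"] by simp
  moreover have "(?v + ?w) $ i = ?v $ i + ?w $ i"
    using i by (simp add: kron_def e_mat_def)
  moreover have "Suc ?a < l \<Longrightarrow> hist p l s k $ (Suc ?a * p + ?b) =
      (if l \<le> k + Suc ?a then s (k + Suc ?a - l) $ ?b else 0)"
    by (rule hist_index) (use b in auto)
  ultimately show "(?v + ?w) $ i = hist p l s (Suc k) $ i"
    using v w a by (cases "Suc ?a = l") auto
qed

lemma weighted_hist:
  assumes "\<And>j. s j \<in> carrier_vec p" and u: "u \<in> carrier_vec p"
  shows "u \<bullet> ((mat 1 l (\<lambda>(_, a). \<nu> a) \<otimes>\<^sub>m 1\<^sub>m p) *\<^sub>v hist p l s k) =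
    (\<Sum>a<l. \<nu> a * (if l \<le> k + a then u \<bullet> s (k + a - l) else 0))"
proof -
  let ?M = "mat 1 l (\<lambda>(_, a). \<nu> a)"
  have comp: "((?M \<otimes>\<^sub>m 1\<^sub>m p) *\<^sub>v hist p l s k) $ b =
      (\<Sum>a<l. \<nu> a * (if l \<le> k + a then s (k + a - l) $ b else 0))" if "b < p" for b
    using kron_one_mult_vec[of ?M 1 l "hist p l s k" p b] that by (simp add: hist_index)
  have "u \<bullet> ((?M \<otimes>\<^sub>m 1\<^sub>m p) *\<^sub>v hist p l s k) =
      (\<Sum>b<p. u $ b * (\<Sum>a<l. \<nu> a * (if l \<le> k + a then s (k + a - l) $ b else 0)))"
    unfolding scalar_prod_def[of u] by (simp add: atLeast0LessThan comp del: index_mult_mat_vec One_nat_def)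
  also have "\<dots> = (\<Sum>a<l. \<Sum>b<p. u $ b * (\<nu> a * (if l \<le> k + a then s (k + a - l) $ b else 0)))"
    unfolding sum_distrib_left by (rule sum.swap)
  also have "\<dots> = (\<Sum>a<l. \<nu> a * (if l \<le> k + a then u \<bullet> s (k + a - l) else 0))"
  proof (rule sum.cong)
    fix a
    have "u \<bullet> s (k + a - l) = (\<Sum>b<p. u $ b * s (k + a - l) $ b)"
      by (simp add: scalar_prod_def atLeast0LessThan carrier_vecD[OF assms(1)])
    then show "(\<Sum>b<p. u $ b * (\<nu> a * (if l \<le> k + a then s (k + a - l) $ b else 0))) =
        \<nu> a * (if l \<le> k + a then u \<bullet> s (k + a - l) else 0)"
      by (cases "l \<le> k + a") (simp_all add: sum_distrib_left mult_ac)
  qed simp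
  finally show ?thesis .
qed

text \<open>Block a of \<open>hist\<close> carries delay l - a: position 0 is the oldest, and the
  delays run through 1, ..., l.\<close>

lemma sum_delay_reindex:
  fixes \<nu> f :: "nat \<Rightarrow> real"
  shows "(\<Sum>a<l. \<nu> (l - a) * (if l \<le> k + a then f (k + a - l) else 0)) =
    (\<Sum>i=1..l. \<nu> i * (if i \<le> k then f (k - i) else 0))"
proof (rule sum.reindex_bij_witness[of _ "\<lambda>i. l - i" "\<lambda>a. l - a"])
  fix a assume "a \<in> {..<l}"
  then have a: "a < l" by simp
  show "l - (l - a) = a" "l - a \<in> {1..l}" using a by auto
  have "l - a \<le> k \<longleftrightarrow> l \<le> k + a" "k - (l - a) = k + a - l" using a by auto
  then show "\<nu> (l - a) * (if l - a \<le> k then f (k - (l - a)) else 0) =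
      \<nu> (l - a) * (if l \<le> k + a then f (k + a - l) else 0)" by (simp only:)
qed auto

text \<open>In \<open>Mm\<close> the block at position a has index a - l, which is minus the delay
  stored at position a of \<open>hist\<close>; the two orders already agree.\<close>

lemma weighted_hist_anticausal:
  assumes "\<And>j. s j \<in> carrier_vec p" "u \<in> carrier_vec p"
  shows "u \<bullet> ((mat 1 l (\<lambda>(_, a). \<mu> (int a - int l)) \<otimes>\<^sub>m 1\<^sub>m p) *\<^sub>v hist p l s k) =
    (\<Sum>i=1..l. \<mu> (- int i) * (if i \<le> k then u \<bullet> s (k - i) else 0))"
proof -
  have \<nu>: "\<mu> (int a - int l) = \<mu> (- int (l - a))" if "a < l" for a
  proof -
    have "int a - int l = - int (l - a)" using that by simp
    then show ?thesis by (rule arg_cong)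
  qed
  have "u \<bullet> ((mat 1 l (\<lambda>(_, a). \<mu> (int a - int l)) \<otimes>\<^sub>m 1\<^sub>m p) *\<^sub>v hist p l s k) =
      (\<Sum>a<l. \<mu> (int a - int l) * (if l \<le> k + a then u \<bullet> s (k + a - l) else 0))"
    by (rule weighted_hist[OF assms])
  also have "\<dots> = (\<Sum>a<l. \<mu> (- int (l - a)) * (if l \<le> k + a then u \<bullet> s (k + a - l) else 0))"
  proof (rule sum.cong)
    fix a assume "a \<in> {..<l}"
    then show "\<mu> (int a - int l) * (if l \<le> k + a then u \<bullet> s (k + a - l) else 0) =
        \<mu> (- int (l - a)) * (if l \<le> k + a then u \<bullet> s (k + a - l) else 0)"
      unfolding lessThan_iff by (subst \<nu>) (assumption, rule refl)
  qed (rule refl)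
  also have "\<dots> = (\<Sum>i=1..l. \<mu> (- int i) * (if i \<le> k then u \<bullet> s (k - i) else 0))"
    by (rule sum_delay_reindex)
  finally show ?thesis .
qed

text \<open>The order in which \<open>C_Delta\<close> outputs the second delay line: newest block
  first, as the blocks M 1, M 2, ... of \<open>Mp\<close> require.\<close>

definition hist_rev :: "nat \<Rightarrow> nat \<Rightarrow> (nat \<Rightarrow> real vec) \<Rightarrow> nat \<Rightarrow> real vec" where
  "hist_rev p l s k = (J_mat l \<otimes>\<^sub>m 1\<^sub>m p) *\<^sub>v hist p l s k"

lemma hist_rev_carrier [simp]: "hist_rev p l s k \<in> carrier_vec (l * p)"
  unfolding carrier_vec_def hist_rev_def by (simp add: J_mat_def del: index_mult_mat_vec)

text \<open>The reversal is moved from the signal to the weights: the row of weights times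
  \<open>J_mat\<close> is the reversed row \<open>?M'\<close>, which meets \<open>hist\<close> in
  its natural order.\<close>

lemma weighted_hist_causal:
  assumes s: "\<And>j. s j \<in> carrier_vec p" and u: "u \<in> carrier_vec p"
  shows "u \<bullet> ((mat 1 l (\<lambda>(_, a). \<mu> (int a + 1)) \<otimes>\<^sub>m 1\<^sub>m p) *\<^sub>v hist_rev p l s k) =
    (\<Sum>i=1..l. \<mu> (int i) * (if i \<le> k then u \<bullet> s (k - i) else 0))"
proof -
  let ?M = "mat 1 l (\<lambda>(_, a). \<mu> (int a + 1))"
  let ?M' = "mat 1 l (\<lambda>(_, a). \<mu> (int l - int a))"
  have J: "J_mat l \<in> carrier_mat l l" by (simp add: J_mat_def)
  have rev: "hist_rev p l s k $ (a * p + b) = hist p l s k $ ((l - Suc a) * p + b)" if "a < l" "b < p" for a b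
  proof -
    have i: "a * p + b < l * p"
    proof -
      have "a * p + b < Suc a * p" using that by simp
      also have "\<dots> \<le> l * p" using that by (intro mult_right_mono) auto
      finally show ?thesis .
    qed
    have "hist_rev p l s k $ (a * p + b) = (\<Sum>j<l. J_mat l $$ (a, j) * hist p l s k $ (j * p + b))"
      unfolding hist_rev_def using kron_one_mult_vec[OF J _ i, of "hist p l s k"] that by simp
    also have "\<dots> = (\<Sum>j<l. if j = l - Suc a then hist p l s k $ (j * p + b) else 0)"
      by (intro sum.cong) (use that in \<open>auto simp: J_mat_def\<close>)
    finally show ?thesis using that by simp
  qed
  have "(?M \<otimes>\<^sub>m 1\<^sub>m p) *\<^sub>v hist_rev p l s k = (?M' \<otimes>\<^sub>m 1\<^sub>m p) *\<^sub>v hist p l s k"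
  proof (rule eq_vecI)
    fix b assume "b < dim_vec ((?M' \<otimes>\<^sub>m 1\<^sub>m p) *\<^sub>v hist p l s k)"
    then have b: "b < p" by simp
    define g where "g = (\<lambda>a. \<mu> (int l - int a) * hist p l s k $ (a * p + b))"
    have "((?M \<otimes>\<^sub>m 1\<^sub>m p) *\<^sub>v hist_rev p l s k) $ b = (\<Sum>a<l. \<mu> (int a + 1) * hist p l s k $ ((l - Suc a) * p + b))"
      using kron_one_mult_vec[of ?M 1 l "hist_rev p l s k" p b] b by (simp add: rev)
    also have "\<dots> = (\<Sum>a<l. g (l - Suc a))"
    proof (rule sum.cong)
      fix a assume "a \<in> {..<l}"
      then have "int l - int (l - Suc a) = int a + 1" by simp
      then show "\<mu> (int a + 1) * hist p l s k $ ((l - Suc a) * p + b) = g (l - Suc a)"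
        by (simp only: g_def)
    qed (rule refl)
    also have "\<dots> = sum g {..<l}"
      by (rule sum.nat_diff_reindex)
    also have "\<dots> = (\<Sum>a<l. \<mu> (int l - int a) * hist p l s k $ (a * p + b))"
      unfolding g_def by (rule refl)
    also have "\<dots> = ((?M' \<otimes>\<^sub>m 1\<^sub>m p) *\<^sub>v hist p l s k) $ b"
      using kron_one_mult_vec[of ?M' 1 l "hist p l s k" p b] b by simp
    finally show "((?M \<otimes>\<^sub>m 1\<^sub>m p) *\<^sub>v hist_rev p l s k) $ b = ((?M' \<otimes>\<^sub>m 1\<^sub>m p) *\<^sub>v hist p l s k) $ b" .
  qed simp
  then have "u \<bullet> ((?M \<otimes>\<^sub>m 1\<^sub>m p) *\<^sub>v hist_rev p l s k) =
      (\<Sum>a<l. \<mu> (int l - int a) * (if l \<le> k + a then u \<bullet> s (k + a - l) else 0))"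
    by (simp only: weighted_hist[OF assms, where \<nu> = "\<lambda>a. \<mu> (int l - int a)"])
  also have "\<dots> = (\<Sum>i=1..l. \<mu> (int i) * (if i \<le> k then u \<bullet> s (k - i) else 0))"
  proof -
    have \<nu>: "\<mu> (int l - int a) = \<mu> (int (l - a))" if "a < l" for a
    proof -
      have "int l - int a = int (l - a)" using that by simp
      then show ?thesis by (rule arg_cong)
    qed
    have "(\<Sum>a<l. \<mu> (int l - int a) * (if l \<le> k + a then u \<bullet> s (k + a - l) else 0)) =
        (\<Sum>a<l. \<mu> (int (l - a)) * (if l \<le> k + a then u \<bullet> s (k + a - l) else 0))"
    proof (rule sum.cong)
      fix a assume "a \<in> {..<l}"
      then show "\<mu> (int l - int a) * (if l \<le> k + a then u \<bullet> s (k + a - l) else 0) =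
          \<mu> (int (l - a)) * (if l \<le> k + a then u \<bullet> s (k + a - l) else 0)"
        unfolding lessThan_iff by (subst \<nu>) (assumption, rule refl)
    qed (rule refl)
    then show ?thesis using sum_delay_reindex by (rule trans)
  qed
  finally show ?thesis .
qed

section \<open>Scalar form of the multiplier conditions\<close>

lemma append_cols_index:
  assumes "A \<in> carrier_mat r c" "B \<in> carrier_mat r d" "i < r" "j < c + d"
  shows "(A @\<^sub>c B) $$ (i, j) = (if j < c then A $$ (i, j) else B $$ (i, j - c))"
  using assms unfolding append_cols_def by auto

text \<open>The concatenated row determines each block by its column range. Since the blocks are
  multiples of the identity, a single entry of each elementwise inequality already yields the scalar
  condition; that entry exists because p is positive.\<close>

lemma multipliers_blocks:
  assumes Mm: "Mm \<in> carrier_mat p (lm * p)" and M0: "M0 \<in> carrier_mat p p"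
    and Mp: "Mp \<in> carrier_mat p (lp * p)"
    and mem: "(Mm @\<^sub>c M0 @\<^sub>c Mp) \<in> multipliers \<rho> lp lm p" and p: "0 < p"
  obtains \<mu> where
    "Mm = mat 1 lm (\<lambda>(_, a). \<mu> (int a - int lm)) \<otimes>\<^sub>m 1\<^sub>m p"
    "M0 = \<mu> 0 \<cdot>\<^sub>m 1\<^sub>m p"
    "Mp = mat 1 lp (\<lambda>(_, a). \<mu> (int a + 1)) \<otimes>\<^sub>m 1\<^sub>m p"
    "\<And>i. i \<in> {- int lm..int lp} \<Longrightarrow> i \<noteq> 0 \<Longrightarrow> \<mu> i \<le> 0"
    "0 \<le> (\<Sum>i\<in>{- int lm..int lp}. \<mu> i * \<rho> powi (- i))"
    "0 \<le> (\<Sum>i\<in>{- int lm..int lp}. \<mu> i * \<rho> powi i)"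
proof -
  let ?I = "{- int lm..int lp}"
  let ?one = "vec p (\<lambda>_. 1) :: real vec"
  from mem obtain M \<mu> where
    E: "Mm @\<^sub>c M0 @\<^sub>c Mp = mat p ((lm + 1 + lp) * p) (\<lambda>(r, c). M (int (c div p) - int lm) $$ (r, c mod p))"
    and M': "\<forall>i\<in>?I. M i = \<mu> i \<cdot>\<^sub>m 1\<^sub>m p" and sign': "\<forall>i\<in>?I. i \<noteq> 0 \<longrightarrow> \<mu> i \<le> 0"
    and row: "mat p p (\<lambda>rc. \<Sum>i\<in>?I. M i $$ rc * \<rho> powi (- i)) *\<^sub>v ?one \<ge> 0\<^sub>v p"
    and col: "mat_of_row ?one * mat p p (\<lambda>rc. \<Sum>i\<in>?I. M i $$ rc * \<rho> powi i) \<ge> 0\<^sub>m 1 p"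
    unfolding multipliers_def mem_Collect_eq by (elim exE conjE) (rule that)
  note M = bspec[OF M'] and sign = bspec[OF sign', THEN mp]
  have R: "M0 @\<^sub>c Mp \<in> carrier_mat p (p + lp * p)" using M0 Mp by simp
  have entry: "(Mm @\<^sub>c M0 @\<^sub>c Mp) $$ (r, c) = \<mu> (int (c div p) - int lm) * (if r = c mod p then 1 else 0)"
    if "r < p" "c < (lm + 1 + lp) * p" for r c
  proof -
    have "c div p < lm + 1 + lp" using that by (simp add: less_mult_imp_div_less)
    then have "int (c div p) - int lm \<in> ?I" by simp
    then show ?thesis unfolding E using that p by (simp add: M)
  qed
  have em: "Mm $$ (r, c) = \<mu> (int (c div p) - int lm) * (if r = c mod p then 1 else 0)"
    if "r < p" "c < lm * p" for r c
  proof -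
    have "c < (lm + 1 + lp) * p" using that by (simp add: distrib_right)
    then show ?thesis
      using entry[of r c] append_cols_index[OF Mm R, of r c] that by (simp add: distrib_right)
  qed
  have e0: "M0 $$ (r, c) = \<mu> 0 * (if r = c then 1 else 0)" if "r < p" "c < p" for r c
  proof -
    have "lm * p + c < (lm + 1 + lp) * p" using that by (simp add: distrib_right)
    moreover have "(lm * p + c) div p = lm" "(lm * p + c) mod p = c" using that by auto
    ultimately show ?thesis
      using entry[of r "lm * p + c"] append_cols_index[OF Mm R, of r "lm * p + c"]
        append_cols_index[OF M0 Mp, of r c] that by simp
  qed
  have ep: "Mp $$ (r, c) = \<mu> (int (c div p) + 1) * (if r = c mod p then 1 else 0)"
    if "r < p" "c < lp * p" for r c
  proof -
    have lt: "lm * p + (p + c) < (lm + 1 + lp) * p" using that by (simp add: distrib_right)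
    \<comment> \<open>Column c of \<open>Mp\<close> comes after \<open>lm\<close> blocks of
      \<open>Mm\<close> and one block \<open>M0\<close>, hence the index c div p + 1.\<close>
    have "lm * p + (p + c) = (lm + 1) * p + c" by simp
    then have dm: "(lm * p + (p + c)) div p = lm + 1 + c div p" "(lm * p + (p + c)) mod p = c mod p"
      using p by (simp_all only: div_mult_self3 mod_mult_self3)
    have ix: "int (lm + 1 + c div p) - int lm = int (c div p) + 1" by simp
    show ?thesis
      using entry[OF that(1) lt] append_cols_index[OF Mm R that(1), of "lm * p + (p + c)"]
        append_cols_index[OF M0 Mp that(1), of "p + c"] that unfolding dm ix by simp
  qed
  \<comment> \<open>Multiplying by the all-ones vector adds up row 0, respectively column 0, where
    only the diagonal entry of each block survives. The exponent h is negation for the row condition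
    and the identity for the column condition.\<close>
  have sum_diag: "(\<Sum>c<p. \<Sum>i\<in>?I. M i $$ (0, c) * \<rho> powi (h i)) = (\<Sum>i\<in>?I. \<mu> i * \<rho> powi (h i))"
    "(\<Sum>c<p. \<Sum>i\<in>?I. M i $$ (c, 0) * \<rho> powi (h i)) = (\<Sum>i\<in>?I. \<mu> i * \<rho> powi (h i))" for h
  proof -
    have "(\<Sum>c<p. M i $$ (0, c) * \<rho> powi (h i)) = \<mu> i * \<rho> powi (h i)"
      "(\<Sum>c<p. M i $$ (c, 0) * \<rho> powi (h i)) = \<mu> i * \<rho> powi (h i)" if "i \<in> ?I" for i
    proof -
      have "(\<Sum>c<p. M i $$ (0, c) * \<rho> powi (h i)) = (\<Sum>c<p. if c = 0 then \<mu> i * \<rho> powi (h i) else 0)"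
        "(\<Sum>c<p. M i $$ (c, 0) * \<rho> powi (h i)) = (\<Sum>c<p. if c = 0 then \<mu> i * \<rho> powi (h i) else 0)"
        unfolding M[OF that] by (intro sum.cong; use p in simp)+
      then show "(\<Sum>c<p. M i $$ (0, c) * \<rho> powi (h i)) = \<mu> i * \<rho> powi (h i)"
        "(\<Sum>c<p. M i $$ (c, 0) * \<rho> powi (h i)) = \<mu> i * \<rho> powi (h i)" using p by simp_all
    qed
    then show "(\<Sum>c<p. \<Sum>i\<in>?I. M i $$ (0, c) * \<rho> powi (h i)) = (\<Sum>i\<in>?I. \<mu> i * \<rho> powi (h i))"
      "(\<Sum>c<p. \<Sum>i\<in>?I. M i $$ (c, 0) * \<rho> powi (h i)) = (\<Sum>i\<in>?I. \<mu> i * \<rho> powi (h i))"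
      by (simp_all add: sum.swap[of _ ?I])
  qed
  show thesis
  proof (rule that[of \<mu>])
    show "Mm = mat 1 lm (\<lambda>(_, a). \<mu> (int a - int lm)) \<otimes>\<^sub>m 1\<^sub>m p"
      by (rule eq_matI) (use Mm p in \<open>auto simp: em kron_def less_mult_imp_div_less\<close>)
    show "M0 = \<mu> 0 \<cdot>\<^sub>m 1\<^sub>m p"
      by (rule eq_matI) (use M0 in \<open>auto simp: e0\<close>)
    show "Mp = mat 1 lp (\<lambda>(_, a). \<mu> (int a + 1)) \<otimes>\<^sub>m 1\<^sub>m p"
      by (rule eq_matI) (use Mp p in \<open>auto simp: ep kron_def less_mult_imp_div_less\<close>)
    show "\<mu> i \<le> 0" if "i \<in> ?I" "i \<noteq> 0" for i using sign that .
    have "0 \<le> (mat p p (\<lambda>rc. \<Sum>i\<in>?I. M i $$ rc * \<rho> powi (- i)) *\<^sub>v ?one) $ 0"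
      using row p by (auto simp: less_eq_vec_def)
    then show "0 \<le> (\<Sum>i\<in>?I. \<mu> i * \<rho> powi (- i))"
      using p sum_diag(1)[of uminus] by (simp add: scalar_prod_def atLeast0LessThan)
    have "0 \<le> (mat_of_row ?one * mat p p (\<lambda>rc. \<Sum>i\<in>?I. M i $$ rc * \<rho> powi i)) $$ (0, 0)"
      using col p by (auto simp: less_eq_mat_def)
    then show "0 \<le> (\<Sum>i\<in>?I. \<mu> i * \<rho> powi i)"
      using p sum_diag(2)[of "\<lambda>i. i"] by (simp add: scalar_prod_def atLeast0LessThan)
  qed
qed

subsection \<open>The extended plant\<close>

lemma append_vec_assoc: "(x @\<^sub>v y) @\<^sub>v z = x @\<^sub>v (y @\<^sub>v z)"
  by (intro eq_vecI) (auto simp: less_diff_conv2)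

lemma smult_append_vec: "k \<cdot>\<^sub>v (a @\<^sub>v b) = (k \<cdot>\<^sub>v a) @\<^sub>v (k \<cdot>\<^sub>v b)" for k :: real
  by (intro eq_vecI) auto

text \<open>The first output of \<open>W_hat\<close>, that is, the signal p of the Zames-Falb sums;
  the second output is u itself.\<close>

definition out_filter :: "real \<Rightarrow> real \<Rightarrow> real vec \<Rightarrow> real vec \<Rightarrow> real vec" where
  "out_filter m L y u = (L - m) \<cdot>\<^sub>v y - u"

lemma out_filter_carrier [simp]:
  "u \<in> carrier_vec p \<Longrightarrow> out_filter m L y u \<in> carrier_vec p"
  unfolding out_filter_def by (rule carrier_vecI) (simp add: carrier_vecD)

lemma W_hat_mult_vec:
  assumes "y \<in> carrier_vec p" "u \<in> carrier_vec p"
  shows "W_hat p m L *\<^sub>v (y @\<^sub>v u) = out_filter m L y u @\<^sub>v u"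
proof -
  have 1: "((L - m) \<cdot>\<^sub>m 1\<^sub>m p) *\<^sub>v y = (L - m) \<cdot>\<^sub>v y"
    using assms by (simp add: smult_mat_mult_vec[of _ p p])
  have 2: "(- 1\<^sub>m p) *\<^sub>v u = - u"
    using assms by (intro eq_vecI) auto
  have "W_hat p m L *\<^sub>v (y @\<^sub>v u) =
      (((L - m) \<cdot>\<^sub>m 1\<^sub>m p) *\<^sub>v y + (- 1\<^sub>m p) *\<^sub>v u) @\<^sub>v (0\<^sub>m p p *\<^sub>v y + 1\<^sub>m p *\<^sub>v u)"
    unfolding W_hat_def using assms by (intro four_block_mat_mult_vec[of _ p p _ p _ p]) auto
  also have "\<dots> = out_filter m L y u @\<^sub>v u"
    unfolding 1 2 out_filter_def using assms by (simp add: zero_mult_mat_vec minus_add_uminus_vec[of _ p])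
  finally show ?thesis .
qed

lemma W_hat_carrier [simp]: "W_hat p m L \<in> carrier_mat (p + p) (p + p)"
  unfolding W_hat_def by (intro four_block_carrier_mat) auto

lemma shift_carriers [simp]:
  "S_mat l \<otimes>\<^sub>m 1\<^sub>m p \<in> carrier_mat (l * p) (l * p)"
  "e_mat l \<otimes>\<^sub>m 1\<^sub>m p \<in> carrier_mat (l * p) p"
  "J_mat l \<otimes>\<^sub>m 1\<^sub>m p \<in> carrier_mat (l * p) (l * p)"
  by (auto simp: S_mat_def e_mat_def J_mat_def)

lemma block_diag_carrier:
  fixes X Y :: "real mat"
  assumes "X \<in> carrier_mat a c" "Y \<in> carrier_mat b d"
  shows "diag_block_mat [X, Y] \<in> carrier_mat (a + b) (c + d)"
  unfolding diag_block_mat_two[OF assms] using assms by auto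

lemma A_Delta_carrier: "A_Delta lp lm p \<in> carrier_mat (lm * p + lp * p) (lm * p + lp * p)"
  unfolding A_Delta_def
  by (subst kron_block_diag) (auto simp: S_mat_def intro: block_diag_carrier)

lemma A_Delta_mult_vec:
  assumes "a \<in> carrier_vec (lm * p)" "b \<in> carrier_vec (lp * p)"
  shows "A_Delta lp lm p *\<^sub>v (a @\<^sub>v b) =
    ((S_mat lm \<otimes>\<^sub>m 1\<^sub>m p) *\<^sub>v a) @\<^sub>v ((S_mat lp \<otimes>\<^sub>m 1\<^sub>m p) *\<^sub>v b)"
proof -
  have S: "S_mat l \<in> carrier_mat l l" for l by (simp add: S_mat_def)
  show ?thesis
    unfolding A_Delta_def kron_block_diag[OF S S]
    by (rule diag_block_mult_vec[OF shift_carriers(1) shift_carriers(1) assms])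
qed

lemma B_Delta_carrier: "B_Delta lp lm p m L \<in> carrier_mat (lm * p + lp * p) (p + p)"
  unfolding B_Delta_def
  by (intro mult_carrier_mat[OF block_diag_carrier[OF shift_carriers(2) shift_carriers(2)]]) simp

lemma B_Delta_mult_vec:
  assumes "y \<in> carrier_vec p" "u \<in> carrier_vec p"
  shows "B_Delta lp lm p m L *\<^sub>v (y @\<^sub>v u) =
    ((e_mat lm \<otimes>\<^sub>m 1\<^sub>m p) *\<^sub>v out_filter m L y u) @\<^sub>v ((e_mat lp \<otimes>\<^sub>m 1\<^sub>m p) *\<^sub>v u)"
proof -
  have "B_Delta lp lm p m L *\<^sub>v (y @\<^sub>v u) =
      diag_block_mat [e_mat lm \<otimes>\<^sub>m 1\<^sub>m p, e_mat lp \<otimes>\<^sub>m 1\<^sub>m p] *\<^sub>v (W_hat p m L *\<^sub>v (y @\<^sub>v u))"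
    unfolding B_Delta_def
    by (intro assoc_mult_mat_vec[OF block_diag_carrier[OF shift_carriers(2) shift_carriers(2)] W_hat_carrier])
       (use assms in simp)
  also have "\<dots> = ((e_mat lm \<otimes>\<^sub>m 1\<^sub>m p) *\<^sub>v out_filter m L y u) @\<^sub>v ((e_mat lp \<otimes>\<^sub>m 1\<^sub>m p) *\<^sub>v u)"
    unfolding W_hat_mult_vec[OF assms]
    by (intro diag_block_mult_vec[OF shift_carriers(2) shift_carriers(2)]) (use assms in simp_all)
  finally show ?thesis .
qed

lemma six_block_rows:
  fixes M1 M2 M3 M4 M5 M6 :: "real mat"
  assumes "M1 \<in> carrier_mat r1 c" "M2 \<in> carrier_mat r2 c" "M3 \<in> carrier_mat r3 c"
    "M4 \<in> carrier_mat r4 c" "M5 \<in> carrier_mat r5 c" "M6 \<in> carrier_mat r6 c"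
  shows "M1 @\<^sub>r M2 @\<^sub>r M3 @\<^sub>r M4 @\<^sub>r M5 @\<^sub>r M6 \<in> carrier_mat (r1 + (r2 + (r3 + (r4 + (r5 + r6))))) c"
    and "v \<in> carrier_vec c \<Longrightarrow> (M1 @\<^sub>r M2 @\<^sub>r M3 @\<^sub>r M4 @\<^sub>r M5 @\<^sub>r M6) *\<^sub>v v =
      (M1 *\<^sub>v v) @\<^sub>v (M2 *\<^sub>v v) @\<^sub>v (M3 *\<^sub>v v) @\<^sub>v (M4 *\<^sub>v v) @\<^sub>v (M5 *\<^sub>v v) @\<^sub>v (M6 *\<^sub>v v)"
proof -
  note c56 = carrier_append_rows[OF assms(5,6)]
  note c46 = carrier_append_rows[OF assms(4) c56]
  note c36 = carrier_append_rows[OF assms(3) c46]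
  note c26 = carrier_append_rows[OF assms(2) c36]
  show "M1 @\<^sub>r M2 @\<^sub>r M3 @\<^sub>r M4 @\<^sub>r M5 @\<^sub>r M6 \<in> carrier_mat (r1 + (r2 + (r3 + (r4 + (r5 + r6))))) c"
    by (rule carrier_append_rows[OF assms(1) c26])
  assume v: "v \<in> carrier_vec c"
  show "(M1 @\<^sub>r M2 @\<^sub>r M3 @\<^sub>r M4 @\<^sub>r M5 @\<^sub>r M6) *\<^sub>v v =
      (M1 *\<^sub>v v) @\<^sub>v (M2 *\<^sub>v v) @\<^sub>v (M3 *\<^sub>v v) @\<^sub>v (M4 *\<^sub>v v) @\<^sub>v (M5 *\<^sub>v v) @\<^sub>v (M6 *\<^sub>v v)"
    unfolding mat_mult_append[OF assms(1) c26 v] mat_mult_append[OF assms(2) c36 v]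
      mat_mult_append[OF assms(3) c46 v] mat_mult_append[OF assms(4) c56 v] mat_mult_append[OF assms(5,6) v]
    by (rule refl)
qed

text \<open>Bracketed to the right, as iterated appending of rows produces it.\<close>

abbreviation filter_dim :: "nat \<Rightarrow> nat \<Rightarrow> nat \<Rightarrow> nat" where
  "filter_dim lp lm p \<equiv> p + (p + (lm * p + (p + (p + lp * p))))"

lemma zero_cols_mult_vec:
  assumes "v \<in> carrier_vec c" "w \<in> carrier_vec d"
  shows "(0\<^sub>m r c @\<^sub>c 0\<^sub>m r d) *\<^sub>v (v @\<^sub>v w) = (0\<^sub>v r :: real vec)"
  using assms by (subst append_cols_mult_vec[of _ r c _ d]) (auto simp: zero_mult_mat_vec)

lemma C_Delta_carrier: "C_Delta lp lm p \<in> carrier_mat (filter_dim lp lm p) (lm * p + lp * p)"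
  unfolding C_Delta_def by (intro six_block_rows(1) append_cols_carrier) simp_all

lemma C_Delta_mult_vec:
  assumes a: "a \<in> carrier_vec (lm * p)" and b: "b \<in> carrier_vec (lp * p)"
  shows "C_Delta lp lm p *\<^sub>v (a @\<^sub>v b) =
    0\<^sub>v p @\<^sub>v 0\<^sub>v p @\<^sub>v a @\<^sub>v 0\<^sub>v p @\<^sub>v 0\<^sub>v p @\<^sub>v ((J_mat lp \<otimes>\<^sub>m 1\<^sub>m p) *\<^sub>v b)"
proof -
  let ?Z = "0\<^sub>m p (lm * p) @\<^sub>c 0\<^sub>m p (lp * p) :: real mat"
  let ?M3 = "1\<^sub>m (lm * p) @\<^sub>c 0\<^sub>m (lm * p) (lp * p) :: real mat"
  let ?M6 = "0\<^sub>m (lp * p) (lm * p) @\<^sub>c (J_mat lp \<otimes>\<^sub>m 1\<^sub>m p)"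
  have Z: "?Z \<in> carrier_mat p (lm * p + lp * p)" by (intro append_cols_carrier) simp_all
  have M3: "?M3 \<in> carrier_mat (lm * p) (lm * p + lp * p)" by (intro append_cols_carrier) simp_all
  have M6: "?M6 \<in> carrier_mat (lp * p) (lm * p + lp * p)" by (intro append_cols_carrier) simp_all
  have m3: "?M3 *\<^sub>v (a @\<^sub>v b) = a"
    using a b by (subst append_cols_mult_vec[of _ "lm * p" "lm * p" _ "lp * p"]) (simp_all add: zero_mult_mat_vec)
  have m6: "?M6 *\<^sub>v (a @\<^sub>v b) = (J_mat lp \<otimes>\<^sub>m 1\<^sub>m p) *\<^sub>v b"
    using a b mult_mat_vec_carrier[OF shift_carriers(3) b]
    by (subst append_cols_mult_vec[of _ "lp * p" "lm * p" _ "lp * p"]) (simp_all add: zero_mult_mat_vec)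
  have v: "a @\<^sub>v b \<in> carrier_vec (lm * p + lp * p)" using a b by simp
  show ?thesis
    unfolding C_Delta_def six_block_rows(2)[OF Z Z M3 Z Z M6 v] m3 m6 zero_cols_mult_vec[OF a b] by (rule refl)
qed

lemma D_Delta_carrier: "D_Delta lp lm p m L \<in> carrier_mat (filter_dim lp lm p) (p + p)"
  unfolding D_Delta_def
  by (intro mult_carrier_mat[OF _ W_hat_carrier] six_block_rows(1) append_cols_carrier) simp_all

lemma D_Delta_mult_vec:
  fixes m L :: real
  assumes y: "y \<in> carrier_vec p" and u: "u \<in> carrier_vec p"
  defines "g \<equiv> out_filter m L y u"
  shows "D_Delta lp lm p m L *\<^sub>v (y @\<^sub>v u) =
    g @\<^sub>v u @\<^sub>v 0\<^sub>v (lm * p) @\<^sub>v u @\<^sub>v g @\<^sub>v 0\<^sub>v (lp * p)"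
proof -
  let ?E = "1\<^sub>m p @\<^sub>c 0\<^sub>m p p :: real mat" and ?G = "0\<^sub>m p p @\<^sub>c 1\<^sub>m p :: real mat"
  let ?Z = "\<lambda>r. 0\<^sub>m r p @\<^sub>c 0\<^sub>m r p :: real mat"
  have g: "g \<in> carrier_vec p" using u by (simp add: g_def)
  have E: "?E \<in> carrier_mat p (p + p)" by (intro append_cols_carrier) simp_all
  have G: "?G \<in> carrier_mat p (p + p)" by (intro append_cols_carrier) simp_all
  have Z: "?Z r \<in> carrier_mat r (p + p)" for r by (intro append_cols_carrier) simp_all
  have e: "?E *\<^sub>v (g @\<^sub>v u) = g"
    using g u by (subst append_cols_mult_vec[of _ p p _ p]) (simp_all add: zero_mult_mat_vec)
  have h: "?G *\<^sub>v (g @\<^sub>v u) = u"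
    using g u by (subst append_cols_mult_vec[of _ p p _ p]) (simp_all add: zero_mult_mat_vec)
  have v: "y @\<^sub>v u \<in> carrier_vec (p + p)" "g @\<^sub>v u \<in> carrier_vec (p + p)" using y g u by simp_all
  show ?thesis
    unfolding D_Delta_def
      assoc_mult_mat_vec[OF six_block_rows(1)[OF E G Z[of "lm * p"] G E Z[of "lp * p"]] W_hat_carrier v(1)]
      W_hat_mult_vec[OF y u] g_def[symmetric]
      six_block_rows(2)[OF E G Z G E Z v(2)] e h zero_cols_mult_vec[OF g u]
    by (rule refl)
qed

text \<open>The extended plant feeds the filter through two separate columns, one driven by the
  plant state and one by the input. Their sum is T applied to the stacked scaled output and
  input.\<close>

lemma scaled_input_split:
  fixes T :: "real mat"
  assumes T: "T \<in> carrier_mat r (p + p)" and C: "C \<in> carrier_mat p c"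
    and x: "x \<in> carrier_vec c" and u: "u \<in> carrier_vec p"
  shows "(k \<cdot>\<^sub>m (T * (C @\<^sub>r 0\<^sub>m p c))) *\<^sub>v x + (T * (0\<^sub>m p p @\<^sub>r 1\<^sub>m p)) *\<^sub>v u =
    T *\<^sub>v ((k \<cdot>\<^sub>v (C *\<^sub>v x)) @\<^sub>v u)"
proof -
  have C0: "C @\<^sub>r 0\<^sub>m p c \<in> carrier_mat (p + p) c" using C by simp
  have I0: "(0\<^sub>m p p @\<^sub>r 1\<^sub>m p :: real mat) \<in> carrier_mat (p + p) p" by (intro carrier_append_rows) simp_all
  have Cx: "C *\<^sub>v x \<in> carrier_vec p" using C x by simp
  have 1: "(C @\<^sub>r 0\<^sub>m p c) *\<^sub>v x = (C *\<^sub>v x) @\<^sub>v 0\<^sub>v p"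
    using mat_mult_append[OF C _ x, of "0\<^sub>m p c" p] x by (simp add: zero_mult_mat_vec)
  have 2: "(0\<^sub>m p p @\<^sub>r 1\<^sub>m p) *\<^sub>v u = 0\<^sub>v p @\<^sub>v u"
    using mat_mult_append[of "0\<^sub>m p p" p p "1\<^sub>m p" p u] u by (simp add: zero_mult_mat_vec)
  have "(k \<cdot>\<^sub>m (T * (C @\<^sub>r 0\<^sub>m p c))) *\<^sub>v x = k \<cdot>\<^sub>v (T *\<^sub>v ((C *\<^sub>v x) @\<^sub>v 0\<^sub>v p))"
    using smult_mat_mult_vec[OF mult_carrier_mat[OF T C0] x, of k] assoc_mult_mat_vec[OF T C0 x] 1 by simp
  also have "\<dots> = T *\<^sub>v ((k \<cdot>\<^sub>v (C *\<^sub>v x)) @\<^sub>v 0\<^sub>v p)"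
  proof -
    have "(k \<cdot>\<^sub>v (C *\<^sub>v x)) @\<^sub>v 0\<^sub>v p = k \<cdot>\<^sub>v ((C *\<^sub>v x) @\<^sub>v 0\<^sub>v p)"
      unfolding smult_append_vec by (intro arg_cong2[of _ _ _ _ append_vec] eq_vecI) auto
    then show ?thesis using mult_mat_vec[OF T, of "(C *\<^sub>v x) @\<^sub>v 0\<^sub>v p" k] Cx by simp
  qed
  finally have first: "(k \<cdot>\<^sub>m (T * (C @\<^sub>r 0\<^sub>m p c))) *\<^sub>v x = T *\<^sub>v ((k \<cdot>\<^sub>v (C *\<^sub>v x)) @\<^sub>v 0\<^sub>v p)" .
  have second: "(T * (0\<^sub>m p p @\<^sub>r 1\<^sub>m p)) *\<^sub>v u = T *\<^sub>v (0\<^sub>v p @\<^sub>v u)"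
    using assoc_mult_mat_vec[OF T I0 u] 2 by simp
  have "T *\<^sub>v ((k \<cdot>\<^sub>v (C *\<^sub>v x)) @\<^sub>v 0\<^sub>v p) + T *\<^sub>v (0\<^sub>v p @\<^sub>v u) =
      T *\<^sub>v (((k \<cdot>\<^sub>v (C *\<^sub>v x)) @\<^sub>v 0\<^sub>v p) + (0\<^sub>v p @\<^sub>v u))"
    using Cx u by (intro mult_add_distrib_mat_vec[symmetric, OF T]) auto
  also have "((k \<cdot>\<^sub>v (C *\<^sub>v x)) @\<^sub>v 0\<^sub>v p) + (0\<^sub>v p @\<^sub>v u) = (k \<cdot>\<^sub>v (C *\<^sub>v x)) @\<^sub>v u"
    using Cx u by (subst append_vec_add[of _ p _ _ p]) simp_all
  finally show ?thesis unfolding first second .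
qed

context
  fixes n p lp lm :: nat and m L \<rho> :: real and A B C :: "real mat"
  assumes A: "A \<in> carrier_mat (n * p) (n * p)" and B: "B \<in> carrier_mat (n * p) p"
    and C: "C \<in> carrier_mat p (n * p)"
begin

lemma F_carrier: "A + m \<cdot>\<^sub>m (B * C) \<in> carrier_mat (n * p) (n * p)"
  using A mult_carrier_mat[OF B C] by simp

lemma filter_input_carriers:
  "k \<cdot>\<^sub>m (B_Delta lp lm p m L * (C @\<^sub>r 0\<^sub>m p (n * p))) \<in> carrier_mat (lm * p + lp * p) (n * p)"
  "k \<cdot>\<^sub>m (D_Delta lp lm p m L * (C @\<^sub>r 0\<^sub>m p (n * p))) \<in> carrier_mat (filter_dim lp lm p) (n * p)"
  "B_Delta lp lm p m L * (0\<^sub>m p p @\<^sub>r 1\<^sub>m p) \<in> carrier_mat (lm * p + lp * p) p"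
  "D_Delta lp lm p m L * (0\<^sub>m p p @\<^sub>r 1\<^sub>m p) \<in> carrier_mat (filter_dim lp lm p) p"
proof -
  have C0: "C @\<^sub>r 0\<^sub>m p (n * p) \<in> carrier_mat (p + p) (n * p)"
    by (rule carrier_append_rows[OF C]) simp
  have I0: "(0\<^sub>m p p @\<^sub>r 1\<^sub>m p :: real mat) \<in> carrier_mat (p + p) p"
    by (rule carrier_append_rows) simp_all
  show "k \<cdot>\<^sub>m (B_Delta lp lm p m L * (C @\<^sub>r 0\<^sub>m p (n * p))) \<in> carrier_mat (lm * p + lp * p) (n * p)"
    "k \<cdot>\<^sub>m (D_Delta lp lm p m L * (C @\<^sub>r 0\<^sub>m p (n * p))) \<in> carrier_mat (filter_dim lp lm p) (n * p)"
    "B_Delta lp lm p m L * (0\<^sub>m p p @\<^sub>r 1\<^sub>m p) \<in> carrier_mat (lm * p + lp * p) p"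
    "D_Delta lp lm p m L * (0\<^sub>m p p @\<^sub>r 1\<^sub>m p) \<in> carrier_mat (filter_dim lp lm p) p"
    using mult_carrier_mat[OF B_Delta_carrier C0] mult_carrier_mat[OF D_Delta_carrier C0]
      mult_carrier_mat[OF B_Delta_carrier I0] mult_carrier_mat[OF D_Delta_carrier I0]
    by (simp_all only: smult_carrier_mat)
qed

lemma A_c_carrier: "A_c lp lm n p m L A B C \<rho> \<in> carrier_mat (lm * p + lp * p + n * p) (lm * p + lp * p + n * p)"
  unfolding A_c_def
  by (rule four_block_carrier_mat[OF A_Delta_carrier]) (rule smult_carrier_mat[OF F_carrier])

lemma B_c_carrier: "B_c lp lm p m L B \<in> carrier_mat (lm * p + lp * p + n * p) p"
  unfolding B_c_def by (rule carrier_append_rows[OF filter_input_carriers(3) B])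

lemma C_c_carrier: "C_c lp lm n p m L C \<rho> \<in> carrier_mat (filter_dim lp lm p) (lm * p + lp * p + n * p)"
  unfolding C_c_def by (rule append_cols_carrier[OF C_Delta_carrier filter_input_carriers(2)])

lemma D_c_carrier: "D_c lp lm p m L \<in> carrier_mat (filter_dim lp lm p) p"
  unfolding D_c_def by (rule filter_input_carriers(4))

lemma outer_factor_carrier:
  "outer_factor (lm * p + lp * p + n * p) (A_c lp lm n p m L A B C \<rho>) (B_c lp lm p m L B)
    (C_c lp lm n p m L C \<rho>) (D_c lp lm p m L) \<in>
   carrier_mat ((lm * p + lp * p + n * p) + ((lm * p + lp * p + n * p) + filter_dim lp lm p)) (lm * p + lp * p + n * p + p)"
  unfolding outer_factor_def carrier_matD(2)[OF B_c_carrier]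
  by (intro carrier_append_rows append_cols_carrier A_c_carrier B_c_carrier C_c_carrier D_c_carrier) simp_all

text \<open>One multiplication turns the outer factor into a description of a single time step:
  successor state, present state and filter output, in the order of the diagonal blocks P, - P and
  \<open>M_Delta\<close>. The filter output comes in the pairs (g, u), (a, u) and (g, reversed b),
  one for each block of \<open>M_Delta\<close>.\<close>

lemma outer_factor_mult_vec:
  assumes a: "a \<in> carrier_vec (lm * p)" and b: "b \<in> carrier_vec (lp * p)"
    and x: "x \<in> carrier_vec (n * p)" and u: "u \<in> carrier_vec p"
  defines "g \<equiv> out_filter m L (inverse \<rho> \<cdot>\<^sub>v (C *\<^sub>v x)) u"
  shows "outer_factor (lm * p + lp * p + n * p) (A_c lp lm n p m L A B C \<rho>) (B_c lp lm p m L B)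
      (C_c lp lm n p m L C \<rho>) (D_c lp lm p m L) *\<^sub>v (((a @\<^sub>v b) @\<^sub>v x) @\<^sub>v u) =
    (((((S_mat lm \<otimes>\<^sub>m 1\<^sub>m p) *\<^sub>v a + (e_mat lm \<otimes>\<^sub>m 1\<^sub>m p) *\<^sub>v g)
       @\<^sub>v ((S_mat lp \<otimes>\<^sub>m 1\<^sub>m p) *\<^sub>v b + (e_mat lp \<otimes>\<^sub>m 1\<^sub>m p) *\<^sub>v u))
      @\<^sub>v (inverse \<rho> \<cdot>\<^sub>v ((A + m \<cdot>\<^sub>m (B * C)) *\<^sub>v x) + B *\<^sub>v u))
     @\<^sub>v ((a @\<^sub>v b) @\<^sub>v x))
    @\<^sub>v (g @\<^sub>v u @\<^sub>v a @\<^sub>v u @\<^sub>v g @\<^sub>v ((J_mat lp \<otimes>\<^sub>m 1\<^sub>m p) *\<^sub>v b))"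
proof -
  let ?N = "lm * p + lp * p + n * p"
  let ?y = "inverse \<rho> \<cdot>\<^sub>v (C *\<^sub>v x)"
  let ?X = "(a @\<^sub>v b) @\<^sub>v x"
  let ?BC = "inverse \<rho> \<cdot>\<^sub>m (B_Delta lp lm p m L * (C @\<^sub>r 0\<^sub>m p (n * p)))"
  let ?DC = "inverse \<rho> \<cdot>\<^sub>m (D_Delta lp lm p m L * (C @\<^sub>r 0\<^sub>m p (n * p)))"
  let ?BI = "B_Delta lp lm p m L * (0\<^sub>m p p @\<^sub>r 1\<^sub>m p)"
  let ?DI = "D_Delta lp lm p m L * (0\<^sub>m p p @\<^sub>r 1\<^sub>m p)"
  let ?F = "A + m \<cdot>\<^sub>m (B * C)"
  let ?eg = "(e_mat lm \<otimes>\<^sub>m 1\<^sub>m p) *\<^sub>v g" and ?eu = "(e_mat lp \<otimes>\<^sub>m 1\<^sub>m p) *\<^sub>v u"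
  let ?Sa = "(S_mat lm \<otimes>\<^sub>m 1\<^sub>m p) *\<^sub>v a" and ?Sb = "(S_mat lp \<otimes>\<^sub>m 1\<^sub>m p) *\<^sub>v b"
  let ?Jb = "(J_mat lp \<otimes>\<^sub>m 1\<^sub>m p) *\<^sub>v b"
  have y: "?y \<in> carrier_vec p" using C x by simp
  have g: "g \<in> carrier_vec p" using u by (simp add: g_def)
  have ab: "a @\<^sub>v b \<in> carrier_vec (lm * p + lp * p)" using a b by simp
  have X: "?X \<in> carrier_vec ?N" using ab x by simp
  have Xu: "?X @\<^sub>v u \<in> carrier_vec (?N + p)" using X u by simp
  have S: "?Sa \<in> carrier_vec (lm * p)" "?Sb \<in> carrier_vec (lp * p)" "?Jb \<in> carrier_vec (lp * p)"
    "?eg \<in> carrier_vec (lm * p)" "?eu \<in> carrier_vec (lp * p)"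
    by (auto intro!: mult_mat_vec_carrier[OF shift_carriers(1) a] mult_mat_vec_carrier[OF shift_carriers(1) b]
      mult_mat_vec_carrier[OF shift_carriers(3) b] mult_mat_vec_carrier[OF shift_carriers(2) g]
      mult_mat_vec_carrier[OF shift_carriers(2) u] simp del: shift_carriers)
  have BC: "?BC *\<^sub>v x \<in> carrier_vec (lm * p + lp * p)" "?BI *\<^sub>v u \<in> carrier_vec (lm * p + lp * p)"
    "?DC *\<^sub>v x \<in> carrier_vec (filter_dim lp lm p)" "?DI *\<^sub>v u \<in> carrier_vec (filter_dim lp lm p)"
    by (rule mult_mat_vec_carrier[OF filter_input_carriers(1) x] mult_mat_vec_carrier[OF filter_input_carriers(3) u]
      mult_mat_vec_carrier[OF filter_input_carriers(2) x] mult_mat_vec_carrier[OF filter_input_carriers(4) u])+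
  have Aab: "A_Delta lp lm p *\<^sub>v (a @\<^sub>v b) \<in> carrier_vec (lm * p + lp * p)"
    by (rule mult_mat_vec_carrier[OF A_Delta_carrier ab])
  have Fx: "inverse \<rho> \<cdot>\<^sub>v (?F *\<^sub>v x) \<in> carrier_vec (n * p)"
    using mult_mat_vec_carrier[OF F_carrier x] by simp
  have Bu: "B *\<^sub>v u \<in> carrier_vec (n * p)" by (rule mult_mat_vec_carrier[OF B u])
  have top: "(A_c lp lm n p m L A B C \<rho> @\<^sub>c B_c lp lm p m L B) *\<^sub>v (?X @\<^sub>v u) =
      ((?Sa + ?eg) @\<^sub>v (?Sb + ?eu)) @\<^sub>v (inverse \<rho> \<cdot>\<^sub>v (?F *\<^sub>v x) + B *\<^sub>v u)"
  proof -
    have "A_c lp lm n p m L A B C \<rho> *\<^sub>v ?X =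
        (A_Delta lp lm p *\<^sub>v (a @\<^sub>v b) + ?BC *\<^sub>v x) @\<^sub>v (0\<^sub>m (n * p) ((lm + lp) * p) *\<^sub>v (a @\<^sub>v b) + (inverse \<rho> \<cdot>\<^sub>m ?F) *\<^sub>v x)"
      unfolding A_c_def distrib_right
      by (rule four_block_mat_mult_vec[OF A_Delta_carrier filter_input_carriers(1) zero_carrier_mat
        smult_carrier_mat[OF F_carrier] ab x])
    also have "0\<^sub>m (n * p) ((lm + lp) * p) *\<^sub>v (a @\<^sub>v b) + (inverse \<rho> \<cdot>\<^sub>m ?F) *\<^sub>v x = inverse \<rho> \<cdot>\<^sub>v (?F *\<^sub>v x)"
      using zero_mult_mat_vec[OF ab, of "n * p"] Fx smult_mat_mult_vec[OF F_carrier x, of "inverse \<rho>"]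
      by (simp only: distrib_right left_zero_vec)
    finally have Ac: "A_c lp lm n p m L A B C \<rho> *\<^sub>v ?X =
        (A_Delta lp lm p *\<^sub>v (a @\<^sub>v b) + ?BC *\<^sub>v x) @\<^sub>v (inverse \<rho> \<cdot>\<^sub>v (?F *\<^sub>v x))" .
    have Bc: "B_c lp lm p m L B *\<^sub>v u = (?BI *\<^sub>v u) @\<^sub>v (B *\<^sub>v u)"
      unfolding B_c_def by (rule mat_mult_append[OF filter_input_carriers(3) B u])
    have split: "?BC *\<^sub>v x + ?BI *\<^sub>v u = ?eg @\<^sub>v ?eu"
      unfolding g_def using scaled_input_split[OF B_Delta_carrier C x u] B_Delta_mult_vec[OF y u] by simp
    have "A_Delta lp lm p *\<^sub>v (a @\<^sub>v b) + ?BC *\<^sub>v x + ?BI *\<^sub>v u =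
        (?Sa @\<^sub>v ?Sb) + (?eg @\<^sub>v ?eu)"
      unfolding assoc_add_vec[OF Aab BC(1,2)] split by (simp only: A_Delta_mult_vec[OF a b])
    also have "\<dots> = (?Sa + ?eg) @\<^sub>v (?Sb + ?eu)"
      by (rule append_vec_add[OF S(1,4,2,5)])
    finally have upper: "A_Delta lp lm p *\<^sub>v (a @\<^sub>v b) + ?BC *\<^sub>v x + ?BI *\<^sub>v u = (?Sa + ?eg) @\<^sub>v (?Sb + ?eu)" .
    show ?thesis
      unfolding append_cols_mult_vec[OF A_c_carrier B_c_carrier X u] Ac Bc upper[symmetric]
      by (rule append_vec_add[OF add_carrier_vec[OF Aab BC(1)] BC(2) Fx Bu])
  qed
  have mid: "(1\<^sub>m ?N @\<^sub>c 0\<^sub>m ?N p) *\<^sub>v (?X @\<^sub>v u) = ?X"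
    using append_cols_mult_vec[OF one_carrier_mat zero_carrier_mat X u] X u
    by (simp only: zero_mult_mat_vec one_mult_mat_vec right_zero_vec)
  have bot: "(C_c lp lm n p m L C \<rho> @\<^sub>c D_c lp lm p m L) *\<^sub>v (?X @\<^sub>v u) =
      g @\<^sub>v u @\<^sub>v a @\<^sub>v u @\<^sub>v g @\<^sub>v ?Jb"
  proof -
    have Cc: "C_c lp lm n p m L C \<rho> *\<^sub>v ?X = C_Delta lp lm p *\<^sub>v (a @\<^sub>v b) + ?DC *\<^sub>v x"
      unfolding C_c_def by (rule append_cols_mult_vec[OF C_Delta_carrier filter_input_carriers(2) ab x])
    have Cab: "C_Delta lp lm p *\<^sub>v (a @\<^sub>v b) \<in> carrier_vec (filter_dim lp lm p)"
      by (rule mult_mat_vec_carrier[OF C_Delta_carrier ab])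
    have split: "?DC *\<^sub>v x + ?DI *\<^sub>v u = g @\<^sub>v u @\<^sub>v 0\<^sub>v (lm * p) @\<^sub>v u @\<^sub>v g @\<^sub>v 0\<^sub>v (lp * p)"
      unfolding g_def using scaled_input_split[OF D_Delta_carrier C x u] D_Delta_mult_vec[OF y u] by simp
    have "(C_c lp lm n p m L C \<rho> @\<^sub>c D_c lp lm p m L) *\<^sub>v (?X @\<^sub>v u) =
        C_Delta lp lm p *\<^sub>v (a @\<^sub>v b) + (?DC *\<^sub>v x + ?DI *\<^sub>v u)"
      unfolding append_cols_mult_vec[OF C_c_carrier D_c_carrier X u] Cc unfolding D_c_def
      by (rule assoc_add_vec[OF Cab BC(3,4)])
    also have "\<dots> = (0\<^sub>v p @\<^sub>v 0\<^sub>v p @\<^sub>v a @\<^sub>v 0\<^sub>v p @\<^sub>v 0\<^sub>v p @\<^sub>v ?Jb) +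
        (g @\<^sub>v u @\<^sub>v 0\<^sub>v (lm * p) @\<^sub>v u @\<^sub>v g @\<^sub>v 0\<^sub>v (lp * p))"
      unfolding split C_Delta_mult_vec[OF a b] ..
    also have "\<dots> = g @\<^sub>v u @\<^sub>v a @\<^sub>v u @\<^sub>v g @\<^sub>v ?Jb"
    proof -
      note z = zero_carrier_vec
      note c5 = append_carrier_vec[OF z[of p] S(3)] append_carrier_vec[OF g z[of "lp * p"]]
      note c4 = append_carrier_vec[OF z[of p] c5(1)] append_carrier_vec[OF u c5(2)]
      note c3 = append_carrier_vec[OF a c4(1)] append_carrier_vec[OF z[of "lm * p"] c4(2)]
      note c2 = append_carrier_vec[OF z[of p] c3(1)] append_carrier_vec[OF u c3(2)]
      show ?thesis
        unfolding append_vec_add[OF z g c2] append_vec_add[OF z u c3] append_vec_add[OF a z c4]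
          append_vec_add[OF z u c5] append_vec_add[OF z g S(3) z]
          left_zero_vec[OF g] left_zero_vec[OF u] right_zero_vec[OF a] right_zero_vec[OF S(3)] ..
    qed
    finally show ?thesis .
  qed
  show ?thesis
    unfolding outer_factor_def carrier_matD(2)[OF B_c_carrier] append_vec_assoc[of _ ?X]
      mat_mult_append[OF append_cols_carrier[OF A_c_carrier B_c_carrier]
        carrier_append_rows[OF append_cols_carrier[OF one_carrier_mat zero_carrier_mat]
          append_cols_carrier[OF C_c_carrier D_c_carrier]] Xu]
      mat_mult_append[OF append_cols_carrier[OF one_carrier_mat zero_carrier_mat]
          append_cols_carrier[OF C_c_carrier D_c_carrier] Xu] top mid bot ..
qed

end

subsection \<open>Dissipation\<close>

lemma M_Delta_blocks:
  fixes M0 Mm Mp :: "real mat"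
  assumes "M0 \<in> carrier_mat p p" "Mm \<in> carrier_mat p c" "Mp \<in> carrier_mat p d"
  defines "X1 \<equiv> four_block_mat (0\<^sub>m p p) (transpose_mat M0) M0 (0\<^sub>m p p)"
    and "X2 \<equiv> four_block_mat (0\<^sub>m c c) (transpose_mat Mm) Mm (0\<^sub>m p p)"
    and "X3 \<equiv> four_block_mat (0\<^sub>m p p) Mp (transpose_mat Mp) (0\<^sub>m d d)"
  shows "M_Delta M0 Mm Mp = diag_block_mat [X1, X2, X3]"
    and "X1 \<in> carrier_mat (p + p) (p + p)" "X2 \<in> carrier_mat (c + p) (c + p)" "X3 \<in> carrier_mat (p + d) (p + d)"
  using assms unfolding M_Delta_def by (auto simp del: diag_block_mat.simps)

lemma diag_block_carrier_Cons:
  fixes X :: "real mat"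
  assumes "X \<in> carrier_mat r r" "diag_block_mat Xs \<in> carrier_mat s s"
  shows "diag_block_mat (X # Xs) \<in> carrier_mat (r + s) (r + s)"
  using assms by (auto simp: Let_def)

lemma M_Delta_carrier:
  assumes "M0 \<in> carrier_mat p p" "Mm \<in> carrier_mat p c" "Mp \<in> carrier_mat p d"
  shows "M_Delta M0 Mm Mp \<in> carrier_mat ((p + p) + ((c + p) + (p + d))) ((p + p) + ((c + p) + (p + d)))"
proof -
  let ?X3 = "four_block_mat (0\<^sub>m p p) Mp (transpose_mat Mp) (0\<^sub>m d d)"
  have "diag_block_mat [?X3] \<in> carrier_mat (p + d) (p + d)"
    unfolding diag_block_mat_singleton by (rule M_Delta_blocks(4)[OF assms])
  then show ?thesis
    unfolding M_Delta_blocks(1)[OF assms]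
    by (intro diag_block_carrier_Cons[OF M_Delta_blocks(2)[OF assms]]
        diag_block_carrier_Cons[OF M_Delta_blocks(3)[OF assms]])
qed

text \<open>Each antidiagonal block counts its pairing twice. \<open>Mm\<close> pairs the present u
  with the past of g, and \<open>Mp\<close> pairs the present g with the past of u, as the two
  delayed sums of \<open>zf_term\<close> do.\<close>

lemma M_Delta_quadratic_form:
  assumes M: "M0 \<in> carrier_mat p p" "Mm \<in> carrier_mat p c" "Mp \<in> carrier_mat p d"
    and g: "g \<in> carrier_vec p" and u: "u \<in> carrier_vec p"
    and a: "a \<in> carrier_vec c" and b: "b \<in> carrier_vec d"
  shows "(g @\<^sub>v u @\<^sub>v a @\<^sub>v u @\<^sub>v g @\<^sub>v b) \<bullet> (M_Delta M0 Mm Mp *\<^sub>v (g @\<^sub>v u @\<^sub>v a @\<^sub>v u @\<^sub>v g @\<^sub>v b)) =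
    2 * (u \<bullet> (M0 *\<^sub>v g) + u \<bullet> (Mm *\<^sub>v a) + g \<bullet> (Mp *\<^sub>v b))"
proof -
  let ?X1 = "four_block_mat (0\<^sub>m p p) (transpose_mat M0) M0 (0\<^sub>m p p)"
  let ?X2 = "four_block_mat (0\<^sub>m c c) (transpose_mat Mm) Mm (0\<^sub>m p p)"
  let ?X3 = "four_block_mat (0\<^sub>m p p) Mp (transpose_mat Mp) (0\<^sub>m d d)"
  note X = M_Delta_blocks(2-4)[OF M]
  have X3': "diag_block_mat [?X3] \<in> carrier_mat (p + d) (p + d)"
    unfolding diag_block_mat_singleton by (rule X(3))
  have gu: "g @\<^sub>v u \<in> carrier_vec (p + p)" "a @\<^sub>v u \<in> carrier_vec (c + p)" "g @\<^sub>v b \<in> carrier_vec (p + d)"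
    using g u a b by simp_all
  have q3: "(g @\<^sub>v b) \<bullet> (?X3 *\<^sub>v (g @\<^sub>v b)) = 2 * (g \<bullet> (Mp *\<^sub>v b))"
  proof -
    \<comment> \<open>The third block has \<open>Mp\<close> above the diagonal, so
      \<open>antidiag_quadratic_form\<close> is applied to its transpose.\<close>
    have Mpt: "transpose_mat Mp \<in> carrier_mat d p" using M(3) by simp
    have "b \<bullet> (transpose_mat Mp *\<^sub>v g) = g \<bullet> (Mp *\<^sub>v b)"
      using transpose_vec_mult_scalar[OF M(3) b g]
        comm_scalar_prod[OF b mult_mat_vec_carrier[OF Mpt g]] by simp
    then show ?thesis
      using antidiag_quadratic_form[OF Mpt g b] by simp
  qed
  show ?thesis
    unfolding append_vec_assoc[of g u, symmetric] append_vec_assoc[of a u, symmetric]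
      M_Delta_blocks(1)[OF M]
      diag_block_quadratic_form[OF X(1) diag_block_carrier_Cons[OF X(2) X3'] gu(1) append_carrier_vec[OF gu(2,3)]]
      diag_block_quadratic_form[OF X(2) X3' gu(2,3)] diag_block_mat_singleton
      antidiag_quadratic_form[OF M(1) g u] antidiag_quadratic_form[OF M(2) a u] q3
    by simp
qed

lemma uminus_quadratic_form:
  fixes P :: "real mat"
  assumes "P \<in> carrier_mat r r" "v \<in> carrier_vec r"
  shows "v \<bullet> ((- P) *\<^sub>v v) = - (v \<bullet> (P *\<^sub>v v))"
proof -
  have "(- P) *\<^sub>v v = (-1) \<cdot>\<^sub>v (P *\<^sub>v v)"
    using assms by (intro eq_vecI) auto
  then show ?thesis using assms by simp
qed

lemma quadratic_form_abs_le:
  fixes P :: "real mat"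
  assumes P: "P \<in> carrier_mat r r" and v: "v \<in> carrier_vec r"
    and \<kappa>: "(P *\<^sub>v v) \<bullet> (P *\<^sub>v v) \<le> \<kappa> * (v \<bullet> v)"
  shows "\<bar>v \<bullet> (P *\<^sub>v v)\<bar> \<le> (1 + \<kappa>) / 2 * (v \<bullet> v)"
proof -
  have Pv: "P *\<^sub>v v \<in> carrier_vec r" using P v by simp
  have "0 \<le> v \<bullet> v + 2 * (v \<bullet> (P *\<^sub>v v)) + (P *\<^sub>v v) \<bullet> (P *\<^sub>v v)"
    using scalar_prod_self_nonneg[of "v + P *\<^sub>v v"] scalar_prod_self_add[OF v Pv] by simp
  moreover have "2 * (v \<bullet> (P *\<^sub>v v)) \<le> v \<bullet> v + (P *\<^sub>v v) \<bullet> (P *\<^sub>v v)"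
    using scalar_prod_young[OF v Pv, of 1] by simp
  ultimately have "2 * \<bar>v \<bullet> (P *\<^sub>v v)\<bar> \<le> v \<bullet> v + (P *\<^sub>v v) \<bullet> (P *\<^sub>v v)" by linarith
  also have "\<dots> \<le> (1 + \<kappa>) * (v \<bullet> v)" using \<kappa> by (simp add: distrib_right)
  finally show ?thesis by simp
qed

text \<open>Young's inequality on both cross terms leaves s with a factor proportional to \<delta>,
  small enough to be paid from the LMI margin, while all the rest is charged to the disturbance
  e.\<close>

lemma quadratic_form_perturbed:
  fixes P :: "real mat"
  assumes P: "P \<in> carrier_mat r r" and \<kappa>: "0 < \<kappa>" "\<And>v. v \<in> carrier_vec r \<Longrightarrow> (P *\<^sub>v v) \<bullet> (P *\<^sub>v v) \<le> \<kappa> * (v \<bullet> v)"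
    and s: "s \<in> carrier_vec r" and e: "e \<in> carrier_vec r" and \<delta>: "0 < \<delta>"
  shows "(s + e) \<bullet> (P *\<^sub>v (s + e)) \<le> s \<bullet> (P *\<^sub>v s) + \<delta> * (1 + \<kappa>) / 2 * (s \<bullet> s) + (1 + \<kappa>) / 2 * (1 + 1 / \<delta>) * (e \<bullet> e)"
proof -
  have Ps: "P *\<^sub>v s \<in> carrier_vec r" and Pe: "P *\<^sub>v e \<in> carrier_vec r" using P s e by simp_all
  have "(s + e) \<bullet> (P *\<^sub>v (s + e)) = s \<bullet> (P *\<^sub>v s) + s \<bullet> (P *\<^sub>v e) + e \<bullet> (P *\<^sub>v s) + e \<bullet> (P *\<^sub>v e)"
    unfolding mult_add_distrib_mat_vec[OF P s e] add_scalar_prod_distrib[OF s e add_carrier_vec[OF Ps Pe]]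
      scalar_prod_add_distrib[OF s Ps Pe] scalar_prod_add_distrib[OF e Ps Pe] by simp
  moreover have "s \<bullet> (P *\<^sub>v e) \<le> (\<delta> * (s \<bullet> s) + \<kappa> / \<delta> * (e \<bullet> e)) / 2"
  proof -
    have "(P *\<^sub>v e) \<bullet> (P *\<^sub>v e) / \<delta> \<le> \<kappa> * (e \<bullet> e) / \<delta>"
      using \<kappa>(2)[OF e] \<delta> by (intro divide_right_mono) auto
    then show ?thesis using scalar_prod_young[OF s Pe \<delta>] by simp
  qed
  moreover have "e \<bullet> (P *\<^sub>v s) \<le> (\<delta> * \<kappa> * (s \<bullet> s) + (e \<bullet> e) / \<delta>) / 2"
  proof -
    have "\<delta> * ((P *\<^sub>v s) \<bullet> (P *\<^sub>v s)) \<le> \<delta> * (\<kappa> * (s \<bullet> s))"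
      using \<kappa>(2)[OF s] \<delta> by (intro mult_left_mono) auto
    then show ?thesis using scalar_prod_young[OF Ps e \<delta>] comm_scalar_prod[OF e Ps] by simp
  qed
  moreover have "e \<bullet> (P *\<^sub>v e) \<le> (1 + \<kappa>) / 2 * (e \<bullet> e)"
    using quadratic_form_abs_le[OF P e \<kappa>(2)[OF e]] by linarith
  moreover have eq: "\<delta> * (1 + \<kappa>) / 2 * S + (1 + \<kappa>) / 2 * (1 + 1 / \<delta>) * E =
      (\<delta> * S + \<kappa> / \<delta> * E) / 2 + (\<delta> * \<kappa> * S + E / \<delta>) / 2 + (1 + \<kappa>) / 2 * E" for S E
    using \<delta> by (simp add: field_simps)
  ultimately show ?thesis unfolding add.assoc eq by linarith
qed

lemma hist_self:
  assumes s: "\<And>j. s j \<in> carrier_vec p"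
  shows "hist p l s k \<bullet> hist p l s k = (\<Sum>a<l. if l \<le> k + a then s (k + a - l) \<bullet> s (k + a - l) else 0)"
proof (cases "p = 0")
  case True
  then have "s j \<bullet> s j = 0" for j using s[of j] by (simp add: scalar_prod_self carrier_vecD)
  moreover have "hist p l s k \<bullet> hist p l s k = 0" using True by (simp add: scalar_prod_self hist_def)
  ultimately show ?thesis by (simp only: if_cancel sum.neutral_const)
next
  case False
  have "hist p l s k \<bullet> hist p l s k = (\<Sum>a<l. \<Sum>b<p. (hist p l s k $ (a * p + b))\<^sup>2)"
    unfolding scalar_prod_self carrier_vecD[OF hist_carrier] sum_mult_product by (simp add: add.commute)
  also have "\<dots> = (\<Sum>a<l. if l \<le> k + a then s (k + a - l) \<bullet> s (k + a - l) else 0)"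
  proof (rule sum.cong)
    fix a assume "a \<in> {..<l}"
    then have "(\<Sum>b<p. (hist p l s k $ (a * p + b))\<^sup>2) = (\<Sum>b<p. if l \<le> k + a then (s (k + a - l) $ b)\<^sup>2 else 0)"
      by (intro sum.cong) (auto simp: hist_index)
    then show "(\<Sum>b<p. (hist p l s k $ (a * p + b))\<^sup>2) = (if l \<le> k + a then s (k + a - l) \<bullet> s (k + a - l) else 0)"
      unfolding scalar_prod_self carrier_vecD[OF s] by simp
  qed (rule refl)
  finally show ?thesis .
qed

lemma hist_self_tendsto_0:
  assumes s: "\<And>j. s j \<in> carrier_vec p" and lim: "(\<lambda>k. s k \<bullet> s k) \<longlonglongrightarrow> 0"
  shows "(\<lambda>k. hist p l s k \<bullet> hist p l s k) \<longlonglongrightarrow> 0"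
proof -
  have "(\<lambda>k. if l \<le> k + a then s (k + a - l) \<bullet> s (k + a - l) else 0) \<longlonglongrightarrow> 0" for a
  \<comment> \<open>After a shift by l the guard against negative times is always satisfied.\<close>
  proof (rule LIMSEQ_offset[of _ l])
    have "(\<lambda>k. s (k + a) \<bullet> s (k + a)) \<longlonglongrightarrow> 0" by (rule LIMSEQ_ignore_initial_segment[OF lim])
    moreover have "l \<le> k + l + a" "k + l + a - l = k + a" for k by auto
    ultimately show "(\<lambda>k. if l \<le> k + l + a then s (k + l + a - l) \<bullet> s (k + l + a - l) else 0) \<longlonglongrightarrow> 0"
      by simp
  qed
  then have "(\<lambda>k. \<Sum>a<l. if l \<le> k + a then s (k + a - l) \<bullet> s (k + a - l) else 0) \<longlonglongrightarrow> (\<Sum>a<l. 0)"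
    by (rule tendsto_sum)
  then show ?thesis unfolding hist_self[OF s] by simp
qed

text \<open>Compactness turns the strict LMI into a one-step dissipation inequality with margin
  \<epsilon>. The vector s is the successor state without disturbance; being part of the output of
  the outer factor, it is bounded by the present state and input. That bound is what allows a
  disturbance to be absorbed later.\<close>

lemma LMI_dissipation:
  fixes A B C P M0 Mm Mp :: "real mat" and m L \<rho> :: real
  assumes A: "A \<in> carrier_mat (n * p) (n * p)" and B: "B \<in> carrier_mat (n * p) p"
    and C: "C \<in> carrier_mat p (n * p)"
    and P: "P \<in> carrier_mat (lm * p + lp * p + n * p) (lm * p + lp * p + n * p)"
    and M: "M0 \<in> carrier_mat p p" "Mm \<in> carrier_mat p (lm * p)" "Mp \<in> carrier_mat p (lp * p)"
    and lmi: "LMI (lm * p + lp * p + n * p) (A_c lp lm n p m L A B C \<rho>) (B_c lp lm p m L B)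
       (C_c lp lm n p m L C \<rho>) (D_c lp lm p m L) P (M_Delta M0 Mm Mp)"
  obtains \<epsilon> \<kappa> where "0 < \<epsilon>" "0 < \<kappa>"
    "\<And>a b x u X s g.
       \<lbrakk>a \<in> carrier_vec (lm * p); b \<in> carrier_vec (lp * p); x \<in> carrier_vec (n * p); u \<in> carrier_vec p;
        X = (a @\<^sub>v b) @\<^sub>v x; g = out_filter m L (inverse \<rho> \<cdot>\<^sub>v (C *\<^sub>v x)) u;
        s = (((S_mat lm \<otimes>\<^sub>m 1\<^sub>m p) *\<^sub>v a + (e_mat lm \<otimes>\<^sub>m 1\<^sub>m p) *\<^sub>v g)
             @\<^sub>v ((S_mat lp \<otimes>\<^sub>m 1\<^sub>m p) *\<^sub>v b + (e_mat lp \<otimes>\<^sub>m 1\<^sub>m p) *\<^sub>v u))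
            @\<^sub>v (inverse \<rho> \<cdot>\<^sub>v ((A + m \<cdot>\<^sub>m (B * C)) *\<^sub>v x) + B *\<^sub>v u)\<rbrakk> \<Longrightarrow>
       s \<bullet> s \<le> \<kappa> * (X \<bullet> X + u \<bullet> u) \<and>
       s \<bullet> (P *\<^sub>v s) - X \<bullet> (P *\<^sub>v X)
         + 2 * (u \<bullet> (M0 *\<^sub>v g) + u \<bullet> (Mm *\<^sub>v a) + g \<bullet> (Mp *\<^sub>v ((J_mat lp \<otimes>\<^sub>m 1\<^sub>m p) *\<^sub>v b)))
       \<le> - \<epsilon> * (X \<bullet> X + u \<bullet> u)"
proof -
  let ?N = "lm * p + lp * p + n * p"
  let ?K = "(p + p) + ((lm * p + p) + (p + lp * p))"
  define T where "T = outer_factor ?N (A_c lp lm n p m L A B C \<rho>) (B_c lp lm p m L B)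
       (C_c lp lm n p m L C \<rho>) (D_c lp lm p m L)"
  let ?Q = "diag_block_mat [P, - P, M_Delta M0 Mm Mp]"
  have dim: "filter_dim lp lm p = ?K" by simp
  have T: "T \<in> carrier_mat (?N + (?N + ?K)) (?N + p)"
    unfolding T_def dim[symmetric] by (rule outer_factor_carrier[OF A B C])
  note MD = M_Delta_carrier[OF M]
  have uP: "- P \<in> carrier_mat ?N ?N" using P by simp
  have MD': "diag_block_mat [M_Delta M0 Mm Mp] \<in> carrier_mat ?K ?K"
    unfolding diag_block_mat_singleton by (rule MD)
  note Q2 = diag_block_carrier_Cons[OF uP MD']
  note Q = diag_block_carrier_Cons[OF P Q2]
  have "transpose_mat T * ?Q * T \<in> carrier_mat (?N + p) (?N + p)"
    using T Q by (intro mult_carrier_mat[of _ _ "?N + (?N + ?K)"]) simp_all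
  moreover have "neg_definite (transpose_mat T * ?Q * T)"
    using lmi unfolding LMI_def T_def .
  ultimately obtain \<epsilon> where \<epsilon>: "0 < \<epsilon>"
    "\<And>v. v \<in> carrier_vec (?N + p) \<Longrightarrow> v \<bullet> ((transpose_mat T * ?Q * T) *\<^sub>v v) \<le> - \<epsilon> * (v \<bullet> v)"
    using neg_definite_uniform by metis
  obtain \<kappa> where \<kappa>: "0 < \<kappa>" "\<And>v. v \<in> carrier_vec (?N + p) \<Longrightarrow> (T *\<^sub>v v) \<bullet> (T *\<^sub>v v) \<le> \<kappa> * (v \<bullet> v)"
    using mult_mat_vec_bounded[OF T] by metis
  show thesis
  proof (rule that[OF \<epsilon>(1) \<kappa>(1)])
    fix a b x u X s g :: "real vec"
    assume a: "a \<in> carrier_vec (lm * p)" and b: "b \<in> carrier_vec (lp * p)" and x: "x \<in> carrier_vec (n * p)"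
      and u: "u \<in> carrier_vec p" and X_def: "X = (a @\<^sub>v b) @\<^sub>v x"
      and g_def: "g = out_filter m L (inverse \<rho> \<cdot>\<^sub>v (C *\<^sub>v x)) u"
      and s_def: "s = (((S_mat lm \<otimes>\<^sub>m 1\<^sub>m p) *\<^sub>v a + (e_mat lm \<otimes>\<^sub>m 1\<^sub>m p) *\<^sub>v g)
             @\<^sub>v ((S_mat lp \<otimes>\<^sub>m 1\<^sub>m p) *\<^sub>v b + (e_mat lp \<otimes>\<^sub>m 1\<^sub>m p) *\<^sub>v u))
            @\<^sub>v (inverse \<rho> \<cdot>\<^sub>v ((A + m \<cdot>\<^sub>m (B * C)) *\<^sub>v x) + B *\<^sub>v u)"
    let ?c = "(J_mat lp \<otimes>\<^sub>m 1\<^sub>m p) *\<^sub>v b"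
    let ?z = "g @\<^sub>v u @\<^sub>v a @\<^sub>v u @\<^sub>v g @\<^sub>v ?c"
    have g: "g \<in> carrier_vec p" using u by (simp add: g_def)
    have c: "?c \<in> carrier_vec (lp * p)" by (rule mult_mat_vec_carrier[OF shift_carriers(3) b])
    have X: "X \<in> carrier_vec ?N" unfolding X_def using a b x by simp
    have s: "s \<in> carrier_vec ?N"
      unfolding s_def
      by (intro append_carrier_vec add_carrier_vec mult_mat_vec_carrier[OF shift_carriers(1) a]
        mult_mat_vec_carrier[OF shift_carriers(1) b] mult_mat_vec_carrier[OF shift_carriers(2) g]
        mult_mat_vec_carrier[OF shift_carriers(2) u] mult_mat_vec_carrier[OF B u]
        smult_carrier_vec[THEN iffD2] mult_mat_vec_carrier[OF F_carrier[OF A B C] x])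
    have z: "?z \<in> carrier_vec ?K"
      unfolding append_vec_assoc[of g u, symmetric] append_vec_assoc[of a u, symmetric]
      by (intro append_carrier_vec g u a c)
    have Xu: "X @\<^sub>v u \<in> carrier_vec (?N + p)" using X u by simp
    have Xz: "X @\<^sub>v ?z \<in> carrier_vec (?N + ?K)" by (rule append_carrier_vec[OF X z])
    have TX: "T *\<^sub>v (X @\<^sub>v u) = s @\<^sub>v (X @\<^sub>v ?z)"
      unfolding T_def X_def s_def g_def outer_factor_mult_vec[OF A B C a b x u]
      by (rule append_vec_assoc)
    have XX: "(X @\<^sub>v u) \<bullet> (X @\<^sub>v u) = X \<bullet> X + u \<bullet> u"
      by (rule scalar_prod_append[OF X u X u])
    have "s \<bullet> s \<le> s \<bullet> s + (X @\<^sub>v ?z) \<bullet> (X @\<^sub>v ?z)"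
      using scalar_prod_self_nonneg[of "X @\<^sub>v ?z"] by simp
    also have "\<dots> = (T *\<^sub>v (X @\<^sub>v u)) \<bullet> (T *\<^sub>v (X @\<^sub>v u))"
      unfolding TX by (rule scalar_prod_append[OF s Xz s Xz, symmetric])
    also have "\<dots> \<le> \<kappa> * (X \<bullet> X + u \<bullet> u)" using \<kappa>(2)[OF Xu] unfolding XX .
    finally have 1: "s \<bullet> s \<le> \<kappa> * (X \<bullet> X + u \<bullet> u)" .
    have "(X @\<^sub>v u) \<bullet> ((transpose_mat T * ?Q * T) *\<^sub>v (X @\<^sub>v u)) =
        s \<bullet> (P *\<^sub>v s) + (- (X \<bullet> (P *\<^sub>v X)) + 2 * (u \<bullet> (M0 *\<^sub>v g) + u \<bullet> (Mm *\<^sub>v a) + g \<bullet> (Mp *\<^sub>v ?c)))"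
      unfolding congruence_quadratic_form[OF T Q Xu] TX diag_block_quadratic_form[OF P Q2 s Xz]
        diag_block_quadratic_form[OF uP MD' X z] diag_block_mat_singleton
        M_Delta_quadratic_form[OF M g u a c] uminus_quadratic_form[OF P X] ..
    then have "s \<bullet> (P *\<^sub>v s) - X \<bullet> (P *\<^sub>v X)
         + 2 * (u \<bullet> (M0 *\<^sub>v g) + u \<bullet> (Mm *\<^sub>v a) + g \<bullet> (Mp *\<^sub>v ?c)) \<le> - \<epsilon> * (X \<bullet> X + u \<bullet> u)"
      using \<epsilon>(2)[OF Xu] unfolding XX by linarith
    with 1 show "s \<bullet> s \<le> \<kappa> * (X \<bullet> X + u \<bullet> u) \<and>
       s \<bullet> (P *\<^sub>v s) - X \<bullet> (P *\<^sub>v X)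
         + 2 * (u \<bullet> (M0 *\<^sub>v g) + u \<bullet> (Mm *\<^sub>v a) + g \<bullet> (Mp *\<^sub>v ?c))
       \<le> - \<epsilon> * (X \<bullet> X + u \<bullet> u)" by blast
  qed
qed

text \<open>
  The limits are needed to discard the terminal storage, because \<open>P\<close> may be indefinite.
\<close>

lemma trajectory_bound:
  fixes A B C P M0 Mm Mp :: "real mat" and m L \<rho> :: real
  assumes A: "A \<in> carrier_mat (n * p) (n * p)" and B: "B \<in> carrier_mat (n * p) p"
    and C: "C \<in> carrier_mat p (n * p)"
    and P: "P \<in> carrier_mat (lm * p + lp * p + n * p) (lm * p + lp * p + n * p)"
    and M: "M0 \<in> carrier_mat p p" "Mm \<in> carrier_mat p (lm * p)" "Mp \<in> carrier_mat p (lp * p)"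
    and lmi: "LMI (lm * p + lp * p + n * p) (A_c lp lm n p m L A B C \<rho>) (B_c lp lm p m L B)
       (C_c lp lm n p m L C \<rho>) (D_c lp lm p m L) P (M_Delta M0 Mm Mp)"
    and \<mu>: "Mm = mat 1 lm (\<lambda>(_, a). \<mu> (int a - int lm)) \<otimes>\<^sub>m 1\<^sub>m p"
      "M0 = \<mu> 0 \<cdot>\<^sub>m 1\<^sub>m p"
      "Mp = mat 1 lp (\<lambda>(_, a). \<mu> (int a + 1)) \<otimes>\<^sub>m 1\<^sub>m p"
  shows "\<exists>K>0. \<forall>x q d D N.
       (\<forall>k. x k \<in> carrier_vec (n * p) \<and> q k \<in> carrier_vec p \<and> d k \<in> carrier_vec (n * p) \<and>
          x (Suc k) = (inverse \<rho> \<cdot>\<^sub>v ((A + m \<cdot>\<^sub>m (B * C)) *\<^sub>v x k) + B *\<^sub>v q k) + d k) \<longrightarrow>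
       (\<forall>M. 0 \<le> (\<Sum>k<M. zf_term (\<lambda>j k. q j \<bullet> out_filter m L (inverse \<rho> \<cdot>\<^sub>v (C *\<^sub>v x k)) (q k)) \<mu> lp lm k)) \<longrightarrow>
       (\<lambda>k. x k \<bullet> x k) \<longlonglongrightarrow> 0 \<longrightarrow> (\<lambda>k. q k \<bullet> q k) \<longlonglongrightarrow> 0 \<longrightarrow>
       (\<forall>M. (\<Sum>k<M. d k \<bullet> d k) \<le> D) \<longrightarrow>
       (\<Sum>k<N. x k \<bullet> x k) \<le> K * (x 0 \<bullet> x 0 + D)"
proof -
  let ?N = "lm * p + lp * p + n * p"
  let ?F = "A + m \<cdot>\<^sub>m (B * C)"
  obtain \<epsilon> \<kappa>T where \<epsilon>: "0 < \<epsilon>" and \<kappa>T: "0 < \<kappa>T" and diss: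
    "\<And>a b x u X s g.
       \<lbrakk>a \<in> carrier_vec (lm * p); b \<in> carrier_vec (lp * p); x \<in> carrier_vec (n * p); u \<in> carrier_vec p;
        X = (a @\<^sub>v b) @\<^sub>v x; g = out_filter m L (inverse \<rho> \<cdot>\<^sub>v (C *\<^sub>v x)) u;
        s = (((S_mat lm \<otimes>\<^sub>m 1\<^sub>m p) *\<^sub>v a + (e_mat lm \<otimes>\<^sub>m 1\<^sub>m p) *\<^sub>v g)
             @\<^sub>v ((S_mat lp \<otimes>\<^sub>m 1\<^sub>m p) *\<^sub>v b + (e_mat lp \<otimes>\<^sub>m 1\<^sub>m p) *\<^sub>v u))
            @\<^sub>v (inverse \<rho> \<cdot>\<^sub>v (?F *\<^sub>v x) + B *\<^sub>v u)\<rbrakk> \<Longrightarrow>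
       s \<bullet> s \<le> \<kappa>T * (X \<bullet> X + u \<bullet> u) \<and>
       s \<bullet> (P *\<^sub>v s) - X \<bullet> (P *\<^sub>v X)
         + 2 * (u \<bullet> (M0 *\<^sub>v g) + u \<bullet> (Mm *\<^sub>v a) + g \<bullet> (Mp *\<^sub>v ((J_mat lp \<otimes>\<^sub>m 1\<^sub>m p) *\<^sub>v b)))
       \<le> - \<epsilon> * (X \<bullet> X + u \<bullet> u)"
    by (rule LMI_dissipation[OF A B C P M lmi]) (rule that)
  obtain \<kappa> where \<kappa>: "0 < \<kappa>" "\<And>v. v \<in> carrier_vec ?N \<Longrightarrow> (P *\<^sub>v v) \<bullet> (P *\<^sub>v v) \<le> \<kappa> * (v \<bullet> v)"
    by (rule mult_mat_vec_bounded[OF P]) (rule that)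
  obtain \<kappa>C where \<kappa>C: "0 < \<kappa>C" "\<And>v. v \<in> carrier_vec (n * p) \<Longrightarrow> (C *\<^sub>v v) \<bullet> (C *\<^sub>v v) \<le> \<kappa>C * (v \<bullet> v)"
    by (rule mult_mat_vec_bounded[OF C]) (rule that)
  \<comment> \<open>With this choice the part of the perturbation falling on s costs exactly
    \<epsilon>/2, half of the dissipation margin.\<close>
  define \<delta> where "\<delta> = \<epsilon> / ((1 + \<kappa>) * \<kappa>T)"
  have \<delta>: "0 < \<delta>" using \<epsilon> \<kappa>T \<kappa>(1) by (simp add: \<delta>_def)
  define c where "c = (1 + \<kappa>) / 2 * (1 + 1 / \<delta>)"
  have c: "0 < c" using \<delta> \<kappa>(1) by (simp add: c_def add_pos_pos)
  let ?b = "(1 + \<kappa>) / 2"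
  \<comment> \<open>The factor 2/\<epsilon> inverts the remaining half of the margin;
    \<open>?b\<close> bounds the initial storage and c the cost of the disturbance.\<close>
  define K where "K = 2 / \<epsilon> * (?b + c)"
  have K: "0 < K" using \<epsilon> \<kappa>(1) c by (simp add: K_def add_pos_pos)
  show ?thesis
  proof (intro exI[of _ K] conjI K allI impI)
    fix x q d :: "nat \<Rightarrow> real vec" and D :: real and N :: nat
    assume sys: "\<forall>k. x k \<in> carrier_vec (n * p) \<and> q k \<in> carrier_vec p \<and> d k \<in> carrier_vec (n * p) \<and>
          x (Suc k) = (inverse \<rho> \<cdot>\<^sub>v (?F *\<^sub>v x k) + B *\<^sub>v q k) + d k"
      and iqc: "\<forall>M. 0 \<le> (\<Sum>k<M. zf_term (\<lambda>j k. q j \<bullet> out_filter m L (inverse \<rho> \<cdot>\<^sub>v (C *\<^sub>v x k)) (q k)) \<mu> lp lm k)"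
      and xlim: "(\<lambda>k. x k \<bullet> x k) \<longlonglongrightarrow> 0" and qlim: "(\<lambda>k. q k \<bullet> q k) \<longlonglongrightarrow> 0"
      and D: "\<forall>M. (\<Sum>k<M. d k \<bullet> d k) \<le> D"
    have x: "x k \<in> carrier_vec (n * p)" and q: "q k \<in> carrier_vec p" and d: "d k \<in> carrier_vec (n * p)"
      and step: "x (Suc k) = (inverse \<rho> \<cdot>\<^sub>v (?F *\<^sub>v x k) + B *\<^sub>v q k) + d k" for k
      using spec[OF sys, of k] by blast+
    define g where "g k = out_filter m L (inverse \<rho> \<cdot>\<^sub>v (C *\<^sub>v x k)) (q k)" for k
    define X where "X k = (hist p lm g k @\<^sub>v hist p lp q k) @\<^sub>v x k" for k
    define s where "s k = (hist p lm g (Suc k) @\<^sub>v hist p lp q (Suc k)) @\<^sub>v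
        (inverse \<rho> \<cdot>\<^sub>v (?F *\<^sub>v x k) + B *\<^sub>v q k)" for k
    \<comment> \<open>The disturbance enters the plant state only; the delay lines follow their
      recursion exactly.\<close>
    define e where "e k = 0\<^sub>v (lm * p + lp * p) @\<^sub>v d k" for k
    define zf where "zf k = zf_term (\<lambda>j k. q j \<bullet> g k) \<mu> lp lm k" for k
    define S where "S k = X k \<bullet> (P *\<^sub>v X k)" for k
    have g: "g k \<in> carrier_vec p" for k using q by (simp add: g_def)
    have Fx: "inverse \<rho> \<cdot>\<^sub>v (?F *\<^sub>v x k) + B *\<^sub>v q k \<in> carrier_vec (n * p)" for k
      by (intro add_carrier_vec smult_carrier_vec[THEN iffD2] mult_mat_vec_carrier[OF F_carrier[OF A B C] x]
        mult_mat_vec_carrier[OF B q])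
    have h: "hist p lm g k @\<^sub>v hist p lp q k \<in> carrier_vec (lm * p + lp * p)" for k
      by (intro append_carrier_vec hist_carrier)
    have X: "X k \<in> carrier_vec ?N" for k unfolding X_def by (rule append_carrier_vec[OF h x])
    have s: "s k \<in> carrier_vec ?N" for k unfolding s_def by (rule append_carrier_vec[OF h Fx])
    have e: "e k \<in> carrier_vec ?N" for k unfolding e_def by (rule append_carrier_vec[OF zero_carrier_vec d])
    have X_Suc: "X (Suc k) = s k + e k" for k
      unfolding X_def s_def e_def step append_vec_add[OF h zero_carrier_vec Fx d] right_zero_vec[OF h] ..
    have "0\<^sub>v r \<bullet> 0\<^sub>v r = (0 :: real)" for r by (simp add: scalar_prod_self)
    then have ee: "e k \<bullet> e k = d k \<bullet> d k" for k
      unfolding e_def scalar_prod_append[OF zero_carrier_vec d zero_carrier_vec d] by simp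
    have XX: "X k \<bullet> X k = hist p lm g k \<bullet> hist p lm g k + hist p lp q k \<bullet> hist p lp q k + x k \<bullet> x k" for k
      unfolding X_def scalar_prod_append[OF h x h x]
        scalar_prod_append[OF hist_carrier hist_carrier hist_carrier hist_carrier] ..
    have zf_eq: "q k \<bullet> (M0 *\<^sub>v g k) + q k \<bullet> (Mm *\<^sub>v hist p lm g k)
        + g k \<bullet> (Mp *\<^sub>v ((J_mat lp \<otimes>\<^sub>m 1\<^sub>m p) *\<^sub>v hist p lp q k)) = zf k" for k
    proof -
      have "M0 *\<^sub>v g k = \<mu> 0 \<cdot>\<^sub>v g k"
        unfolding \<mu>(2) using smult_mat_mult_vec[OF one_carrier_mat g] one_mult_mat_vec[OF g] by simp
      then have 0: "q k \<bullet> (M0 *\<^sub>v g k) = \<mu> 0 * (q k \<bullet> g k)"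
        using scalar_prod_smult_distrib[OF q g] by simp
      have comm: "g k \<bullet> q j = q j \<bullet> g k" for j by (rule comm_scalar_prod[OF g q])
      have 1: "q k \<bullet> (Mm *\<^sub>v hist p lm g k) =
          (\<Sum>i=1..lm. \<mu> (- int i) * (if i \<le> k then q k \<bullet> g (k - i) else 0))"
        unfolding \<mu>(1) by (rule weighted_hist_anticausal[OF g q])
      have 2: "g k \<bullet> (Mp *\<^sub>v ((J_mat lp \<otimes>\<^sub>m 1\<^sub>m p) *\<^sub>v hist p lp q k)) =
          (\<Sum>i=1..lp. \<mu> (int i) * (if i \<le> k then g k \<bullet> q (k - i) else 0))"
        unfolding \<mu>(3) hist_rev_def[symmetric] by (rule weighted_hist_causal[OF q g])
      show ?thesis
        unfolding 0 1 2 comm zf_def zf_term_def ..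
    qed
    have rec: "S (Suc k) - S k + 2 * zf k \<le> - (\<epsilon> / 2) * (x k \<bullet> x k) + c * (d k \<bullet> d k)" for k
    proof -
      have "s k = (((S_mat lm \<otimes>\<^sub>m 1\<^sub>m p) *\<^sub>v hist p lm g k + (e_mat lm \<otimes>\<^sub>m 1\<^sub>m p) *\<^sub>v g k)
             @\<^sub>v ((S_mat lp \<otimes>\<^sub>m 1\<^sub>m p) *\<^sub>v hist p lp q k + (e_mat lp \<otimes>\<^sub>m 1\<^sub>m p) *\<^sub>v q k))
            @\<^sub>v (inverse \<rho> \<cdot>\<^sub>v (?F *\<^sub>v x k) + B *\<^sub>v q k)"
        unfolding s_def hist_step[where s = g and k = k, OF g] hist_step[where s = q and k = k, OF q] ..
      note ds = diss[OF hist_carrier hist_carrier x q X_def g_def this]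
      have ss: "s k \<bullet> s k \<le> \<kappa>T * (X k \<bullet> X k + q k \<bullet> q k)" using ds by blast
      have sP: "s k \<bullet> (P *\<^sub>v s k) - S k + 2 * zf k \<le> - \<epsilon> * (X k \<bullet> X k + q k \<bullet> q k)"
        using ds unfolding zf_eq S_def by blast
      have "S (Suc k) \<le> s k \<bullet> (P *\<^sub>v s k) + \<delta> * (1 + \<kappa>) / 2 * (s k \<bullet> s k) + c * (d k \<bullet> d k)"
        unfolding S_def X_Suc c_def ee[symmetric]
        by (rule quadratic_form_perturbed[OF P \<kappa> s e \<delta>])
      moreover have "\<delta> * (1 + \<kappa>) / 2 * (s k \<bullet> s k) \<le> \<epsilon> / 2 * (X k \<bullet> X k + q k \<bullet> q k)"
      proof -
        have "\<delta> * (1 + \<kappa>) / 2 * (s k \<bullet> s k) \<le> \<delta> * (1 + \<kappa>) / 2 * (\<kappa>T * (X k \<bullet> X k + q k \<bullet> q k))"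
          using \<delta> \<kappa>(1) by (intro mult_left_mono ss) simp
        also have "\<dots> = \<epsilon> / 2 * (X k \<bullet> X k + q k \<bullet> q k)"
          using \<kappa>(1) \<kappa>T by (simp add: \<delta>_def)
        finally show ?thesis .
      qed
      moreover have "\<epsilon> / 2 * (x k \<bullet> x k) \<le> \<epsilon> / 2 * (X k \<bullet> X k + q k \<bullet> q k)"
        unfolding XX using \<epsilon> scalar_prod_self_nonneg[of "hist p lm g k"]
          scalar_prod_self_nonneg[of "hist p lp q k"] scalar_prod_self_nonneg[of "q k"]
        by (intro mult_left_mono) auto
      moreover have "- \<epsilon> * (X k \<bullet> X k + q k \<bullet> q k) = - (2 * (\<epsilon> / 2 * (X k \<bullet> X k + q k \<bullet> q k)))" by simp
      ultimately show ?thesis using sP by linarith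
    qed
    have summed: "S M - S 0 + 2 * (\<Sum>k<M. zf k) \<le> - (\<epsilon> / 2) * (\<Sum>k<M. x k \<bullet> x k) + c * (\<Sum>k<M. d k \<bullet> d k)" for M
    proof (induction M)
      case (Suc M)
      then show ?case using rec[of M] by (simp add: distrib_left)
    qed simp
    have S_abs: "\<bar>S k\<bar> \<le> ?b * (X k \<bullet> X k)" for k
      unfolding S_def by (rule quadratic_form_abs_le[OF P X \<kappa>(2)[OF X]])
    \<comment> \<open>The delay lines start at zero, so the initial storage is controlled by the
      plant state alone.\<close>
    have X0: "X 0 \<bullet> X 0 = x 0 \<bullet> x 0"
      unfolding XX by (simp add: scalar_prod_self)
    have glim: "(\<lambda>k. g k \<bullet> g k) \<longlonglongrightarrow> 0"
    proof (rule tendsto_sandwich[OF _ _ tendsto_const])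
      let ?r = "2 * ((L - m) * inverse \<rho>)\<^sup>2 * \<kappa>C"
      show "\<forall>\<^sub>F k in sequentially. 0 \<le> g k \<bullet> g k" by (simp add: scalar_prod_self_nonneg)
      have "g k \<bullet> g k \<le> ?r * (x k \<bullet> x k) + 2 * (q k \<bullet> q k)" for k
      proof -
        let ?y = "((L - m) * inverse \<rho>) \<cdot>\<^sub>v (C *\<^sub>v x k)"
        have Cx: "C *\<^sub>v x k \<in> carrier_vec p" by (rule mult_mat_vec_carrier[OF C x])
        have gk: "g k = ?y + (-1) \<cdot>\<^sub>v q k"
          unfolding g_def out_filter_def using q[of k] by (intro eq_vecI) (auto simp: carrier_matD[OF C])
        have "g k \<bullet> g k \<le> 2 * (?y \<bullet> ?y) + 2 * (((-1) \<cdot>\<^sub>v q k) \<bullet> ((-1) \<cdot>\<^sub>v q k))"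
          unfolding gk using scalar_prod_self_add_le[of ?y p "(-1) \<cdot>\<^sub>v q k" 1] Cx q[of k] by simp
        also have "\<dots> = 2 * (((L - m) * inverse \<rho>)\<^sup>2 * ((C *\<^sub>v x k) \<bullet> (C *\<^sub>v x k))) + 2 * (q k \<bullet> q k)"
          unfolding scalar_prod_self_smult by simp
        also have "\<dots> \<le> 2 * (((L - m) * inverse \<rho>)\<^sup>2 * (\<kappa>C * (x k \<bullet> x k))) + 2 * (q k \<bullet> q k)"
          using \<kappa>C(2)[OF x] by (intro add_right_mono mult_left_mono) auto
        finally show ?thesis by (simp add: mult.assoc)
      qed
      then show "\<forall>\<^sub>F k in sequentially. g k \<bullet> g k \<le> ?r * (x k \<bullet> x k) + 2 * (q k \<bullet> q k)" by simp
      show "(\<lambda>k. ?r * (x k \<bullet> x k) + 2 * (q k \<bullet> q k)) \<longlonglongrightarrow> 0"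
        using tendsto_add[OF tendsto_mult[OF tendsto_const[of ?r] xlim] tendsto_mult[OF tendsto_const[of 2] qlim]]
        by simp
    qed
    have Xlim: "(\<lambda>k. X k \<bullet> X k) \<longlonglongrightarrow> 0"
      unfolding XX
      using tendsto_add[OF tendsto_add[OF hist_self_tendsto_0[OF g glim, of lm] hist_self_tendsto_0[OF q qlim, of lp]] xlim]
      by simp
    \<comment> \<open>N stays fixed while the dissipation is summed up to a later M; letting M tend
      to infinity removes the terminal storage, whatever its sign.\<close>
    have "(\<Sum>k<N. x k \<bullet> x k) \<le> 2 / \<epsilon> * (?b * (x 0 \<bullet> x 0) + ?b * (X M \<bullet> X M) + c * D)" if "N \<le> M" for M
    proof -
      have "(\<Sum>k<N. x k \<bullet> x k) \<le> (\<Sum>k<M. x k \<bullet> x k)"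
        using that by (intro sum_mono2) (auto simp: scalar_prod_self_nonneg)
      moreover have "\<epsilon> / 2 * (\<Sum>k<M. x k \<bullet> x k) \<le> ?b * (x 0 \<bullet> x 0) + ?b * (X M \<bullet> X M) + c * D"
      proof -
        have "0 \<le> (\<Sum>k<M. zf k)" unfolding zf_def g_def by (rule spec[OF iqc])
        moreover have "c * (\<Sum>k<M. d k \<bullet> d k) \<le> c * D" using c D by simp
        ultimately show ?thesis
          using summed[of M] S_abs[of M] S_abs[of 0] X0 by simp
      qed
      ultimately have "\<epsilon> / 2 * (\<Sum>k<N. x k \<bullet> x k) \<le> ?b * (x 0 \<bullet> x 0) + ?b * (X M \<bullet> X M) + c * D"
        using \<epsilon> by (meson mult_left_mono half_gt_zero less_imp_le order_trans)
      then have "2 / \<epsilon> * (\<epsilon> / 2 * (\<Sum>k<N. x k \<bullet> x k)) \<le> 2 / \<epsilon> * (?b * (x 0 \<bullet> x 0) + ?b * (X M \<bullet> X M) + c * D)"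
        using \<epsilon> by (intro mult_left_mono) auto
      then show ?thesis using \<epsilon> by simp
    qed
    moreover have "(\<lambda>M. 2 / \<epsilon> * (?b * (x 0 \<bullet> x 0) + ?b * (X M \<bullet> X M) + c * D))
        \<longlonglongrightarrow> 2 / \<epsilon> * (?b * (x 0 \<bullet> x 0) + ?b * 0 + c * D)"
      by (intro tendsto_intros Xlim)
    ultimately have "(\<Sum>k<N. x k \<bullet> x k) \<le> 2 / \<epsilon> * (?b * (x 0 \<bullet> x 0) + ?b * 0 + c * D)"
      by (intro LIMSEQ_le_const) auto
    also have "\<dots> \<le> 2 / \<epsilon> * ((?b + c) * (x 0 \<bullet> x 0 + D))"
    proof -
      have "0 \<le> D" using spec[OF D, of 0] by simp
      then have "0 \<le> ?b * D" "0 \<le> c * (x 0 \<bullet> x 0)"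
        using \<kappa>(1) c by (auto simp: scalar_prod_self_nonneg)
      then have "?b * (x 0 \<bullet> x 0) + ?b * 0 + c * D \<le> (?b + c) * (x 0 \<bullet> x 0 + D)"
        unfolding distrib_left distrib_right by linarith
      then show ?thesis using \<epsilon> by (intro mult_left_mono) auto
    qed
    finally show "(\<Sum>k<N. x k \<bullet> x k) \<le> K * (x 0 \<bullet> x 0 + D)"
      unfolding K_def mult.assoc .
  qed
qed

subsection \<open>Homotopy\<close>

lemma smult_pow_mat:
  fixes M :: "'a::comm_ring_1 mat"
  assumes M: "M \<in> carrier_mat N N"
  shows "(a \<cdot>\<^sub>m M) ^\<^sub>m k = a ^ k \<cdot>\<^sub>m (M ^\<^sub>m k)"
proof (induction k)
  case 0
  then show ?case using M by (intro eq_matI) auto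
next
  case (Suc k)
  have Mk: "M ^\<^sub>m k \<in> carrier_mat N N" using M by simp
  have "(a \<cdot>\<^sub>m M) ^\<^sub>m Suc k = (a ^ k \<cdot>\<^sub>m (M ^\<^sub>m k)) * (a \<cdot>\<^sub>m M)" using Suc by simp
  also have "\<dots> = a ^ k \<cdot>\<^sub>m ((M ^\<^sub>m k) * (a \<cdot>\<^sub>m M))"
    by (rule mult_smult_assoc_mat[OF Mk smult_carrier_mat[OF M]])
  also have "\<dots> = a ^ k \<cdot>\<^sub>m (a \<cdot>\<^sub>m ((M ^\<^sub>m k) * M))"
    by (simp only: mult_smult_distrib[OF Mk M])
  also have "\<dots> = a ^ Suc k \<cdot>\<^sub>m (M ^\<^sub>m Suc k)" by (intro eq_matI) (auto simp: mult_ac)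
  finally show ?case .
qed

text \<open>For r strictly between the spectral radius and \<rho>, the matrix F / r has spectral
  radius below 1, so the entries of its powers are bounded by one constant. Multiplying by the
  powers of r gives geometric decay of F itself.\<close>

lemma powers_bound:
  fixes F :: "real mat"
  assumes F: "F \<in> carrier_mat N N" and N: "0 < N"
    and ev: "\<And>z. eigenvalue (map_mat complex_of_real F) z \<Longrightarrow> cmod z < \<rho>"
  obtains r c where "0 < r" "r < \<rho>" "0 < c"
    "\<And>k v. v \<in> carrier_vec N \<Longrightarrow> ((F ^\<^sub>m k) *\<^sub>v v) \<bullet> ((F ^\<^sub>m k) *\<^sub>v v) \<le> c * (r\<^sup>2) ^ k * (v \<bullet> v)"
proof -
  let ?F = "map_mat complex_of_real F"
  have F': "?F \<in> carrier_mat N N" using F by simp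
  let ?\<sigma> = "spectral_radius ?F"
  have \<sigma>: "0 \<le> ?\<sigma>" "?\<sigma> < \<rho>"
    using spectral_radius_mem_max(1)[OF F' N] ev by (auto simp: spectrum_def)
  define r where "r = (?\<sigma> + \<rho>) / 2"
  have r: "0 < r" "?\<sigma> < r" "r < \<rho>" using \<sigma> by (auto simp: r_def)
  let ?G = "complex_of_real (1 / r) \<cdot>\<^sub>m ?F"
  have G: "?G \<in> carrier_mat N N" using F' by simp
  have "spectral_radius ?G < 1"
  proof -
    obtain z where z: "eigenvalue ?G z" "spectral_radius ?G = cmod z"
      using spectral_radius_mem_max(1)[OF G N] by (auto simp: spectrum_def)
    then obtain v where v: "v \<in> carrier_vec N" "v \<noteq> 0\<^sub>v N" "?G *\<^sub>v v = z \<cdot>\<^sub>v v"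
      using G by (auto simp: eigenvalue_def eigenvector_def)
    have "?F *\<^sub>v v = (complex_of_real r * z) \<cdot>\<^sub>v v"
    proof -
      have "?G *\<^sub>v v = complex_of_real (1 / r) \<cdot>\<^sub>v (?F *\<^sub>v v)"
        using F' v(1) by (intro eq_vecI) auto
      then have "complex_of_real r \<cdot>\<^sub>v (complex_of_real (1 / r) \<cdot>\<^sub>v (?F *\<^sub>v v)) = complex_of_real r \<cdot>\<^sub>v (z \<cdot>\<^sub>v v)"
        using v(3) by simp
      then show ?thesis using r by (simp add: smult_smult_assoc flip: of_real_mult)
    qed
    then have "eigenvalue ?F (complex_of_real r * z)"
      using v F' unfolding eigenvalue_def eigenvector_def by auto
    then have "cmod (complex_of_real r * z) \<le> ?\<sigma>"
      by (intro spectral_radius_mem_max(2)[OF F' N]) (auto simp: spectrum_def)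
    then have "r * cmod z \<le> ?\<sigma>" using r by (simp add: norm_mult)
    also note r(2)
    finally have "cmod z < 1" using r(1) by simp
    then show ?thesis using z by simp
  qed
  then obtain c where c: "\<And>k. norm_bound (?G ^\<^sub>m k) c"
    using spectral_radius_jnf_norm_bound_less_1_upper_triangular[OF G] by auto
  have entry: "\<bar>(F ^\<^sub>m k) $$ (i, j)\<bar> \<le> c * r ^ k" if ij: "i < N" "j < N" for i j k
  proof -
    have Fk: "F ^\<^sub>m k \<in> carrier_mat N N" "?F ^\<^sub>m k \<in> carrier_mat N N" using F F' by simp_all
    have hom: "?F ^\<^sub>m k = map_mat complex_of_real (F ^\<^sub>m k)"
      by (rule of_real_hom.mat_hom_pow[OF F, symmetric])
    have "cmod ((?G ^\<^sub>m k) $$ (i, j)) \<le> c"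
      using c[of k] ij carrier_matD[OF pow_carrier_mat[OF G, of k]] unfolding norm_bound_def by (simp only:)
    moreover have "(?G ^\<^sub>m k) $$ (i, j) = complex_of_real ((1 / r) ^ k * (F ^\<^sub>m k) $$ (i, j))"
    proof -
      have "i < dim_row (F ^\<^sub>m k)" "j < dim_col (F ^\<^sub>m k)"
        using ij carrier_matD[OF Fk(1)] by (simp_all only:)
      then show ?thesis unfolding smult_pow_mat[OF F'] hom by simp
    qed
    ultimately have "(1 / r) ^ k * \<bar>(F ^\<^sub>m k) $$ (i, j)\<bar> \<le> c"
      using r by (simp only: norm_of_real abs_mult power_abs abs_divide abs_one abs_of_pos)
    then show ?thesis using r by (simp add: field_simps power_divide)
  qed
  \<comment> \<open>N^2 entries, each at most c r^k in modulus, bound the squared Frobenius norm;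
    the 1 ensures positivity.\<close>
  let ?c = "real N * real N * c\<^sup>2 + 1"
  show thesis
  proof (rule that[OF r(1,3), of ?c])
    show "0 < ?c" by (simp add: add_nonneg_pos)
    fix k :: nat and v :: "real vec" assume v: "v \<in> carrier_vec N"
    have Fk: "F ^\<^sub>m k \<in> carrier_mat N N" using F by simp
    have "(\<Sum>i<N. \<Sum>j<N. ((F ^\<^sub>m k) $$ (i, j))\<^sup>2) \<le> (\<Sum>i<N. \<Sum>j<N. c\<^sup>2 * (r\<^sup>2) ^ k)"
    proof (intro sum_mono)
      fix i j assume "i \<in> {..<N}" "j \<in> {..<N}"
      then have "\<bar>(F ^\<^sub>m k) $$ (i, j)\<bar>\<^sup>2 \<le> (c * r ^ k)\<^sup>2"
        using entry by (intro power_mono) auto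
      then show "((F ^\<^sub>m k) $$ (i, j))\<^sup>2 \<le> c\<^sup>2 * (r\<^sup>2) ^ k"
        by (simp add: power_mult_distrib flip: power_mult) (simp add: mult.commute)
    qed
    also have "\<dots> \<le> ?c * (r\<^sup>2) ^ k" by (simp add: distrib_right)
    finally have "(\<Sum>i<N. \<Sum>j<N. ((F ^\<^sub>m k) $$ (i, j))\<^sup>2) * (v \<bullet> v) \<le> ?c * (r\<^sup>2) ^ k * (v \<bullet> v)"
      by (intro mult_right_mono scalar_prod_self_nonneg)
    then show "((F ^\<^sub>m k) *\<^sub>v v) \<bullet> ((F ^\<^sub>m k) *\<^sub>v v) \<le> ?c * (r\<^sup>2) ^ k * (v \<bullet> v)"
      using mult_mat_vec_frobenius[OF Fk v] by linarith
  qed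
qed

text \<open>A scalar majorant a takes the place of a quadratic Lyapunov function: it bounds the
  squared norm of F^i x_k, divided by r^(2 i), for all i at once. It contracts by a factor \<theta>
  < 1 up to the disturbance, and telescoping its recursion bounds its sum.\<close>

lemma schur_recursion_square_summable:
  fixes F :: "real mat"
  assumes F: "F \<in> carrier_mat N N" and N: "0 < N"
    and ev: "\<And>z. eigenvalue (map_mat complex_of_real F) z \<Longrightarrow> cmod z < \<rho>"
    and x: "\<And>k. x k \<in> carrier_vec N" and d: "\<And>k. d k \<in> carrier_vec N"
    and step: "\<And>k. x (Suc k) = (inverse \<rho> \<cdot>\<^sub>v (F *\<^sub>v x k)) + d k"
    and D: "\<And>M. (\<Sum>k<M. d k \<bullet> d k) \<le> D"
  shows "\<exists>E. \<forall>M. (\<Sum>k<M. x k \<bullet> x k) \<le> E"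
proof -
  obtain r c where r: "0 < r" "r < \<rho>" and c: "0 < c"
    and pow: "\<And>k v. v \<in> carrier_vec N \<Longrightarrow> ((F ^\<^sub>m k) *\<^sub>v v) \<bullet> ((F ^\<^sub>m k) *\<^sub>v v) \<le> c * (r\<^sup>2) ^ k * (v \<bullet> v)"
    by (rule powers_bound[OF F N ev]) (assumption, rule that)
  have \<rho>: "0 < \<rho>" using r by simp
  have rr: "r\<^sup>2 < \<rho>\<^sup>2" using r by (simp add: power_strict_mono)
  \<comment> \<open>The Young parameter is chosen so that \<theta> below is the midpoint between r^2
    / \<rho>^2 and 1.\<close>
  define s where "s = (\<rho>\<^sup>2 / r\<^sup>2 - 1) / 2"
  have s: "0 < s" using r rr by (simp add: s_def field_simps)
  define \<theta> where "\<theta> = (1 + s) * (r\<^sup>2 / \<rho>\<^sup>2)"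
  have \<theta>: "\<theta> < 1" "0 < \<theta>"
  proof -
    have "\<theta> = (1 + r\<^sup>2 / \<rho>\<^sup>2) / 2" using r \<rho> by (simp add: \<theta>_def s_def field_simps)
    moreover have "r\<^sup>2 / \<rho>\<^sup>2 < 1" "0 < r\<^sup>2 / \<rho>\<^sup>2" using r rr \<rho> by simp_all
    ultimately show "\<theta> < 1" "0 < \<theta>" by simp_all
  qed
  define a where "a = rec_nat (c * (x 0 \<bullet> x 0)) (\<lambda>k y. \<theta> * y + (1 + 1 / s) * c * (d k \<bullet> d k))"
  have a0: "a 0 = c * (x 0 \<bullet> x 0)" and aS: "a (Suc k) = \<theta> * a k + (1 + 1 / s) * c * (d k \<bullet> d k)" for k
    by (simp_all add: a_def)
  have Fi: "F ^\<^sub>m i \<in> carrier_mat N N" for i using F by simp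
  \<comment> \<open>The power i must be arbitrary: advancing k by one uses the hypothesis at i +
    1.\<close>
  have bound: "((F ^\<^sub>m i) *\<^sub>v x k) \<bullet> ((F ^\<^sub>m i) *\<^sub>v x k) \<le> (r\<^sup>2) ^ i * a k" for i k
  proof (induction k arbitrary: i)
    case 0
    show ?case unfolding a0 using pow[OF x, of i 0] by (simp add: mult_ac)
  next
    case (Suc k)
    let ?u = "(F ^\<^sub>m Suc i) *\<^sub>v x k" and ?w = "(F ^\<^sub>m i) *\<^sub>v d k"
    have u: "?u \<in> carrier_vec N" and w: "?w \<in> carrier_vec N"
      by (rule mult_mat_vec_carrier[OF Fi x] mult_mat_vec_carrier[OF Fi d])+
    have Fx: "F *\<^sub>v x k \<in> carrier_vec N" by (rule mult_mat_vec_carrier[OF F x])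
    have "(F ^\<^sub>m i) *\<^sub>v x (Suc k) = inverse \<rho> \<cdot>\<^sub>v ?u + ?w"
    proof -
      have "(F ^\<^sub>m i) *\<^sub>v x (Suc k) = (F ^\<^sub>m i) *\<^sub>v (inverse \<rho> \<cdot>\<^sub>v (F *\<^sub>v x k)) + ?w"
        unfolding step by (rule mult_add_distrib_mat_vec[OF Fi smult_carrier_vec[THEN iffD2, OF Fx] d])
      also have "(F ^\<^sub>m i) *\<^sub>v (inverse \<rho> \<cdot>\<^sub>v (F *\<^sub>v x k)) = inverse \<rho> \<cdot>\<^sub>v ?u"
        unfolding mult_mat_vec[OF Fi Fx] pow_mat.simps assoc_mult_mat_vec[OF Fi F x] ..
      finally show ?thesis .
    qed
    then have "((F ^\<^sub>m i) *\<^sub>v x (Suc k)) \<bullet> ((F ^\<^sub>m i) *\<^sub>v x (Suc k)) \<le>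
        (1 + s) * ((inverse \<rho>)\<^sup>2 * (?u \<bullet> ?u)) + (1 + 1 / s) * (?w \<bullet> ?w)"
      using scalar_prod_self_add_le[of "inverse \<rho> \<cdot>\<^sub>v ?u" N ?w s] u w s by (simp only: scalar_prod_self_smult smult_carrier_vec)
    also have "\<dots> \<le> (1 + s) * ((inverse \<rho>)\<^sup>2 * ((r\<^sup>2) ^ Suc i * a k)) + (1 + 1 / s) * (c * (r\<^sup>2) ^ i * (d k \<bullet> d k))"
      using s by (intro add_mono mult_left_mono Suc.IH pow d) auto
    also have "\<dots> = (r\<^sup>2) ^ i * a (Suc k)"
      unfolding aS \<theta>_def by (simp add: divide_inverse power_inverse algebra_simps)
    finally show ?case .
  qed
  have xa: "x k \<bullet> x k \<le> a k" for k
    using bound[of 0 k] x[of k] F by simp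
  have tele: "a M + (1 - \<theta>) * (\<Sum>k<M. a k) \<le> a 0 + (1 + 1 / s) * c * (\<Sum>k<M. d k \<bullet> d k)" for M
  proof (induction M)
    case (Suc M)
    have "a (Suc M) + (1 - \<theta>) * (\<Sum>k<Suc M. a k) = a M + (1 - \<theta>) * (\<Sum>k<M. a k) + (1 + 1 / s) * c * (d M \<bullet> d M)"
      unfolding aS by (simp add: algebra_simps)
    then show ?case using Suc by (simp add: distrib_left)
  qed simp
  have "(\<Sum>k<M. x k \<bullet> x k) \<le> (a 0 + (1 + 1 / s) * c * D) / (1 - \<theta>)" for M
  proof -
    have "0 \<le> a M" using xa[of M] scalar_prod_self_nonneg[of "x M"] by linarith
    moreover have "(1 + 1 / s) * c * (\<Sum>k<M. d k \<bullet> d k) \<le> (1 + 1 / s) * c * D"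
      using s c by (intro mult_left_mono D) auto
    moreover have "(1 - \<theta>) * (\<Sum>k<M. x k \<bullet> x k) \<le> (1 - \<theta>) * (\<Sum>k<M. a k)"
      using \<theta> xa by (intro mult_left_mono sum_mono) auto
    ultimately have "(1 - \<theta>) * (\<Sum>k<M. x k \<bullet> x k) \<le> a 0 + (1 + 1 / s) * c * D"
      using tele[of M] by linarith
    then show ?thesis using \<theta> by (simp add: field_simps)
  qed
  then show ?thesis by blast
qed

text \<open>The feedback depends on time because exponential scaling of the state makes a static
  nonlinearity time-varying. The additive d is where a change of the feedback strength is
  accommodated.\<close>

definition perturbed_loop ::
  "real mat \<Rightarrow> real mat \<Rightarrow> (nat \<Rightarrow> real vec \<Rightarrow> real vec) \<Rightarrow> (nat \<Rightarrow> real vec) \<Rightarrow> (nat \<Rightarrow> real vec) \<Rightarrow> bool" where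
  "perturbed_loop G B \<psi> x d \<longleftrightarrow>
     (\<forall>k. x k \<in> carrier_vec (dim_row G)) \<and> (\<forall>k. d k \<in> carrier_vec (dim_row G)) \<and>
     (\<forall>k. x (Suc k) = (G *\<^sub>v x k + B *\<^sub>v \<psi> k (x k)) + d k)"

text \<open>The assumption \<open>apriori\<close> asks for summability but returns a bound in which
  E does not occur. With one K for all \<tau>, each step raises \<tau> by the same \<delta>: the
  extra feedback, cut off at time M, is a disturbance of finite energy for the previous \<tau>, and
  its share of the bound is at most half of the sum being estimated.\<close>

lemma homotopy_square_summable:
  fixes G B :: "real mat" and \<psi> :: "nat \<Rightarrow> real vec \<Rightarrow> real vec"
  assumes G: "G \<in> carrier_mat N N" and B: "B \<in> carrier_mat N p"
    and \<psi>: "\<And>k v. v \<in> carrier_vec N \<Longrightarrow> \<psi> k v \<in> carrier_vec p"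
    and gain: "\<And>k v. v \<in> carrier_vec N \<Longrightarrow> \<psi> k v \<bullet> \<psi> k v \<le> b * (v \<bullet> v)" and b: "0 \<le> b"
    and K: "0 < K"
    and apriori: "\<And>\<tau> x d D E M. \<lbrakk>0 \<le> \<tau>; \<tau> \<le> 1; perturbed_loop G B (\<lambda>k v. \<tau> \<cdot>\<^sub>v \<psi> k v) x d;
        \<And>M. (\<Sum>k<M. d k \<bullet> d k) \<le> D; \<And>M. (\<Sum>k<M. x k \<bullet> x k) \<le> E\<rbrakk> \<Longrightarrow>
        (\<Sum>k<M. x k \<bullet> x k) \<le> K * (x 0 \<bullet> x 0 + D)"
    and base: "\<And>x d D. \<lbrakk>perturbed_loop G B (\<lambda>k v. 0 \<cdot>\<^sub>v \<psi> k v) x d; \<And>M. (\<Sum>k<M. d k \<bullet> d k) \<le> D\<rbrakk> \<Longrightarrow>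
        \<exists>E. \<forall>M. (\<Sum>k<M. x k \<bullet> x k) \<le> E"
    and loop: "perturbed_loop G B \<psi> x d" and D: "\<And>M. (\<Sum>k<M. d k \<bullet> d k) \<le> D"
  shows "\<exists>E. \<forall>M. (\<Sum>k<M. x k \<bullet> x k) \<le> E"
proof -
  obtain \<kappa> where \<kappa>: "0 < \<kappa>" "\<And>v. v \<in> carrier_vec p \<Longrightarrow> (B *\<^sub>v v) \<bullet> (B *\<^sub>v v) \<le> \<kappa> * (v \<bullet> v)"
    by (rule mult_mat_vec_bounded[OF B]) (rule that)
  \<comment> \<open>J is large enough for the absorption inequality \<open>small\<close>, and
    \<delta> = 1/(J + 1) reaches \<tau> = 1 after exactly \<open>Suc J\<close> steps.\<close>
  obtain J :: nat where J: "4 * K * \<kappa> * b < real J" using reals_Archimedean2 by blast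
  define \<delta> where "\<delta> = 1 / real (Suc J)"
  have \<delta>: "0 < \<delta>" "\<delta> \<le> 1" by (simp_all add: \<delta>_def)
  have small: "2 * K * \<kappa> * b * \<delta>\<^sup>2 \<le> 1 / 2"
  proof -
    have "4 * K * \<kappa> * b * \<delta> \<le> 1" using J by (simp add: \<delta>_def field_simps)
    moreover have "4 * K * \<kappa> * b * \<delta> * \<delta> \<le> 4 * K * \<kappa> * b * \<delta> * 1"
      using \<delta> K \<kappa> b by (intro mult_left_mono) auto
    ultimately show ?thesis by (simp add: power2_eq_square)
  qed
  have all: "\<exists>E. \<forall>M. (\<Sum>k<M. x k \<bullet> x k) \<le> E"
    if "j \<le> Suc J" "perturbed_loop G B (\<lambda>k v. (real j * \<delta>) \<cdot>\<^sub>v \<psi> k v) x d" "\<And>M. (\<Sum>k<M. d k \<bullet> d k) \<le> D" for j x d D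
    using that
  proof (induction j arbitrary: x d D)
    case 0
    show ?case by (rule base[OF _ 0(3)]) (use 0(2) in simp)
  next
    case (Suc j)
    let ?\<tau> = "real j * \<delta>"
    have \<tau>: "0 \<le> ?\<tau>" "?\<tau> \<le> 1" using Suc.prems(1) \<delta> by (simp_all add: \<delta>_def)
    have x: "x k \<in> carrier_vec N" and d: "d k \<in> carrier_vec N"
      and step: "x (Suc k) = (G *\<^sub>v x k + B *\<^sub>v ((real (Suc j) * \<delta>) \<cdot>\<^sub>v \<psi> k (x k))) + d k" for k
      using Suc.prems(2) G by (auto simp: perturbed_loop_def)
    have "(\<Sum>k<M. x k \<bullet> x k) \<le> 2 * K * (x 0 \<bullet> x 0 + 2 * D)" for M
    proof -
      define h where "h k = B *\<^sub>v (\<delta> \<cdot>\<^sub>v \<psi> k (x k))" for k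
      \<comment> \<open>Before time M the extra feedback, evaluated along the given x, counts as
        disturbance; afterwards there is none. The trajectory \<open>x'\<close> defined next
        coincides with x up to time M and then continues in the loop with the smaller \<tau>, to
        which the induction hypothesis applies.\<close>
      define d' where "d' k = (if k < M then h k + d k else 0\<^sub>v N)" for k
      define x' where "x' = rec_nat (x 0) (\<lambda>k y. (G *\<^sub>v y + B *\<^sub>v (?\<tau> \<cdot>\<^sub>v \<psi> k y)) + d' k)"
      have x'0: "x' 0 = x 0" and x'S: "x' (Suc k) = (G *\<^sub>v x' k + B *\<^sub>v (?\<tau> \<cdot>\<^sub>v \<psi> k (x' k))) + d' k" for k
        by (simp_all add: x'_def)
      have \<psi>c: "a \<cdot>\<^sub>v \<psi> k v \<in> carrier_vec p" if "v \<in> carrier_vec N" for a k v using \<psi>[OF that] by simp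
      have h: "h k \<in> carrier_vec N" for k unfolding h_def by (rule mult_mat_vec_carrier[OF B \<psi>c[OF x]])
      have d': "d' k \<in> carrier_vec N" for k using h d by (simp add: d'_def)
      have x': "x' k \<in> carrier_vec N" for k
      proof (induction k)
        case (Suc k)
        show ?case unfolding x'S
          by (intro add_carrier_vec d' mult_mat_vec_carrier[OF G Suc] mult_mat_vec_carrier[OF B \<psi>c[OF Suc]])
      qed (simp add: x'0 x)
      have agree: "x' k = x k" if "k \<le> M" for k
        using that
      proof (induction k)
        case (Suc k)
        then have eq: "x' k = x k" and "k < M" by auto
        have \<psi>k: "\<psi> k (x k) \<in> carrier_vec p" by (rule \<psi>[OF x])
        have "(real (Suc j) * \<delta>) \<cdot>\<^sub>v \<psi> k (x k) = ?\<tau> \<cdot>\<^sub>v \<psi> k (x k) + \<delta> \<cdot>\<^sub>v \<psi> k (x k)"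
          using \<psi>k by (intro eq_vecI) (auto simp: algebra_simps)
        then have Bsplit: "B *\<^sub>v ((real (Suc j) * \<delta>) \<cdot>\<^sub>v \<psi> k (x k)) = B *\<^sub>v (?\<tau> \<cdot>\<^sub>v \<psi> k (x k)) + h k"
          unfolding h_def using mult_add_distrib_mat_vec[OF B \<psi>c[OF x] \<psi>c[OF x]] by simp
        note Gx = mult_mat_vec_carrier[OF G x[of k]] and Bx = mult_mat_vec_carrier[OF B \<psi>c[OF x[of k], of ?\<tau> k]]
        have "x (Suc k) = (G *\<^sub>v x k + B *\<^sub>v (?\<tau> \<cdot>\<^sub>v \<psi> k (x k))) + (h k + d k)"
          unfolding step Bsplit assoc_add_vec[OF Gx Bx h, symmetric]
          by (rule assoc_add_vec[OF add_carrier_vec[OF Gx Bx] h d])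
        then show ?case unfolding x'S eq using \<open>k < M\<close> by (simp add: d'_def)
      qed (simp add: x'0)
      have loop': "perturbed_loop G B (\<lambda>k v. ?\<tau> \<cdot>\<^sub>v \<psi> k v) x' d'"
        unfolding perturbed_loop_def using x' d' x'S G by simp
      let ?E = "\<Sum>k<M. x k \<bullet> x k"
      define D' where "D' = 2 * \<kappa> * b * \<delta>\<^sup>2 * ?E + 2 * D"
      have d'_le: "d' k \<bullet> d' k \<le> 2 * \<kappa> * b * \<delta>\<^sup>2 * (x k \<bullet> x k) + 2 * (d k \<bullet> d k)" if "k < M" for k
      proof -
        have "h k \<bullet> h k \<le> \<kappa> * (\<delta>\<^sup>2 * (b * (x k \<bullet> x k)))"
        proof -
          have "h k \<bullet> h k \<le> \<kappa> * (\<delta>\<^sup>2 * (\<psi> k (x k) \<bullet> \<psi> k (x k)))"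
            using \<kappa>(2)[OF \<psi>c[OF x], of \<delta> k k] unfolding h_def scalar_prod_self_smult .
          also have "\<dots> \<le> \<kappa> * (\<delta>\<^sup>2 * (b * (x k \<bullet> x k)))"
            using \<kappa>(1) gain[OF x] by (intro mult_left_mono) auto
          finally show ?thesis .
        qed
        then show ?thesis
          using scalar_prod_self_add_le[OF h d, of 1 k k] that by (simp add: d'_def mult_ac)
      qed
      have D'_bound: "(\<Sum>k<M'. d' k \<bullet> d' k) \<le> D'" for M'
      proof -
        have "(\<Sum>k<M'. d' k \<bullet> d' k) \<le> (\<Sum>k<M + M'. d' k \<bullet> d' k)"
          by (intro sum_mono2) (auto simp: scalar_prod_self_nonneg)
        also have "\<dots> = (\<Sum>k<M. d' k \<bullet> d' k)"
          by (intro sum.mono_neutral_right) (auto simp: d'_def scalar_prod_self)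
        also have "\<dots> \<le> (\<Sum>k<M. 2 * \<kappa> * b * \<delta>\<^sup>2 * (x k \<bullet> x k) + 2 * (d k \<bullet> d k))"
          by (intro sum_mono d'_le) simp
        also have "\<dots> = 2 * \<kappa> * b * \<delta>\<^sup>2 * ?E + 2 * (\<Sum>k<M. d k \<bullet> d k)"
          by (simp add: sum.distrib sum_distrib_left)
        also have "\<dots> \<le> D'" unfolding D'_def using Suc.prems(3)[of M] by simp
        finally show ?thesis .
      qed
      have "\<exists>E. \<forall>M. (\<Sum>k<M. x' k \<bullet> x' k) \<le> E"
        by (rule Suc.IH[OF _ loop' D'_bound]) (use Suc.prems(1) in simp)
      then obtain E where E: "\<And>M. (\<Sum>k<M. x' k \<bullet> x' k) \<le> E" by blast
      have "?E = (\<Sum>k<M. x' k \<bullet> x' k)" using agree by (intro sum.cong) auto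
      also have "\<dots> \<le> K * (x' 0 \<bullet> x' 0 + D')"
        by (rule apriori[OF \<tau> loop' D'_bound E])
      \<comment> \<open>\<open>?E\<close> is a finite sum, so its share on the right, at most one
        half, can be moved to the left. The bound that remains does not depend on M.\<close>
      finally have "?E \<le> K * (x 0 \<bullet> x 0) + 2 * K * D + (2 * K * \<kappa> * b * \<delta>\<^sup>2) * ?E"
        unfolding x'0 D'_def by (simp add: algebra_simps)
      moreover have "(2 * K * \<kappa> * b * \<delta>\<^sup>2) * ?E \<le> 1 / 2 * ?E"
        by (intro mult_right_mono small sum_nonneg scalar_prod_self_nonneg)
      moreover have "e \<le> 2 * a" if "e \<le> a + t" "t \<le> 1 / 2 * e" for e a t :: real
        using that by linarith
      ultimately have "?E \<le> 2 * (K * (x 0 \<bullet> x 0) + 2 * K * D)" by blast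
      also have "\<dots> = 2 * K * (x 0 \<bullet> x 0 + 2 * D)" by (simp add: algebra_simps)
      finally show ?thesis .
    qed
    then show ?case by blast
  qed
  have "perturbed_loop G B (\<lambda>k v. (real (Suc J) * \<delta>) \<cdot>\<^sub>v \<psi> k v) x d"
    using loop by (simp add: \<delta>_def)
  from all[OF _ this D] show ?thesis by simp
qed

subsection \<open>Stability of the loop\<close>

lemma bij_betw_coord: "bij_betw (coord :: nat \<Rightarrow> 'p::finite) {..<CARD('p)} UNIV"
  unfolding coord_def
  by (rule someI_ex[OF ex_bij_betw_nat_finite[OF finite_class.finite_UNIV, unfolded atLeast0LessThan]])

lemma to_vec_carrier [simp]: "to_vec (x :: real ^ 'p) \<in> carrier_vec CARD('p)"
  by (simp add: to_vec_def)

lemma scalar_prod_to_vec: "to_vec a \<bullet> to_vec b = inner a b" for a b :: "real ^ 'p"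
proof -
  have "to_vec a \<bullet> to_vec b = (\<Sum>i<CARD('p). vec_nth a (coord i) * vec_nth b (coord i))"
    by (simp add: to_vec_def scalar_prod_def atLeast0LessThan)
  also have "\<dots> = (\<Sum>j\<in>UNIV. vec_nth a j * vec_nth b j)"
    by (rule sum.reindex_bij_betw[OF bij_betw_coord])
  finally show ?thesis by (simp add: inner_vec_def)
qed

lemma to_vec_of_vec:
  assumes "v \<in> carrier_vec CARD('p::finite)"
  shows "to_vec (of_vec v :: real ^ 'p) = v"
proof (rule eq_vecI)
  fix i assume "i < dim_vec v"
  then have i: "i < CARD('p)" using assms by simp
  then have "inv_into {..<CARD('p)} coord (coord i :: 'p) = i"
    using bij_betw_coord[where 'p = 'p] by (intro inv_into_f_f) (auto simp: bij_betw_def)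
  then show "to_vec (of_vec v :: real ^ 'p) $ i = v $ i"
    using i by (simp add: to_vec_def of_vec_def)
qed (use assms in \<open>simp add: to_vec_def\<close>)

lemma norm_of_vec:
  assumes "v \<in> carrier_vec CARD('p::finite)"
  shows "(norm (of_vec v :: real ^ 'p))\<^sup>2 = v \<bullet> v"
  using scalar_prod_to_vec[of "of_vec v :: real ^ 'p" "of_vec v"]
  by (simp add: power2_norm_eq_inner to_vec_of_vec[OF assms])

lemma to_vec_scaleR: "to_vec (r *\<^sub>R x) = r \<cdot>\<^sub>v to_vec x"
  by (intro eq_vecI) (auto simp: to_vec_def)

lemma to_vec_diff: "to_vec (x - y) = to_vec x - to_vec y"
  by (intro eq_vecI) (auto simp: to_vec_def)

text \<open>With \<open>Y k\<close> the unscaled plant output, both filter signals at time k are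
  \<open>inverse \<rho> ^ Suc k\<close> times functions of \<open>Y k\<close>. The exponent is k + 1
  because the extended plant carries a factor \<open>inverse \<rho>\<close> in front of C.\<close>

lemma zames_falb_loop_signals:
  fixes f :: "real ^ 'p \<Rightarrow> real ^ 'p" and C :: "real mat" and m L \<rho> :: real
  assumes st: "zf_storage (L - m) f V" and \<rho>: "0 < \<rho>"
    and C: "C \<in> carrier_mat CARD('p) N" and x: "\<And>k. x k \<in> carrier_vec N"
    and \<mu>: "\<And>i. i \<in> {- int lm..int lp} \<Longrightarrow> i \<noteq> 0 \<Longrightarrow> \<mu> i \<le> 0"
      "0 \<le> (\<Sum>i\<in>{- int lm..int lp}. \<mu> i * \<rho> powi (- i))"
      "0 \<le> (\<Sum>i\<in>{- int lm..int lp}. \<mu> i * \<rho> powi i)"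
    and q: "\<And>k. q k = inverse \<rho> ^ Suc k \<cdot>\<^sub>v to_vec (f (of_vec (\<rho> ^ k \<cdot>\<^sub>v (C *\<^sub>v x k))))"
  shows "0 \<le> (\<Sum>k<M. zf_term (\<lambda>j k. q j \<bullet> out_filter m L (inverse \<rho> \<cdot>\<^sub>v (C *\<^sub>v x k)) (q k)) \<mu> lp lm k)"
proof -
  define Y :: "nat \<Rightarrow> real ^ 'p" where "Y k = of_vec (\<rho> ^ k \<cdot>\<^sub>v (C *\<^sub>v x k))" for k
  let ?r = "inverse \<rho>"
  let ?P = "\<lambda>k. (L - m) *\<^sub>R Y k - f (Y k)"
  have Cx: "C *\<^sub>v x k \<in> carrier_vec CARD('p)" for k by (rule mult_mat_vec_carrier[OF C x])
  have p: "out_filter m L (?r \<cdot>\<^sub>v (C *\<^sub>v x k)) (q k) = ?r ^ Suc k \<cdot>\<^sub>v to_vec (?P k)" for k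
  proof -
    have "to_vec (Y k) = \<rho> ^ k \<cdot>\<^sub>v (C *\<^sub>v x k)"
      unfolding Y_def by (rule to_vec_of_vec) (simp add: Cx)
    then have "?r ^ Suc k \<cdot>\<^sub>v to_vec (Y k) = (?r ^ Suc k * \<rho> ^ k) \<cdot>\<^sub>v (C *\<^sub>v x k)"
      by (simp only: smult_smult_assoc)
    also have "?r ^ Suc k * \<rho> ^ k = ?r" using \<rho> by (simp add: power_inverse)
    finally have y: "?r ^ Suc k \<cdot>\<^sub>v to_vec (Y k) = ?r \<cdot>\<^sub>v (C *\<^sub>v x k)" .
    show ?thesis
      unfolding out_filter_def y[symmetric] q Y_def[symmetric] to_vec_diff to_vec_scaleR
      by (intro eq_vecI) (auto simp: to_vec_def algebra_simps)
  qed
  \<comment> \<open>The surplus factor \<open>inverse \<rho>\<close> of each signal is moved into s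
    and V, whose inequalities are homogeneous.\<close>
  interpret zf_signals "\<lambda>j k. ?r\<^sup>2 * inner (f (Y j)) (?P k)" "\<lambda>k. ?r\<^sup>2 * V (Y k)" \<rho>
  proof
    show "0 \<le> ?r\<^sup>2 * V (Y k)" for k using st by (simp add: zf_storage_def)
    show "?r\<^sup>2 * V (Y k) \<le> ?r\<^sup>2 * inner (f (Y k)) (?P k)" for k
      using st by (intro mult_left_mono) (auto simp: zf_storage_def)
    fix j k
    have "?r\<^sup>2 * inner (f (Y j)) (?P k) \<le> ?r\<^sup>2 * (inner (f (Y j)) (?P j) + V (Y k) - V (Y j))"
      using st by (intro mult_left_mono) (auto simp: zf_storage_def)
    then show "?r\<^sup>2 * inner (f (Y j)) (?P k) \<le> ?r\<^sup>2 * inner (f (Y j)) (?P j) + ?r\<^sup>2 * V (Y k) - ?r\<^sup>2 * V (Y j)"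
      by (simp add: algebra_simps)
  qed (rule \<rho>)
  have "(\<lambda>j k. q j \<bullet> out_filter m L (?r \<cdot>\<^sub>v (C *\<^sub>v x k)) (q k)) = t"
  proof (intro ext)
    fix j k
    have "q j \<bullet> (?r ^ Suc k \<cdot>\<^sub>v to_vec (?P k)) = ?r ^ Suc j * (?r ^ Suc k * inner (f (Y j)) (?P k))"
      unfolding q Y_def[symmetric]
      by (simp add: scalar_prod_to_vec to_vec_def[where 'p = 'p] flip: scalar_prod_to_vec)
    also have "\<dots> = t j k" unfolding t_def by (simp add: power_add power2_eq_square mult_ac)
    finally show "q j \<bullet> out_filter m L (?r \<cdot>\<^sub>v (C *\<^sub>v x k)) (q k) = t j k" unfolding p .
  qed
  then show ?thesis using zames_falb_sum[OF \<mu>, of M] by simp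
qed

theorem theorem5:
  fixes n p lp lm nc :: nat
    and m L \<rho> :: real
    and A B C D D' :: "real mat"
  assumes "n \<ge> 1"
    and "p = CARD('p::finite)"
    and "0 < m" and "m \<le> L"
    and "A \<in> carrier_mat (n * p) (n * p)"
    and "B \<in> carrier_mat (n * p) p"
    and "C \<in> carrier_mat p (n * p)"
    and "D \<in> carrier_mat p (n * p)"
    and "D' \<in> carrier_mat (n * p) p"
    and "D * D' = 1\<^sub>m p"
    and "C * D' = 1\<^sub>m p"
    and "(A - 1\<^sub>m (n * p)) * D' = 0\<^sub>m (n * p) p"
    and "0 < \<rho>" and "\<rho> < 1"
    and "\<And>z. eigenvalue (map_mat complex_of_real (A + m \<cdot>\<^sub>m (B * C))) z \<Longrightarrow> cmod z < \<rho>"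
    and "nc = p * (n + lm + lp)"
    and "\<exists>P Mp Mm M0.
           P \<in> carrier_mat nc nc \<and> transpose_mat P = P \<and>
           Mp \<in> carrier_mat p (lp * p) \<and>
           Mm \<in> carrier_mat p (lm * p) \<and>
           M0 \<in> carrier_mat p p \<and>
           LMI nc (A_c lp lm n p m L A B C \<rho>) (B_c lp lm p m L B)
             (C_c lp lm n p m L C \<rho>) (D_c lp lm p m L) P (M_Delta M0 Mm Mp) \<and>
           (Mm @\<^sub>c M0 @\<^sub>c Mp) \<in> multipliers \<rho> lp lm p"
  shows "robustly_exp_stable \<rho> (A + m \<cdot>\<^sub>m (B * C)) B C
           (Delta_op m ` (S_class m L :: (real ^ 'p \<Rightarrow> real) set))"
proof -
  note A = assms(5) and B = assms(6) and C = assms(7) and \<rho> = assms(13) and ev = assms(15)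
  let ?N = "n * p" and ?F = "A + m \<cdot>\<^sub>m (B * C)" and ?r = "inverse \<rho>"
  have p: "0 < p" using assms(2) by simp
  have N: "0 < ?N" using p assms(1) by simp
  have F: "?F \<in> carrier_mat ?N ?N" by (rule F_carrier[OF A B C])
  have nc: "nc = lm * p + lp * p + n * p" unfolding assms(16) by (simp add: algebra_simps)
  obtain P Mp Mm M0 where P: "P \<in> carrier_mat (lm * p + lp * p + n * p) (lm * p + lp * p + n * p)"
    and M: "M0 \<in> carrier_mat p p" "Mm \<in> carrier_mat p (lm * p)" "Mp \<in> carrier_mat p (lp * p)"
    and lmi: "LMI (lm * p + lp * p + n * p) (A_c lp lm n p m L A B C \<rho>) (B_c lp lm p m L B)
             (C_c lp lm n p m L C \<rho>) (D_c lp lm p m L) P (M_Delta M0 Mm Mp)"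
    and mult: "(Mm @\<^sub>c M0 @\<^sub>c Mp) \<in> multipliers \<rho> lp lm p"
    using assms(17) unfolding nc by (elim exE conjE) (rule that)
  obtain \<mu> where \<mu>: "Mm = mat 1 lm (\<lambda>(_, a). \<mu> (int a - int lm)) \<otimes>\<^sub>m 1\<^sub>m p"
      "M0 = \<mu> 0 \<cdot>\<^sub>m 1\<^sub>m p" "Mp = mat 1 lp (\<lambda>(_, a). \<mu> (int a + 1)) \<otimes>\<^sub>m 1\<^sub>m p"
    and \<mu>_cond: "\<And>i. i \<in> {- int lm..int lp} \<Longrightarrow> i \<noteq> 0 \<Longrightarrow> \<mu> i \<le> 0"
      "0 \<le> (\<Sum>i\<in>{- int lm..int lp}. \<mu> i * \<rho> powi (- i))"
      "0 \<le> (\<Sum>i\<in>{- int lm..int lp}. \<mu> i * \<rho> powi i)"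
    by (rule multipliers_blocks[OF M(2,1,3) mult p]) (rule that)
  from trajectory_bound[OF A B C P M lmi \<mu>] obtain K where K: "0 < K" and bound:
    "\<forall>x q d D N.
       (\<forall>k. x k \<in> carrier_vec ?N \<and> q k \<in> carrier_vec p \<and> d k \<in> carrier_vec ?N \<and>
          x (Suc k) = (?r \<cdot>\<^sub>v (?F *\<^sub>v x k) + B *\<^sub>v q k) + d k) \<longrightarrow>
       (\<forall>M. 0 \<le> (\<Sum>k<M. zf_term (\<lambda>j k. q j \<bullet> out_filter m L (?r \<cdot>\<^sub>v (C *\<^sub>v x k)) (q k)) \<mu> lp lm k)) \<longrightarrow>
       (\<lambda>k. x k \<bullet> x k) \<longlonglongrightarrow> 0 \<longrightarrow> (\<lambda>k. q k \<bullet> q k) \<longlonglongrightarrow> 0 \<longrightarrow>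
       (\<forall>M. (\<Sum>k<M. d k \<bullet> d k) \<le> D) \<longrightarrow>
       (\<Sum>k<N. x k \<bullet> x k) \<le> K * (x 0 \<bullet> x 0 + D)"
    by (elim exE conjE) (rule that)
  obtain \<kappa> where \<kappa>: "0 < \<kappa>" "\<And>v. v \<in> carrier_vec ?N \<Longrightarrow> (C *\<^sub>v v) \<bullet> (C *\<^sub>v v) \<le> \<kappa> * (v \<bullet> v)"
    by (rule mult_mat_vec_bounded[OF C]) (rule that)
  let ?G = "?r \<cdot>\<^sub>m ?F"
  have G: "?G \<in> carrier_mat ?N ?N" by (rule smult_carrier_mat[OF F])
  have Gv: "?G *\<^sub>v v = ?r \<cdot>\<^sub>v (?F *\<^sub>v v)" if "v \<in> carrier_vec ?N" for v
    by (rule smult_mat_mult_vec[OF F that])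
  show ?thesis
    unfolding robustly_exp_stable_def
  \<comment> \<open>K is fixed before H and the trajectory are introduced, which makes \<eta> = K
    uniform.\<close>
  proof (intro exI[of _ K] conjI K ballI allI impI)
    fix \<Delta> :: "(nat \<Rightarrow> real ^ 'p) \<Rightarrow> nat \<Rightarrow> real ^ 'p" and \<xi> k0
    assume "\<Delta> \<in> Delta_op m ` (S_class m L :: (real ^ 'p \<Rightarrow> real) set)" and loop: "solves_loop ?F B C \<Delta> \<xi>"
    then obtain H :: "real ^ 'p \<Rightarrow> real" where H: "H \<in> S_class m L" and \<Delta>: "\<Delta> = Delta_op m H" by blast
    define f where "f y = grad H (y + minimizer H) - m *\<^sub>R y" for y
    have f_gain: "norm (f y) \<le> (L + m) * norm y" for y
      unfolding f_def by (rule S_class_residual(1)[OF H assms(3,4)])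
    have f_zf: "\<exists>V. zf_storage (L - m) (\<lambda>y. \<tau> *\<^sub>R f y) V" if "0 \<le> \<tau>" "\<tau> \<le> 1" for \<tau>
      unfolding f_def by (rule S_class_residual(2)[OF H assms(3,4) that])
    \<comment> \<open>The nonlinearity in scaled coordinates: the argument is scaled back to time k,
      while the value drives the state at time k + 1. The powers cancel up to one
      \<open>inverse \<rho>\<close>, so the gain b below does not depend on k.\<close>
    define \<psi> where "\<psi> k v = ?r ^ Suc k \<cdot>\<^sub>v to_vec (f (of_vec (\<rho> ^ k \<cdot>\<^sub>v (C *\<^sub>v v))))" for k v
    have \<psi>: "\<psi> k v \<in> carrier_vec p" for k v unfolding \<psi>_def assms(2) by simp
    define b where "b = (?r * (L + m))\<^sup>2 * \<kappa>"
    have b: "0 \<le> b" using \<kappa>(1) by (simp add: b_def)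
    have gain: "\<psi> k v \<bullet> \<psi> k v \<le> b * (v \<bullet> v)" if v: "v \<in> carrier_vec ?N" for k v
    proof -
      let ?y = "of_vec (\<rho> ^ k \<cdot>\<^sub>v (C *\<^sub>v v)) :: real ^ 'p"
      have Cv: "C *\<^sub>v v \<in> carrier_vec CARD('p)" using mult_mat_vec_carrier[OF C v] assms(2) by simp
      have ny: "(norm ?y)\<^sup>2 = (\<rho> ^ k)\<^sup>2 * ((C *\<^sub>v v) \<bullet> (C *\<^sub>v v))"
        using norm_of_vec[of "\<rho> ^ k \<cdot>\<^sub>v (C *\<^sub>v v)", where 'p = 'p] Cv by (simp only: scalar_prod_self_smult smult_carrier_vec)
      have "\<psi> k v \<bullet> \<psi> k v = (?r ^ Suc k)\<^sup>2 * (norm (f ?y))\<^sup>2"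
        unfolding \<psi>_def scalar_prod_self_smult scalar_prod_to_vec power2_norm_eq_inner ..
      also have "\<dots> \<le> (?r ^ Suc k)\<^sup>2 * ((L + m) * norm ?y)\<^sup>2"
        by (intro mult_left_mono power_mono f_gain) auto
      also have "\<dots> = (?r ^ Suc k * \<rho> ^ k)\<^sup>2 * (L + m)\<^sup>2 * ((C *\<^sub>v v) \<bullet> (C *\<^sub>v v))"
        unfolding power_mult_distrib[of "L + m"] ny by (simp add: power_mult_distrib)
      also have "?r ^ Suc k * \<rho> ^ k = ?r" using \<rho> by (simp add: power_inverse)
      also have "?r\<^sup>2 * (L + m)\<^sup>2 * ((C *\<^sub>v v) \<bullet> (C *\<^sub>v v)) \<le> ?r\<^sup>2 * (L + m)\<^sup>2 * (\<kappa> * (v \<bullet> v))"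
        by (intro mult_left_mono \<kappa>(2)[OF v]) auto
      finally show ?thesis by (simp add: b_def power_mult_distrib mult.assoc)
    qed
    \<comment> \<open>E enters only qualitatively: summability makes x tend to zero, and the finite
      gain passes this on to the input, as \<open>bound\<close> demands.\<close>
    have apriori: "(\<Sum>k<M. x k \<bullet> x k) \<le> K * (x 0 \<bullet> x 0 + D)"
      if \<tau>: "0 \<le> \<tau>" "\<tau> \<le> 1" and sol: "perturbed_loop ?G B (\<lambda>k v. \<tau> \<cdot>\<^sub>v \<psi> k v) x d"
        and D: "\<And>M. (\<Sum>k<M. d k \<bullet> d k) \<le> D" and E: "\<And>M. (\<Sum>k<M. x k \<bullet> x k) \<le> E" for \<tau> x d D E M
    proof -
      have x: "x k \<in> carrier_vec ?N" and d: "d k \<in> carrier_vec ?N"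
        and step: "x (Suc k) = (?G *\<^sub>v x k + B *\<^sub>v (\<tau> \<cdot>\<^sub>v \<psi> k (x k))) + d k" for k
        using sol unfolding perturbed_loop_def carrier_matD(1)[OF G] by blast+
      let ?q = "\<lambda>k. \<tau> \<cdot>\<^sub>v \<psi> k (x k)"
      have q: "?q k \<in> carrier_vec p" for k using \<psi> by simp
      have "summable (\<lambda>k. x k \<bullet> x k)"
        by (rule summableI_nonneg_bounded[OF scalar_prod_self_nonneg E])
      then have xlim: "(\<lambda>k. x k \<bullet> x k) \<longlonglongrightarrow> 0" by (rule summable_LIMSEQ_zero)
      have qlim: "(\<lambda>k. ?q k \<bullet> ?q k) \<longlonglongrightarrow> 0"
      proof (rule tendsto_sandwich[OF _ _ tendsto_const])
        show "\<forall>\<^sub>F k in sequentially. 0 \<le> ?q k \<bullet> ?q k"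
          by (intro always_eventually allI scalar_prod_self_nonneg)
        show "\<forall>\<^sub>F k in sequentially. ?q k \<bullet> ?q k \<le> \<tau>\<^sup>2 * (b * (x k \<bullet> x k))"
          unfolding scalar_prod_self_smult by (intro always_eventually allI mult_left_mono gain x) simp
        show "(\<lambda>k. \<tau>\<^sup>2 * (b * (x k \<bullet> x k))) \<longlonglongrightarrow> 0"
          by (intro tendsto_mult_right_zero xlim)
      qed
      obtain V where V: "zf_storage (L - m) (\<lambda>y. \<tau> *\<^sub>R f y) V" using f_zf[OF \<tau>] by blast
      have qeq: "?q k = ?r ^ Suc k \<cdot>\<^sub>v to_vec (\<tau> *\<^sub>R f (of_vec (\<rho> ^ k \<cdot>\<^sub>v (C *\<^sub>v x k))))" for k
        unfolding \<psi>_def to_vec_scaleR by (simp only: smult_smult_assoc mult.commute)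
      show ?thesis
      proof (rule bound[rule_format, OF _ _ xlim qlim D])
        show "x k \<in> carrier_vec ?N \<and> ?q k \<in> carrier_vec p \<and> d k \<in> carrier_vec ?N \<and>
            x (Suc k) = (?r \<cdot>\<^sub>v (?F *\<^sub>v x k) + B *\<^sub>v ?q k) + d k" for k
          unfolding step Gv[OF x] by (intro conjI x q d refl)
        show "0 \<le> (\<Sum>k<N. zf_term (\<lambda>j k. ?q j \<bullet> out_filter m L (?r \<cdot>\<^sub>v (C *\<^sub>v x k)) (?q k)) \<mu> lp lm k)" for N
          by (rule zames_falb_loop_signals[OF V \<rho> C[unfolded assms(2)] x[unfolded assms(2)] \<mu>_cond qeq])
      qed
    qed
    have base: "\<exists>E. \<forall>M. (\<Sum>k<M. x k \<bullet> x k) \<le> E"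
      if sol: "perturbed_loop ?G B (\<lambda>k v. 0 \<cdot>\<^sub>v \<psi> k v) x d" and D: "\<And>M. (\<Sum>k<M. d k \<bullet> d k) \<le> D" for x d D
    proof -
      have x: "x k \<in> carrier_vec ?N" and d: "d k \<in> carrier_vec ?N"
        and step: "x (Suc k) = (?G *\<^sub>v x k + B *\<^sub>v (0 \<cdot>\<^sub>v \<psi> k (x k))) + d k" for k
        using sol unfolding perturbed_loop_def carrier_matD(1)[OF G] by blast+
      \<comment> \<open>At \<tau> = 0 the loop is linear, and the eigenvalue assumption on A + m B C
        applies.\<close>
      have B0: "B *\<^sub>v (0 \<cdot>\<^sub>v \<psi> k (x k)) = 0\<^sub>v ?N" for k
      proof -
        have "B *\<^sub>v (0 \<cdot>\<^sub>v \<psi> k (x k)) = 0 \<cdot>\<^sub>v (B *\<^sub>v \<psi> k (x k))" by (rule mult_mat_vec[OF B \<psi>])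
        also have "\<dots> = 0\<^sub>v ?N" using carrier_matD(1)[OF B] by (intro eq_vecI) auto
        finally show ?thesis .
      qed
      show ?thesis
      proof (rule schur_recursion_square_summable[OF F N ev x d _ D])
        show "x (Suc k) = ?r \<cdot>\<^sub>v (?F *\<^sub>v x k) + d k" for k
          unfolding step B0 Gv[OF x]
          using right_zero_vec[OF smult_carrier_vec[THEN iffD2, OF mult_mat_vec_carrier[OF F x]]] by simp
      qed
    qed
    have \<xi>_step: "\<xi> (Suc k) = ?F *\<^sub>v \<xi> k + B *\<^sub>v to_vec (f (of_vec (C *\<^sub>v \<xi> k)))" for k
      using loop unfolding solves_loop_def \<Delta> Delta_op_def f_def by blast
    have w: "to_vec (f y) \<in> carrier_vec p" for y unfolding assms(2) by simp
    have \<xi>: "\<xi> k \<in> carrier_vec ?N" for k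
    proof (induction k)
      case 0
      then show ?case using loop unfolding solves_loop_def carrier_matD(2)[OF F] by blast
    next
      case (Suc k)
      show ?case
        unfolding \<xi>_step by (rule add_carrier_vec[OF mult_mat_vec_carrier[OF F Suc] mult_mat_vec_carrier[OF B w]])
    qed
    define x where "x k = ?r ^ k \<cdot>\<^sub>v \<xi> k" for k
    have x: "x k \<in> carrier_vec ?N" for k using \<xi> by (simp add: x_def)
    have sol: "perturbed_loop ?G B \<psi> x (\<lambda>_. 0\<^sub>v ?N)"
      unfolding perturbed_loop_def carrier_matD(1)[OF G]
    proof (intro conjI allI x zero_carrier_vec)
      fix k
      have "\<rho> ^ k \<cdot>\<^sub>v (C *\<^sub>v x k) = C *\<^sub>v \<xi> k"
        unfolding x_def mult_mat_vec[OF C \<xi>] smult_smult_assoc using \<rho> by (simp add: power_inverse)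
      then have \<psi>k: "\<psi> k (x k) = ?r ^ Suc k \<cdot>\<^sub>v to_vec (f (of_vec (C *\<^sub>v \<xi> k)))" unfolding \<psi>_def by simp
      note F\<xi> = mult_mat_vec_carrier[OF F \<xi>[of k]] and Bw = mult_mat_vec_carrier[OF B w]
      have "x (Suc k) = ?r ^ Suc k \<cdot>\<^sub>v (?F *\<^sub>v \<xi> k) + ?r ^ Suc k \<cdot>\<^sub>v (B *\<^sub>v to_vec (f (of_vec (C *\<^sub>v \<xi> k))))"
        unfolding x_def \<xi>_step by (rule smult_add_distrib_vec[OF F\<xi> Bw])
      also have "?r ^ Suc k \<cdot>\<^sub>v (?F *\<^sub>v \<xi> k) = ?G *\<^sub>v x k"
        unfolding Gv[OF x] unfolding x_def mult_mat_vec[OF F \<xi>] smult_smult_assoc by simp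
      also have "?r ^ Suc k \<cdot>\<^sub>v (B *\<^sub>v to_vec (f (of_vec (C *\<^sub>v \<xi> k)))) = B *\<^sub>v \<psi> k (x k)"
        unfolding \<psi>k by (rule mult_mat_vec[OF B w, symmetric])
      finally show "x (Suc k) = (?G *\<^sub>v x k + B *\<^sub>v \<psi> k (x k)) + 0\<^sub>v ?N"
        using right_zero_vec[OF add_carrier_vec[OF mult_mat_vec_carrier[OF G x] mult_mat_vec_carrier[OF B \<psi>]]] by simp
    qed
    have D0: "(\<Sum>k<M. 0\<^sub>v ?N \<bullet> 0\<^sub>v ?N) \<le> (0 :: real)" for M :: nat by (simp add: scalar_prod_self)
    have "\<exists>E. \<forall>M. (\<Sum>k<M. x k \<bullet> x k) \<le> E"
    proof (rule homotopy_square_summable[OF G B \<psi> gain b K _ _ sol D0], assumption, goal_cases)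
      case 1
      then show ?case by (rule apriori)
    next
      case 2
      then show ?case by (rule base)
    qed
    then obtain E where E: "\<And>M. (\<Sum>k<M. x k \<bullet> x k) \<le> E" by blast
    \<comment> \<open>E may depend on the trajectory. Now that summability is known, the a priori
      bound at \<tau> = 1 with zero disturbance replaces it by the uniform K.\<close>
    have sol1: "perturbed_loop ?G B (\<lambda>k v. 1 \<cdot>\<^sub>v \<psi> k v) x (\<lambda>_. 0\<^sub>v ?N)" using sol by simp
    have "x k0 \<bullet> x k0 \<le> (\<Sum>k<Suc k0. x k \<bullet> x k)"
      by (rule member_le_sum) (auto simp: scalar_prod_self_nonneg)
    also have "\<dots> \<le> K * (x 0 \<bullet> x 0 + 0)"
      by (rule apriori[OF _ _ sol1 D0 E]) simp_all
    also have "x 0 = \<xi> 0" by (simp add: x_def)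
    finally have x_le: "x k0 \<bullet> x k0 \<le> K * (\<xi> 0 \<bullet> \<xi> 0)" by simp
    have "\<xi> k0 = \<rho> ^ k0 \<cdot>\<^sub>v x k0" unfolding x_def smult_smult_assoc using \<rho> by (simp add: power_inverse)
    then have "\<xi> k0 \<bullet> \<xi> k0 = \<rho> ^ (2 * k0) * (x k0 \<bullet> x k0)"
      by (simp only: scalar_prod_self_smult power_mult[symmetric] mult.commute)
    also have "\<dots> \<le> \<rho> ^ (2 * k0) * (K * (\<xi> 0 \<bullet> \<xi> 0))"
      using x_le \<rho> by (intro mult_left_mono) auto
    finally show "\<xi> k0 \<bullet> \<xi> k0 \<le> K * \<rho> ^ (2 * k0) * (\<xi> 0 \<bullet> \<xi> 0)" by (simp add: mult_ac)
  qed
qed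

end
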